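(* Let $(M^n,\mathrm g)$ be a closed Riemannian spin manifold with curvature operator $R$, let $\mathsf G$ be a connected compact Lie subgroup of $\mathsf{Spin}(n)$ containing $\mathrm{Hol}(M^n,\mathrm g)$ (lifted to $\mathsf{Spin}(n)$), let $\pi$ be a unitary $\mathsf G$-representation with associated complex vector bundle $E_\pi\to M$, and let $S\to M$ be the complex spinor bundle, associated to the spinor representation $\pi_S$. Let $D_\pi$ be the Dirac operator on $S\otimes E_\pi$, so that $D_\pi^2=\nabla^*\nabla+\mathcal R_\pi$, where $$\mathcal R_\pi=\sum_{i<j}(e_ie_j\otimes1)\circ R^{S\otimes E_\pi}_{e_i,e_j}.$$ Then $$\mathcal R_\pi=K(R,\pi_S\otimes\pi)+\tfrac{\mathrm{scal}}8\operatorname{Id}-1\otimes K(R,\pi).$$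
   Context: $\{e_i\}$ is a local orthonormal frame of $TM$ and $e_ie_j$ acts on $S$ by Clifford multiplication. $E_\pi$ is the bundle associated via $\pi$ to the reduction to $\mathsf G$ of the spin frame bundle of $M$, with connection induced by the Levi-Civita connection, and $S\otimes E_\pi$ is the bundle associated to $\pi_S\otimes\pi$, with curvature tensor $R^{S\otimes E_\pi}$. The conventions are: $\mathrm d\pi_S(e_i\wedge e_j)=\frac12e_ie_j$ under $\mathfrak{so}(n)\cong\wedge^2\mathbb R^n$, and $R^{S\otimes E_\pi}_{e_i,e_j}=-\mathrm d(\pi_S\otimes\pi)(R(e_i\wedge e_j))$, where $R\colon\wedge^2TM\to\wedge^2TM$ is the curvature operator (equal to $\operatorname{Id}$ on the unit round sphere), whose image lies in the Lie algebra $\mathfrak g\subset\mathfrak{so}(n)$ of $\mathsf G$ since $\mathrm{Hol}(M,\mathrm g)\subset\mathsf G$. For a $\mathsf G$-representation $\sigma$, $K(R,\sigma)=-\sum_a\mathrm d\sigma(R(X_a))\circ\mathrm d\sigma(X_a)$, with $\{X_a\}$ an orthonormal basis of $\mathfrak g$ for the inner product $\langle X,Y\rangle=\frac12\operatorname{Re}\operatorname{tr}XY^*$, viewed as an endomorphism of the bundle associated to $\sigma$. *)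

theory Defs
  imports "HOL-Analysis.Analysis"
begin

section \<open>The real Clifford algebra of Euclidean space\<close>

text \<open>
  An element is given by its coefficients in the basis \<open>e\<^sub>A = e\<^sub>i\<^sub>1 \<cdots> e\<^sub>i\<^sub>k\<close>, where
  \<open>A = {i\<^sub>1 < \<dots> < i\<^sub>k}\<close> ranges over the subsets of the index type. The relations are
  \<open>e\<^sub>i e\<^sub>j + e\<^sub>j e\<^sub>i = -2 \<delta>\<^sub>i\<^sub>j\<close>; in \<open>e\<^sub>A e\<^sub>B = \<plusminus>e\<^sub>A\<^sub>\<Delta>\<^sub>B\<close> each pair \<open>i \<in> A\<close>, \<open>j \<in> B\<close> with
  \<open>j < i\<close> (a transposition) or \<open>j = i\<close> (a square) contributes one sign.
\<close>

typedef 'n cliff = "UNIV :: ('n set \<Rightarrow> real) set"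
  morphisms coeff Cliff ..

lemma coeff_Cliff [simp]: "coeff (Cliff f) = f"
  by (simp add: Cliff_inverse)

lemma cliff_eqI: "(\<And>A. coeff a A = coeff b A) \<Longrightarrow> a = b"
  by (metis coeff_inject ext)

definition csign :: "'n::{finite,linorder} set \<Rightarrow> 'n set \<Rightarrow> real" where
  "csign A B = (-1) ^ card {(i, j). i \<in> A \<and> j \<in> B \<and> j \<le> i}"

lemma csign_prod: "csign A B = (\<Prod>i\<in>A. \<Prod>j\<in>B. if j \<le> i then -1 else 1)"
proof -
  have "(\<Prod>i\<in>A. \<Prod>j\<in>B. if j \<le> i then -1 else (1::real))
      = (\<Prod>z\<in>A \<times> B. if snd z \<le> fst z then -1 else 1)"
    by (simp add: prod.cartesian_product case_prod_beta)
  also have "\<dots> = (\<Prod>z\<in>{z \<in> A \<times> B. snd z \<le> fst z}. -1)"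
    by (rule prod.mono_neutral_cong_right) auto
  also have "\<dots> = (-1) ^ card {z \<in> A \<times> B. snd z \<le> fst z}"
    by simp
  also have "{z \<in> A \<times> B. snd z \<le> fst z} = {(i, j). i \<in> A \<and> j \<in> B \<and> j \<le> i}"
    by auto
  finally show ?thesis
    by (simp add: csign_def)
qed

lemma prod_sign_sym_diff:
  fixes f :: "'a::finite \<Rightarrow> real"
  assumes "\<And>i. f i * f i = 1"
  shows "prod f (sym_diff A B) = prod f A * prod f B"
proof -
  have fin: "finite X" for X :: "'a set" by simp
  have "prod f A = prod f (A - B) * prod f (A \<inter> B)"
    using prod.Int_Diff [OF fin, of f A B] by (simp add: mult.commute)
  moreover have "prod f B = prod f (B - A) * prod f (A \<inter> B)"
    using prod.Int_Diff [OF fin, of f B A] by (simp add: mult.commute Int_commute)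
  moreover have "prod f (A \<inter> B) * prod f (A \<inter> B) = 1"
    by (simp add: prod.distrib [symmetric] assms)
  moreover have "prod f (sym_diff A B) = prod f (A - B) * prod f (B - A)"
    by (rule prod.union_disjoint) auto
  ultimately show ?thesis
    by (simp add: mult.assoc mult.left_commute)
qed

lemma csign_sym_diff_left: "csign (sym_diff A B) C = csign A C * csign B C"
  unfolding csign_prod
  by (rule prod_sign_sym_diff) (auto simp: prod.distrib [symmetric] intro!: prod.neutral)

lemma csign_sym_diff_right: "csign C (sym_diff A B) = csign C A * csign C B"
proof -
  have "(\<Prod>j\<in>sym_diff A B. if j \<le> i then -1 else (1::real))
      = (\<Prod>j\<in>A. if j \<le> i then -1 else 1) * (\<Prod>j\<in>B. if j \<le> i then -1 else 1)" for i
    by (rule prod_sign_sym_diff) auto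
  then show ?thesis
    by (simp add: csign_prod prod.distrib)
qed

lemma csign_empty [simp]: "csign {} A = 1" "csign A {} = 1"
  by (simp_all add: csign_prod)

lemma abs_csign [simp]: "\<bar>csign A B\<bar> = 1"
  by (simp add: csign_def)

lemma sum_sym_diff_reindex:
  fixes f :: "'n::finite set \<Rightarrow> real"
  shows "(\<Sum>B\<in>UNIV. f (sym_diff A B)) = (\<Sum>B\<in>UNIV. f B)"
proof -
  have inv: "sym_diff A (sym_diff A B) = B" for B by auto
  then have "bij (sym_diff A)"
    by (intro o_bij [of "sym_diff A" "sym_diff A"]) (auto simp only: fun_eq_iff o_apply id_apply)
  then show ?thesis
    by (rule sum.reindex_bij_betw)
qed

text \<open>The norm is the \<open>\<ell>\<^sup>1\<close> norm of the coefficients, which is submultiplicative; only the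
  topology it induces on the finite-dimensional algebra matters.\<close>

instantiation cliff :: ("{finite,linorder}") real_normed_algebra_1
begin

definition "0 = Cliff (\<lambda>_. 0)"
definition "1 = Cliff (\<lambda>A. if A = {} then 1 else 0)"
definition "a + b = Cliff (\<lambda>A. coeff a A + coeff b A)"
definition "a - b = Cliff (\<lambda>A. coeff a A - coeff b A)"
definition "- a = Cliff (\<lambda>A. - coeff a A)"
definition "a * b =
  Cliff (\<lambda>C. \<Sum>A\<in>UNIV. csign A (sym_diff A C) * coeff a A * coeff b (sym_diff A C))"
definition "r *\<^sub>R a = Cliff (\<lambda>A. r * coeff a A)"
definition "norm a = (\<Sum>A\<in>UNIV. \<bar>coeff a A\<bar>)"
definition "sgn (a::'a cliff) = inverse (norm a) *\<^sub>R a"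
definition "dist (a::'a cliff) b = norm (a - b)"
definition "(uniformity :: ('a cliff \<times> 'a cliff) filter) =
  (INF e\<in>{0 <..}. principal {(x, y). dist x y < e})"
definition "open (U :: 'a cliff set) \<longleftrightarrow>
  (\<forall>x\<in>U. eventually (\<lambda>(x', y). x' = x \<longrightarrow> y \<in> U) uniformity)"

lemma coeff_simps [simp]:
  "coeff (0::'a cliff) A = 0"
  "coeff (1::'a cliff) A = (if A = {} then 1 else 0)"
  "coeff (a + b) A = coeff a A + coeff (b::'a cliff) A"
  "coeff (a - b) A = coeff a A - coeff (b::'a cliff) A"
  "coeff (- a) A = - coeff (a::'a cliff) A"
  "coeff (r *\<^sub>R a) A = r * coeff (a::'a cliff) A"
  by (simp_all add: zero_cliff_def one_cliff_def plus_cliff_def minus_cliff_def uminus_cliff_def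
      scaleR_cliff_def)

lemma coeff_times:
  "coeff (a * b) C
    = (\<Sum>A\<in>UNIV. csign A (sym_diff A C) * coeff a A * coeff (b::'a cliff) (sym_diff A C))"
  by (simp add: times_cliff_def)

instance
proof
  fix a b c :: "'a cliff" and r s :: real
  show "a + b + c = a + (b + c)" "a + b = b + a" "0 + a = a" "- a + a = 0" "a - b = a + - b"
    by (rule cliff_eqI; simp)+
  show "r *\<^sub>R (a + b) = r *\<^sub>R a + r *\<^sub>R b" "(r + s) *\<^sub>R a = r *\<^sub>R a + s *\<^sub>R a"
    "r *\<^sub>R s *\<^sub>R a = (r * s) *\<^sub>R a" "1 *\<^sub>R a = a"
    by (rule cliff_eqI; simp add: algebra_simps)+
  show "(a + b) * c = a * c + b * c" "a * (b + c) = a * b + a * c"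
    by (rule cliff_eqI; simp add: coeff_times algebra_simps sum.distrib)+
  show "r *\<^sub>R a * b = r *\<^sub>R (a * b)" "a * r *\<^sub>R b = r *\<^sub>R (a * b)"
    by (rule cliff_eqI; simp add: coeff_times sum_distrib_left algebra_simps)+
  show "1 * a = a"
  proof (rule cliff_eqI)
    fix C
    have "coeff (1 * a) C
        = (\<Sum>A\<in>UNIV. if A = {} then csign A (sym_diff A C) * coeff a (sym_diff A C) else 0)"
      unfolding coeff_times by (rule sum.cong) auto
    then show "coeff (1 * a) C = coeff a C" by simp
  qed
  show "a * 1 = a"
  proof (rule cliff_eqI)
    fix C
    have "coeff (a * 1) C = (\<Sum>A\<in>UNIV. if A = C then csign A (sym_diff A C) * coeff a A else 0)"
      unfolding coeff_times by (rule sum.cong) auto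
    then show "coeff (a * 1) C = coeff a C" by simp
  qed
  show "(a * b) * c = a * (b * c)"
  proof (rule cliff_eqI)
    fix D
    have "coeff ((a * b) * c) D = (\<Sum>E\<in>UNIV. \<Sum>A\<in>UNIV. csign E (sym_diff E D) *
        (csign A (sym_diff A E) * coeff a A * coeff b (sym_diff A E)) * coeff c (sym_diff E D))"
      by (simp add: coeff_times sum_distrib_left sum_distrib_right)
    also have "\<dots> = (\<Sum>A\<in>UNIV. \<Sum>E\<in>UNIV. csign E (sym_diff E D) *
        (csign A (sym_diff A E) * coeff a A * coeff b (sym_diff A E)) * coeff c (sym_diff E D))"
      by (rule sum.swap)
    also have "\<dots> = (\<Sum>A\<in>UNIV. \<Sum>B\<in>UNIV.
        csign (sym_diff A B) (sym_diff (sym_diff A B) D) *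
        (csign A (sym_diff A (sym_diff A B)) * coeff a A * coeff b (sym_diff A (sym_diff A B)))
          * coeff c (sym_diff (sym_diff A B) D))"
      by (rule sum.cong [OF refl], rule sum_sym_diff_reindex [symmetric])
    also have "\<dots> = (\<Sum>A\<in>UNIV. \<Sum>B\<in>UNIV. csign A (sym_diff A D) * coeff a A *
        (csign B (sym_diff B (sym_diff A D)) * coeff b B * coeff c (sym_diff B (sym_diff A D))))"
    proof (intro sum.cong refl)
      fix A B :: "'a set"
      have 1: "sym_diff A (sym_diff A B) = B" by auto
      have 2: "sym_diff (sym_diff A B) D = sym_diff B (sym_diff A D)" by auto
      have 3: "sym_diff A D = sym_diff B (sym_diff B (sym_diff A D))" by auto
      have 4: "csign A (sym_diff A D) = csign A B * csign A (sym_diff B (sym_diff A D))"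
        using csign_sym_diff_right [of A B "sym_diff B (sym_diff A D)"] 3 by simp
      show "csign (sym_diff A B) (sym_diff (sym_diff A B) D) *
          (csign A (sym_diff A (sym_diff A B)) * coeff a A * coeff b (sym_diff A (sym_diff A B)))
            * coeff c (sym_diff (sym_diff A B) D)
        = csign A (sym_diff A D) * coeff a A *
          (csign B (sym_diff B (sym_diff A D)) * coeff b B * coeff c (sym_diff B (sym_diff A D)))"
        unfolding 1 2 4 csign_sym_diff_left by (simp only: mult_ac)
    qed
    also have "\<dots> = coeff (a * (b * c)) D"
      by (simp only: coeff_times sum_distrib_left sum_distrib_right)
    finally show "coeff ((a * b) * c) D = coeff (a * (b * c)) D" .
  qed
  show "(0::'a cliff) \<noteq> 1"
  proof
    assume "(0::'a cliff) = 1"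
    then have "coeff (0::'a cliff) {} = coeff (1::'a cliff) {}" by (rule arg_cong)
    then show False by simp
  qed
  show "dist a b = norm (a - b)" "sgn a = inverse (norm a) *\<^sub>R a"
    by (simp_all add: dist_cliff_def sgn_cliff_def)
  show "uniformity = (INF e\<in>{0<..}. principal {(x, y::'a cliff). dist x y < e})"
    by (rule uniformity_cliff_def)
  show "open U \<longleftrightarrow> (\<forall>x\<in>U. eventually (\<lambda>(x', y). x' = x \<longrightarrow> y \<in> U) uniformity)"
    for U :: "'a cliff set"
    by (rule open_cliff_def)
  show "norm a = 0 \<longleftrightarrow> a = 0"
  proof
    assume "norm a = 0"
    then show "a = 0"
      by (intro cliff_eqI) (simp add: norm_cliff_def sum_nonneg_eq_0_iff)
  qed (simp add: norm_cliff_def)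
  show "norm (a + b) \<le> norm a + norm b"
    by (simp add: norm_cliff_def sum.distrib [symmetric] sum_mono)
  show "norm (r *\<^sub>R a) = \<bar>r\<bar> * norm a"
    by (simp add: norm_cliff_def abs_mult sum_distrib_left)
  show "norm (1::'a cliff) = 1"
  proof -
    have "norm (1::'a cliff) = (\<Sum>A\<in>(UNIV::'a set set). if A = {} then 1 else 0)"
      unfolding norm_cliff_def by (rule sum.cong) auto
    then show ?thesis by simp
  qed
  show "norm (a * b) \<le> norm a * norm b"
  proof -
    have "norm (a * b) \<le> (\<Sum>C\<in>UNIV. \<Sum>A\<in>UNIV. \<bar>coeff a A\<bar> * \<bar>coeff b (sym_diff A C)\<bar>)"
      unfolding norm_cliff_def coeff_times
      by (intro sum_mono order_trans [OF sum_abs]) (simp add: abs_mult)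
    also have "\<dots> = (\<Sum>A\<in>UNIV. \<Sum>C\<in>UNIV. \<bar>coeff a A\<bar> * \<bar>coeff b (sym_diff A C)\<bar>)"
      by (rule sum.swap)
    also have "\<dots> = (\<Sum>A\<in>UNIV. \<bar>coeff a A\<bar> * (\<Sum>C\<in>UNIV. \<bar>coeff b C\<bar>))"
      using sum_sym_diff_reindex [of "\<lambda>C. \<bar>coeff b C\<bar>"] by (simp add: sum_distrib_left [symmetric])
    also have "\<dots> = norm a * norm b"
      by (simp add: norm_cliff_def sum_distrib_right)
    finally show ?thesis .
  qed
qed

end

instance cliff :: ("{finite,linorder}") banach
proof
  fix X :: "nat \<Rightarrow> 'a cliff"
  assume X: "Cauchy X"
  have le: "\<bar>coeff a A\<bar> \<le> norm a" for a :: "'a cliff" and A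
    unfolding norm_cliff_def by (rule member_le_sum) auto
  have "Cauchy (\<lambda>n. coeff (X n) A)" for A
  proof (rule metric_CauchyI)
    fix e :: real assume "0 < e"
    then obtain N where N: "\<And>m n. m \<ge> N \<Longrightarrow> n \<ge> N \<Longrightarrow> dist (X m) (X n) < e"
      using metric_CauchyD [OF X] by blast
    have "dist (coeff (X m) A) (coeff (X n) A) \<le> dist (X m) (X n)" for m n
      using le [of "X m - X n" A] by (simp add: dist_norm)
    then show "\<exists>N. \<forall>m\<ge>N. \<forall>n\<ge>N. dist (coeff (X m) A) (coeff (X n) A) < e"
      using N by (meson le_less_trans)
  qed
  then have conv: "(\<lambda>n. coeff (X n) A) \<longlonglongrightarrow> lim (\<lambda>n. coeff (X n) A)" for A
    using Cauchy_convergent convergent_LIMSEQ_iff by blast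
  let ?L = "Cliff (\<lambda>A. lim (\<lambda>n. coeff (X n) A))"
  have "(\<lambda>n. \<Sum>A\<in>UNIV. \<bar>coeff (X n) A - lim (\<lambda>n. coeff (X n) A)\<bar>) \<longlonglongrightarrow> (\<Sum>A\<in>(UNIV::'a set set). 0)"
    by (intro tendsto_sum tendsto_rabs_zero LIM_zero conv)
  then have "(\<lambda>n. norm (X n - ?L)) \<longlonglongrightarrow> 0"
    by (simp add: norm_cliff_def)
  then have "X \<longlonglongrightarrow> ?L"
    by (rule LIM_zero_cancel [OF tendsto_norm_zero_cancel])
  then show "convergent X"
    by (auto simp: convergent_def)
qed

text \<open>Synonyms for \<open>real^'n\<close> and \<open>real^'n^'n\<close>, whose own syntax would force the sort of \<open>'n\<close>.\<close>

type_synonym 'n rvec = "(real, 'n) vec"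
type_synonym 'n rmat = "((real, 'n) vec, 'n) vec"

definition cliff_basis :: "'n::{finite,linorder} set \<Rightarrow> 'n cliff" where
  "cliff_basis A = Cliff (\<lambda>B. if B = A then 1 else 0)"

definition cvec :: "'n::{finite,linorder} rvec \<Rightarrow> 'n cliff" where
  "cvec v = (\<Sum>i\<in>UNIV. v $ i *\<^sub>R cliff_basis {i})"

lemma cliff_basis_mult:
  "cliff_basis A * cliff_basis B = csign A B *\<^sub>R cliff_basis (sym_diff A B)"
proof (rule cliff_eqI)
  fix C
  have "coeff (cliff_basis A * cliff_basis B) C
      = (\<Sum>D\<in>UNIV. if D = A then (if sym_diff A C = B then csign A B else 0) else 0)"
    unfolding coeff_times cliff_basis_def by (rule sum.cong) auto
  also have "\<dots> = (if sym_diff A C = B then csign A B else 0)"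
    by simp
  also have "(sym_diff A C = B) = (C = sym_diff A B)"
    by blast
  finally show "coeff (cliff_basis A * cliff_basis B) C
      = coeff (csign A B *\<^sub>R cliff_basis (sym_diff A B)) C"
    by (simp add: cliff_basis_def)
qed

lemma clifford_relation:
  "cliff_basis {i} * cliff_basis {j} + cliff_basis {j} * cliff_basis {i} = (if i = j then -2 else 0)"
proof (cases "i = j")
  case True
  have "cliff_basis {j} * cliff_basis {j} = - (1::'a cliff)"
    by (rule cliff_eqI) (simp add: cliff_basis_mult csign_prod, simp add: cliff_basis_def)
  then show ?thesis
    using True by simp
next
  case False
  then have "csign {i} {j} = - csign {j} {i}"
    by (auto simp: csign_prod)
  moreover have "sym_diff {i} {j} = sym_diff {j} {i}"
    by blast
  ultimately show ?thesis
    using False by (simp add: cliff_basis_mult)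
qed

text \<open>The anti-automorphism fixing the vectors; on \<open>Spin(n)\<close> it is the inverse.\<close>

definition reversal :: "'n::{finite,linorder} cliff \<Rightarrow> 'n cliff" where
  "reversal a = Cliff (\<lambda>A. (-1) ^ (card A * (card A - 1) div 2) * coeff a A)"

definition spin_group :: "'n::{finite,linorder} cliff set" where
  "spin_group = {a. (\<forall>A. odd (card A) \<longrightarrow> coeff a A = 0) \<and> a * reversal a = 1 \<and> reversal a * a = 1 \<and>
    (\<forall>v. \<exists>w. a * cvec v * reversal a = cvec w)}"

text \<open>The matrix of the covering homomorphism \<open>v \<mapsto> a v a\<^sup>-\<^sup>1\<close> onto \<open>SO(n)\<close>.\<close>

definition spin_cover :: "'n::{finite,linorder} cliff \<Rightarrow> 'n rmat" where
  "spin_cover a = (\<chi> i j. coeff (a * cliff_basis {j} * reversal a) {i})"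

section \<open>Lie algebras and representations of subgroups of \<open>Spin(n)\<close>\<close>

definition compact_connected_subgroup :: "'n::{finite,linorder} cliff set \<Rightarrow> bool" where
  "compact_connected_subgroup G \<longleftrightarrow> G \<subseteq> spin_group \<and> 1 \<in> G \<and> (\<forall>a\<in>G. \<forall>b\<in>G. a * b \<in> G) \<and>
    (\<forall>a\<in>G. reversal a \<in> G) \<and> compact G \<and> connected G"

text \<open>Under \<open>\<wedge>\<^sup>2 \<real>\<^sup>n \<cong> so(n)\<close> the bivector \<open>v \<wedge> w\<close> is \<open>z \<mapsto> \<langle>v,z\<rangle>w - \<langle>w,z\<rangle>v\<close>. With this sign
  \<open>e\<^sub>i \<wedge> e\<^sub>j\<close> is the image of \<open>e\<^sub>i e\<^sub>j / 2\<close> under the derivative of \<open>spin_cover\<close>;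
  \<open>spin_lift\<close> is the inverse of that derivative.\<close>

definition wedge :: "'n::finite rvec \<Rightarrow> 'n rvec \<Rightarrow> 'n rmat" where
  "wedge v w = (\<chi> a b. v $ b * w $ a - w $ b * v $ a)"

definition spin_lift :: "'n::{finite,linorder} rmat \<Rightarrow> 'n cliff" where
  "spin_lift X =
    (\<Sum>i\<in>UNIV. \<Sum>j\<in>{i<..}. X $ j $ i *\<^sub>R ((1/2) *\<^sub>R (cliff_basis {i} * cliff_basis {j})))"

definition lie_algebra :: "'n::{finite,linorder} cliff set \<Rightarrow> ('n rmat) set" where
  "lie_algebra G = {X. transpose X = - X \<and> (\<forall>t. exp (t *\<^sub>R spin_lift X) \<in> G)}"

definition so_inner :: "'n::finite rmat \<Rightarrow> 'n rmat \<Rightarrow> real" where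
  "so_inner X Y = (1/2) * trace (X ** transpose Y)"

definition orthonormal_basis :: "('n::finite rmat) set \<Rightarrow> ('n rmat) set \<Rightarrow> bool" where
  "orthonormal_basis B V \<longleftrightarrow> B \<subseteq> V \<and> span B = V \<and>
    (\<forall>X\<in>B. \<forall>Y\<in>B. so_inner X Y = (if X = Y then 1 else 0))"

text \<open>Representations are matrix-valued functions on the Clifford algebra of which only the values
  on the group matter. Continuous representations are automatically smooth.\<close>

definition conj_transpose :: "complex^'k^'k \<Rightarrow> complex^'k^'k" where
  "conj_transpose A = (\<chi> i j. cnj (A $ j $ i))"

definition unitary_rep :: "'n::{finite,linorder} cliff set \<Rightarrow> ('n cliff \<Rightarrow> complex^'k^'k) \<Rightarrow> bool" where
  "unitary_rep G \<sigma> \<longleftrightarrow> continuous_on G \<sigma> \<and> \<sigma> 1 = mat 1 \<and> (\<forall>a\<in>G. \<forall>b\<in>G. \<sigma> (a * b) = \<sigma> a ** \<sigma> b) \<and>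
    (\<forall>a\<in>G. \<sigma> a ** conj_transpose (\<sigma> a) = mat 1)"

definition d_rep :: "('n::{finite,linorder} cliff \<Rightarrow> complex^'r^'r) \<Rightarrow> 'n rmat \<Rightarrow> complex^'r^'r" where
  "d_rep \<sigma> X = vector_derivative (\<lambda>t. \<sigma> (exp (t *\<^sub>R spin_lift X))) (at 0)"

text \<open>An irreducible complex module over the Clifford algebra. Its restriction to \<open>Spin(n)\<close> is the
  complex spinor representation; for odd \<open>n\<close> the two irreducible modules restrict to
  equivalent representations.\<close>

definition spinor_module :: "('n::{finite,linorder} cliff \<Rightarrow> complex^'s^'s) \<Rightarrow> bool" where
  "spinor_module \<rho> \<longleftrightarrow> linear \<rho> \<and> \<rho> 1 = mat 1 \<and> (\<forall>a b. \<rho> (a * b) = \<rho> a ** \<rho> b) \<and>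
    (\<forall>W. vec.subspace W \<and> (\<forall>a. \<forall>\<psi>\<in>W. \<rho> a *v \<psi> \<in> W) \<longrightarrow> W = {0} \<or> W = UNIV)"

definition kron :: "complex^'s^'s \<Rightarrow> complex^'k^'k \<Rightarrow> complex^('s \<times> 'k)^('s \<times> 'k)" where
  "kron A B = (\<chi> p q. A $ fst p $ fst q * B $ snd p $ snd q)"

definition tensor_rep :: "('n cliff \<Rightarrow> complex^'s^'s) \<Rightarrow> ('n cliff \<Rightarrow> complex^'k^'k)
    \<Rightarrow> 'n cliff \<Rightarrow> complex^('s \<times> 'k)^('s \<times> 'k)" where
  "tensor_rep \<sigma> \<tau> a = kron (\<sigma> a) (\<tau> a)"

section \<open>Closed Riemannian spin manifolds\<close>

text \<open>Iterated Frechet differentiability; used for open \<open>S\<close> only.\<close>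

primrec Ck_on :: "nat \<Rightarrow> 'a::real_normed_vector set \<Rightarrow> ('a \<Rightarrow> 'b::real_normed_vector) \<Rightarrow> bool" where
  "Ck_on 0 S f \<longleftrightarrow> continuous_on S f"
| "Ck_on (Suc k) S f \<longleftrightarrow>
    f differentiable_on S \<and> (\<forall>v. Ck_on k S (\<lambda>x. frechet_derivative f (at x) v))"

definition smooth_on :: "'a::real_normed_vector set \<Rightarrow> ('a \<Rightarrow> 'b::real_normed_vector) \<Rightarrow> bool" where
  "smooth_on S f \<longleftrightarrow> (\<forall>k. Ck_on k S f)"

type_synonym ('m, 'n) chart = "'m set \<times> ('m \<Rightarrow> 'n rvec)"

text \<open>
  The points of the manifold are the elements of the topological space \<open>'m\<close>, the spin frames those of
  \<open>'p\<close>. Tangent vectors, the metric and frames are given by their components in the charts: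
  \<open>gram M c y\<close> is the Gram matrix of the coordinate fields of the chart \<open>c\<close> at the
  point with coordinates \<open>y\<close>, and the columns of \<open>frame M c p\<close> are the coordinate
  vectors, in the chart \<open>c\<close>, of the orthonormal frame of the tangent space at \<open>base M p\<close>
  underlying the spin frame \<open>p\<close>.
\<close>

record ('m, 'n, 'p) spin_data =
  charts :: "('m, 'n::finite) chart set"
  gram :: "('m, 'n) chart \<Rightarrow> 'n rvec \<Rightarrow> 'n rmat"
  base :: "'p \<Rightarrow> 'm"
  act :: "'p \<Rightarrow> 'n cliff \<Rightarrow> 'p"
  frame :: "('m, 'n) chart \<Rightarrow> 'p \<Rightarrow> 'n rmat"

text \<open>
  The orientation is the one for which the frames underlying the spin frames are positive.
  The equivariant map from spin frames to orthonormal frames is a covering, so the total space of the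
  spin structure carries the smooth structure pulled back from the frame bundle; a continuous local
  section is smooth iff its underlying frame field is.
\<close>

locale closed_spin_manifold =
  fixes M :: "('m::t2_space, 'n::{finite,linorder}, 'p::topological_space) spin_data"
  assumes compact: "compact (UNIV :: 'm set)"
    and connected: "connected (UNIV :: 'm set)"
    and charts_cover: "(\<Union>(D, \<phi>)\<in>charts M. D) = UNIV"
    and chart_homeo: "(D, \<phi>) \<in> charts M \<Longrightarrow>
      open D \<and> open (\<phi> ` D) \<and> homeomorphism D (\<phi> ` D) \<phi> (inv_into D \<phi>)"
    and transition_smooth: "(D, \<phi>) \<in> charts M \<Longrightarrow> (D', \<phi>') \<in> charts M \<Longrightarrow>
      smooth_on (\<phi> ` (D \<inter> D')) (\<phi>' \<circ> inv_into D \<phi>)"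
    and gram_smooth: "(D, \<phi>) \<in> charts M \<Longrightarrow> smooth_on (\<phi> ` D) (gram M (D, \<phi>))"
    and gram_sym: "(D, \<phi>) \<in> charts M \<Longrightarrow> x \<in> D \<Longrightarrow>
      transpose (gram M (D, \<phi>) (\<phi> x)) = gram M (D, \<phi>) (\<phi> x)"
    and gram_pos: "(D, \<phi>) \<in> charts M \<Longrightarrow> x \<in> D \<Longrightarrow> v \<noteq> 0 \<Longrightarrow>
      v \<bullet> (gram M (D, \<phi>) (\<phi> x) *v v) > 0"
    and gram_transition: "(D, \<phi>) \<in> charts M \<Longrightarrow> (D', \<phi>') \<in> charts M \<Longrightarrow> x \<in> D \<inter> D' \<Longrightarrow>
      J = jacobian (\<phi>' \<circ> inv_into D \<phi>) (at (\<phi> x)) \<Longrightarrow>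
      gram M (D, \<phi>) (\<phi> x) = transpose J ** gram M (D', \<phi>') (\<phi>' x) ** J"
    and act_base: "a \<in> spin_group \<Longrightarrow> base M (act M p a) = base M p"
    and act_one: "act M p 1 = p"
    and act_mult: "a \<in> spin_group \<Longrightarrow> b \<in> spin_group \<Longrightarrow> act M p (a * b) = act M (act M p a) b"
    and act_simply_transitive: "base M p = base M q \<Longrightarrow> \<exists>!a. a \<in> spin_group \<and> q = act M p a"
    and locally_trivial: "\<exists>U s h. open U \<and> x \<in> U \<and> (\<forall>y\<in>U. base M (s y) = y) \<and>
      homeomorphism (U \<times> spin_group) (base M -` U) (\<lambda>(y, a). act M (s y) a) h \<and> open (base M -` U) \<and>
      (\<forall>(D, \<phi>)\<in>charts M. smooth_on (\<phi> ` (D \<inter> U)) (\<lambda>y. frame M (D, \<phi>) (s (inv_into D \<phi> y))))"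
    and frame_orthonormal: "(D, \<phi>) \<in> charts M \<Longrightarrow> base M p \<in> D \<Longrightarrow>
      transpose (frame M (D, \<phi>) p) ** gram M (D, \<phi>) (\<phi> (base M p)) ** frame M (D, \<phi>) p = mat 1"
    and frame_transition: "(D, \<phi>) \<in> charts M \<Longrightarrow> (D', \<phi>') \<in> charts M \<Longrightarrow> base M p \<in> D \<inter> D' \<Longrightarrow>
      J = jacobian (\<phi>' \<circ> inv_into D \<phi>) (at (\<phi> (base M p))) \<Longrightarrow>
      frame M (D', \<phi>') p = J ** frame M (D, \<phi>) p"
    and frame_equivariant: "(D, \<phi>) \<in> charts M \<Longrightarrow> base M p \<in> D \<Longrightarrow> a \<in> spin_group \<Longrightarrow>
      frame M (D, \<phi>) (act M p a) = frame M (D, \<phi>) p ** spin_cover a"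

section \<open>Levi-Civita connection and curvature\<close>

definition partial :: "'n::finite \<Rightarrow> ('n rvec \<Rightarrow> 'b::real_normed_vector) \<Rightarrow> 'n rvec \<Rightarrow> 'b" where
  "partial i f y = frechet_derivative f (at y) (axis i 1)"

text \<open>The entry \<open>(k, j)\<close> of \<open>christoffel M c y i\<close> is \<open>\<Gamma>\<^sup>k\<^sub>i\<^sub>j\<close>.\<close>

definition christoffel ::
    "('m, 'n::finite, 'p) spin_data \<Rightarrow> ('m, 'n) chart \<Rightarrow> 'n rvec \<Rightarrow> 'n \<Rightarrow> 'n rmat" where
  "christoffel M c y i = (\<chi> k j. (1/2) * (\<Sum>l\<in>UNIV. matrix_inv (gram M c y) $ k $ l *
     (partial i (\<lambda>z. gram M c z $ j $ l) y + partial j (\<lambda>z. gram M c z $ i $ l) y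
       - partial l (\<lambda>z. gram M c z $ i $ j) y)))"

text \<open>\<open>R\<^sub>X\<^sub>,\<^sub>Y = \<nabla>\<^sub>X\<nabla>\<^sub>Y - \<nabla>\<^sub>Y\<nabla>\<^sub>X - \<nabla>\<^sub>[\<^sub>X\<^sub>,\<^sub>Y\<^sub>]\<close> for coordinate fields, then extended bilinearly.\<close>

definition riemann_coord ::
    "('m, 'n::finite, 'p) spin_data \<Rightarrow> ('m, 'n) chart \<Rightarrow> 'n rvec \<Rightarrow> 'n \<Rightarrow> 'n \<Rightarrow> 'n rmat" where
  "riemann_coord M c y i j =
     partial i (\<lambda>z. christoffel M c z j) y - partial j (\<lambda>z. christoffel M c z i) y
     + christoffel M c y i ** christoffel M c y j - christoffel M c y j ** christoffel M c y i"

definition riemann :: "('m, 'n::finite, 'p) spin_data \<Rightarrow> ('m, 'n) chart \<Rightarrow> 'n rvec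
    \<Rightarrow> 'n rvec \<Rightarrow> 'n rvec \<Rightarrow> 'n rmat" where
  "riemann M c y v w = (\<Sum>i\<in>UNIV. \<Sum>j\<in>UNIV. (v $ i * w $ j) *\<^sub>R riemann_coord M c y i j)"

text \<open>\<open>Ric(Y, Z) = tr (X \<mapsto> R\<^sub>X\<^sub>,\<^sub>Y Z)\<close> and \<open>scal = g\<^sup>j\<^sup>k Ric\<^sub>j\<^sub>k\<close>.\<close>

definition scal :: "('m, 'n::finite, 'p) spin_data \<Rightarrow> ('m, 'n) chart \<Rightarrow> 'n rvec \<Rightarrow> real" where
  "scal M c y = (\<Sum>j\<in>UNIV. \<Sum>k\<in>UNIV. matrix_inv (gram M c y) $ j $ k *
     (\<Sum>i\<in>UNIV. riemann_coord M c y i j $ i $ k))"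

text \<open>The components in the frame \<open>p\<close> of the tangent vector with components \<open>v\<close> in the chart \<open>c\<close>.\<close>

definition in_frame :: "('m, 'n::finite, 'p) spin_data \<Rightarrow> ('m, 'n) chart \<Rightarrow> 'p \<Rightarrow> 'n rvec \<Rightarrow> 'n rvec" where
  "in_frame M c p v = matrix_inv (frame M c p) *v v"

text \<open>The curvature operator read in the frame \<open>p = (E\<^sub>1, \<dots>, E\<^sub>n)\<close>: the linear map with
  \<open>R(E\<^sub>a \<wedge> E\<^sub>b) = -R\<^sub>E\<^sub>a\<^sub>,\<^sub>E\<^sub>b\<close>, which is the identity on the unit round sphere. The entry \<open>(b, a)\<close>
  of \<open>X\<close> is its coefficient at \<open>e\<^sub>a \<wedge> e\<^sub>b\<close>.\<close>

definition curvature_operator :: "('m, 'n::{finite,linorder}, 'p) spin_data \<Rightarrow> ('m, 'n) chart \<Rightarrow> 'p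
    \<Rightarrow> 'n rmat \<Rightarrow> 'n rmat" where
  "curvature_operator M c p X =
     - (\<Sum>a\<in>UNIV. \<Sum>b\<in>{a<..}. X $ b $ a *\<^sub>R (matrix_inv (frame M c p) **
         riemann M c (snd c (base M p)) (column a (frame M c p)) (column b (frame M c p)) **
         frame M c p))"

section \<open>Holonomy, reduction and associated bundles\<close>

text \<open>A \<open>C\<^sup>1\<close> curve of spin frames that is parallel for the Levi-Civita connection and whose
  projection stays in one chart. Every piecewise \<open>C\<^sup>1\<close> parallel curve is a finite
  concatenation of such curves.\<close>

definition parallel_curve ::
    "('m, 'n::finite, 'p::topological_space) spin_data \<Rightarrow> (real \<Rightarrow> 'p) \<Rightarrow> bool" where
  "parallel_curve M \<gamma> \<longleftrightarrow> continuous_on {0..1} \<gamma> \<and>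
    (\<exists>(D, \<phi>)\<in>charts M. \<gamma> ` {0..1} \<subseteq> base M -` D \<and>
      (\<exists>x'. continuous_on {0..1} x' \<and> (\<forall>t\<in>{0..1}.
        ((\<lambda>s. \<phi> (base M (\<gamma> s))) has_vector_derivative x' t) (at t within {0..1}) \<and>
        ((\<lambda>s. frame M (D, \<phi>) (\<gamma> s)) has_vector_derivative
           - ((\<Sum>i\<in>UNIV. x' t $ i *\<^sub>R christoffel M (D, \<phi>) (\<phi> (base M (\<gamma> t))) i) **
              frame M (D, \<phi>) (\<gamma> t))) (at t within {0..1}))))"

definition parallel_related ::
    "('m, 'n::finite, 'p::topological_space) spin_data \<Rightarrow> 'p \<Rightarrow> 'p \<Rightarrow> bool" where
  "parallel_related M = (\<lambda>p q. \<exists>\<gamma>. parallel_curve M \<gamma> \<and> \<gamma> 0 = p \<and> \<gamma> 1 = q)\<^sup>*\<^sup>*"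

text \<open>The holonomy group at the spin frame \<open>u\<close>, as a subgroup of \<open>Spin(n)\<close>.\<close>

definition holonomy_group ::
    "('m, 'n::{finite,linorder}, 'p::topological_space) spin_data \<Rightarrow> 'p \<Rightarrow> 'n cliff set" where
  "holonomy_group M u = {a \<in> spin_group. parallel_related M u (act M u a)}"

text \<open>For \<open>G\<close> containing the holonomy group at \<open>u\<close>: the reduction to \<open>G\<close> of the bundle of spin frames
  through \<open>u\<close> that is preserved by parallel transport.\<close>

definition reduction :: "('m, 'n::{finite,linorder}, 'p::topological_space) spin_data
    \<Rightarrow> 'n cliff set \<Rightarrow> 'p \<Rightarrow> 'p set" where
  "reduction M G u = {q. \<exists>a\<in>G. parallel_related M (act M u a) q}"

text \<open>The class \<open>[q, \<psi>]\<close> in \<open>Q \<times>\<^sub>G \<complex>\<^sup>r\<close>, and the fibre of this bundle over \<open>x\<close>.\<close>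

definition assoc_class :: "('m, 'n::{finite,linorder}, 'p) spin_data \<Rightarrow> 'n cliff set
    \<Rightarrow> ('n cliff \<Rightarrow> complex^'r^'r) \<Rightarrow> 'p \<Rightarrow> complex^'r \<Rightarrow> ('p \<times> (complex^'r)) set" where
  "assoc_class M G \<sigma> q \<psi> = {(act M q a, \<sigma> (reversal a) *v \<psi>) | a. a \<in> G}"

definition assoc_fibre :: "('m, 'n::{finite,linorder}, 'p) spin_data \<Rightarrow> 'n cliff set \<Rightarrow> 'p set
    \<Rightarrow> ('n cliff \<Rightarrow> complex^'r^'r) \<Rightarrow> 'm \<Rightarrow> ('p \<times> (complex^'r)) set set" where
  "assoc_fibre M G Q \<sigma> x = {assoc_class M G \<sigma> q \<psi> | q \<psi>. q \<in> Q \<and> base M q = x}"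

text \<open>Endomorphisms of an associated bundle are given by equivariant matrix-valued functions \<open>T\<close>
  on the reduction, with composition and linear combinations taken pointwise; \<open>T\<close> maps \<open>[q, \<psi>]\<close>
  to \<open>[q, T(q)\<psi>]\<close>.\<close>

definition bundle_endo :: "('p \<Rightarrow> complex^'r^'r) \<Rightarrow> ('p \<times> (complex^'r)) set \<Rightarrow> ('p \<times> (complex^'r)) set" where
  "bundle_endo T z = {(q, T q *v \<psi>) | q \<psi>. (q, \<psi>) \<in> z}"

section \<open>The curvature terms\<close>

text \<open>The endomorphism \<open>K(R, \<sigma>)\<close>, computed with the orthonormal basis \<open>B\<close> of the Lie algebra.\<close>

definition K_endo :: "('m, 'n::{finite,linorder}, 'p) spin_data \<Rightarrow> ('m, 'n) chart \<Rightarrow> ('n rmat) set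
    \<Rightarrow> ('n cliff \<Rightarrow> complex^'r^'r) \<Rightarrow> 'p \<Rightarrow> complex^'r^'r" where
  "K_endo M c B \<sigma> q = - (\<Sum>X\<in>B. d_rep \<sigma> (curvature_operator M c q X) ** d_rep \<sigma> X)"

text \<open>Clifford multiplication by a tangent vector, and the curvature tensor of an associated bundle;
  the tangent vectors are given by their components in the chart \<open>c\<close>.\<close>

definition clifford_mult :: "('m, 'n::{finite,linorder}, 'p) spin_data \<Rightarrow> ('m, 'n) chart
    \<Rightarrow> ('n cliff \<Rightarrow> complex^'s^'s) \<Rightarrow> 'n rvec \<Rightarrow> 'p \<Rightarrow> complex^'s^'s" where
  "clifford_mult M c \<rho> v q = \<rho> (cvec (in_frame M c q v))"

definition assoc_curvature :: "('m, 'n::{finite,linorder}, 'p) spin_data \<Rightarrow> ('m, 'n) chart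
    \<Rightarrow> ('n cliff \<Rightarrow> complex^'r^'r) \<Rightarrow> 'n rvec \<Rightarrow> 'n rvec \<Rightarrow> 'p \<Rightarrow> complex^'r^'r" where
  "assoc_curvature M c \<sigma> v w q =
     - d_rep \<sigma> (curvature_operator M c q (wedge (in_frame M c q v) (in_frame M c q w)))"

definition weitzenboeck :: "('m, 'n::{finite,linorder}, 'p) spin_data \<Rightarrow> ('m, 'n) chart
    \<Rightarrow> ('n cliff \<Rightarrow> complex^'s^'s) \<Rightarrow> ('n cliff \<Rightarrow> complex^'k^'k) \<Rightarrow> ('n \<Rightarrow> 'n rvec)
    \<Rightarrow> 'p \<Rightarrow> complex^('s \<times> 'k)^('s \<times> 'k)" where
  "weitzenboeck M c \<rho> \<pi> e q = (\<Sum>i\<in>UNIV. \<Sum>j\<in>{i<..}.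
     kron (clifford_mult M c \<rho> (e i) q ** clifford_mult M c \<rho> (e j) q) (mat 1) **
     assoc_curvature M c (tensor_rep \<rho> \<pi>) (e i) (e j) q)"

end

theory Submission
  imports Defs
begin

text \<open>
  Both sides are compared fibrewise, at a spin frame of the reduction. The curvature operator \<open>R\<close> takes
  values in \<open>\<gg>\<close>: the holonomy of the coordinate square with side \<open>s\<close> lies in \<open>G\<close> and equals
  \<open>1 + s\<^sup>2 L + o(s\<^sup>2)\<close>, where \<open>L\<close> is the lift of a curvature value, and \<open>G\<close> is closed. The parallel
  curves are obtained by solving a linear equation in the Clifford algebra, and since the covering is
  a local isomorphism it suffices to expand the underlying frames. Orthogonality of the holonomy makes
  the curvature skew, so with the first Bianchi identity \<open>R\<close> is symmetric. Hence
  \<open>\<Sum>\<^bsub>i<j\<^esub> \<beta>(e\<^sub>i \<and> e\<^sub>j, R(e\<^sub>i \<and> e\<^sub>j)) = \<Sum>\<^sub>a \<beta>(R X\<^sub>a, X\<^sub>a) = \<Sum>\<^sub>a \<beta>(X\<^sub>a, R X\<^sub>a)\<close> for bilinear \<open>\<beta>\<close>. Writing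
  \<open>e\<^sub>i e\<^sub>j = 2 d\<pi>\<^sub>S(e\<^sub>i \<and> e\<^sub>j)\<close>, this expresses \<open>\<R>\<^sub>\<pi>\<close> through the \<open>X\<^sub>a\<close>; it differs from \<open>K(R, \<pi>\<^sub>S \<otimes> \<pi>) - 1 \<otimes> K(R, \<pi>)\<close>
  by \<open>K(R, \<pi>\<^sub>S) \<otimes> 1\<close>, which is \<open>scal/8\<close> by Lichnerowicz's computation with the Clifford relations.
\<close>

section \<open>The Clifford algebra and the spin group\<close>

text \<open>The representation \<pi> is a continuous function on G alone, so d\<pi> has a meaning
  only on the Lie algebra. This is why the range of the curvature operator must be known before
  anything is contracted, and why existence, homogeneity and additivity of d\<pi> are derived from
  continuity. \<open>lie_algebra G\<close> is given by one-parameter groups; that it is a vector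
  space is read off from the basis that spans it. The spinor factor, in contrast, is the restriction
  of a linear map on the Clifford algebra and is differentiated directly. Two ways around half of
  the coordinate square, e_i then e_j and e_j then e_i, are compared at the opposite corner. They
  agree to first order in s, so each must be expanded to second order with a remainder that is
  uniform along the path. Lifts of paths are constructed inside the Clifford algebra because the
  space of spin frames is only a topological space; derivatives are visible only in the underlying
  frames, read in charts.\<close>

definition rsign :: "'n::finite set \<Rightarrow> real" where
  "rsign A = (-1) ^ (card A choose 2)"

text \<open>Reversing a word of k anticommuting letters takes k(k-1)/2 transpositions. Written as a
  binomial coefficient, this number splits over disjoint unions by
  \<open>choose_two_add\<close>.\<close>

lemma coeff_reversal [simp]: "coeff (reversal a) A = rsign A * coeff a A"
  by (simp add: reversal_def rsign_def choose_two)

text \<open>Among the card A * card B pairs, an off-diagonal one counts in exactly one of the two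
  signs and a diagonal one in both. This gives the exponent.\<close>

lemma csign_swap: "csign A B = (-1) ^ (card A * card B + card (A \<inter> B)) * csign B A"
proof -
  have sq: "csign B A * csign B A = 1"
    by (simp add: csign_def flip: power_add mult_2)
  have "csign B A = (\<Prod>i\<in>A. \<Prod>j\<in>B. if i \<le> j then -1 else 1)"
    unfolding csign_prod by (rule prod.swap)
  then have "csign A B * csign B A = (\<Prod>i\<in>A. \<Prod>j\<in>B. (if j \<le> i then -1 else 1) * (if i \<le> j then -1 else 1))"
    by (simp add: csign_prod prod.distrib)
  also have "\<dots> = (\<Prod>i\<in>A. \<Prod>j\<in>B. -1 * (if i = j then -1 else 1))"
    by (intro prod.cong refl) auto
  also have "\<dots> = (\<Prod>i\<in>A. (-1) ^ card B * (if i \<in> B then -1 else 1))"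
  proof (rule prod.cong [OF refl])
    fix i
    have "(\<Prod>j\<in>B. if i = j then -1 else (1::real)) = (if i \<in> B then -1 else 1)"
      by (simp add: prod.delta)
    then show "(\<Prod>j\<in>B. -1 * (if i = j then -1 else (1::real))) = (-1) ^ card B * (if i \<in> B then -1 else 1)"
      by (simp only: prod.distrib prod_constant)
  qed
  also have "\<dots> = (-1) ^ (card A * card B) * (\<Prod>i\<in>A. if i \<in> B then -1 else 1)"
    by (simp add: prod.distrib mult.commute flip: power_mult)
  also have "(\<Prod>i\<in>A. if i \<in> B then -1 else (1::real)) = (-1) ^ card (A \<inter> B)"
    by (simp add: prod.If_cases Int_def)
  finally have "csign A B * csign B A * csign B A = (-1) ^ (card A * card B) * (-1) ^ card (A \<inter> B) * csign B A"
    by simp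
  then show ?thesis
    by (simp add: mult.assoc sq power_add)
qed

lemma choose_two_add: "(a + b) choose 2 = (a choose 2) + (b choose 2) + a * b"
  by (induction b) (simp_all add: numeral_2_eq_2)

text \<open>Reversing e_A e_B reverses both factors and exchanges them, so the extra sign is the one
  of \<open>csign_swap\<close>.\<close>

lemma rsign_sym_diff:
  "rsign (sym_diff A B) = (-1) ^ (card A * card B + card (A \<inter> B)) * rsign A * rsign B"
proof -
  define p q c where "p = card (A - B)" and "q = card (B - A)" and "c = card (A \<inter> B)"
  have A: "card A = p + c" and B: "card B = q + c"
    unfolding p_def q_def c_def
    by (subst card_Un_disjoint [symmetric]; auto intro: arg_cong [where f = card])+
  have S: "card (sym_diff A B) = p + q"
    unfolding p_def q_def by (rule card_Un_disjoint) auto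
  \<comment> \<open>After expansion of the binomials, the c common elements leave only c * c + c and
    terms that occur twice.\<close>
  have "even (c * c + c)" by simp
  then have "even ((p + c) * (q + c) + c + ((p + c) choose 2) + ((q + c) choose 2)) =
      even ((p + q) choose 2)"
    unfolding choose_two_add by (simp only: even_add even_mult_iff) argo
  then have "(-1) ^ ((p + c) * (q + c) + c + ((p + c) choose 2) + ((q + c) choose 2)) =
      (-1::real) ^ ((p + q) choose 2)"
    by (simp only: minus_one_power_iff)
  then show ?thesis
    unfolding rsign_def A B S c_def [symmetric] power_add [symmetric] ..
qed

text \<open>Substituting \<open>sym_diff C A\<close> for A in the coefficient at C exchanges the
  roles of the two factors; what remains is the comparison of signs in \<open>rsign_sym_diff\<close>
  and \<open>csign_swap\<close>.\<close>

lemma reversal_mult: "reversal (a * b) = reversal b * reversal a"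
proof (rule cliff_eqI)
  fix C :: "'a set"
  have "coeff (reversal b * reversal a) C =
      (\<Sum>A\<in>UNIV. csign (sym_diff C A) (sym_diff (sym_diff C A) C) *
        coeff (reversal b) (sym_diff C A) * coeff (reversal a) (sym_diff (sym_diff C A) C))"
    unfolding coeff_times by (rule sum_sym_diff_reindex [symmetric])
  also have "\<dots> = (\<Sum>A\<in>UNIV. rsign C * (csign A (sym_diff A C) * coeff a A * coeff b (sym_diff A C)))"
  proof (rule sum.cong [OF refl])
    fix A
    define B where "B = sym_diff A C"
    have C: "C = sym_diff A B" unfolding B_def by auto
    have e: "sym_diff C A = B" "sym_diff B C = A" unfolding B_def by auto
    have "rsign C * csign A B = rsign A * rsign B * csign B A"
      unfolding C rsign_sym_diff csign_swap [of A B]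
      by (simp add: minus_one_power_iff)
    then show "csign (sym_diff C A) (sym_diff (sym_diff C A) C) *
        coeff (reversal b) (sym_diff C A) * coeff (reversal a) (sym_diff (sym_diff C A) C) =
        rsign C * (csign A (sym_diff A C) * coeff a A * coeff b (sym_diff A C))"
      by (simp only: e coeff_reversal B_def [symmetric]) (simp add: mult_ac)
  qed
  finally show "coeff (reversal (a * b)) C = coeff (reversal b * reversal a) C"
    by (simp add: coeff_times sum_distrib_left)
qed

lemma reversal_reversal [simp]: "reversal (reversal a) = a"
  by (rule cliff_eqI) (simp add: rsign_def flip: power_add mult.assoc mult_2)

lemma reversal_one [simp]: "reversal 1 = 1"
  by (rule cliff_eqI) (auto simp: rsign_def numeral_2_eq_2)

lemma reversal_linear:
  "reversal (a + b) = reversal a + reversal b" "reversal (a - b) = reversal a - reversal b"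
  "reversal (- a) = - reversal a" "reversal (r *\<^sub>R a) = r *\<^sub>R reversal a"
  by (rule cliff_eqI; simp add: algebra_simps)+

lemma norm_reversal [simp]: "norm (reversal a) = norm a"
  by (simp add: norm_cliff_def abs_mult rsign_def)

lemma bounded_linear_reversal: "bounded_linear reversal"
  by (rule bounded_linear_intro [where K = 1]) (simp_all add: reversal_linear)

section \<open>Coordinates and topology of the Clifford algebra, and its vectors\<close>

lemma coeff_cliff_basis [simp]: "coeff (cliff_basis A) B = (if B = A then 1 else 0)"
  by (simp add: cliff_basis_def)

lemma bounded_linear_coeff: "bounded_linear (\<lambda>a. coeff a A)"
proof (rule bounded_linear_intro [where K = 1])
  show "norm (coeff a A) \<le> norm a * 1" for a
    unfolding norm_cliff_def by (auto intro: member_le_sum)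
qed simp_all

lemma cliff_coeff_sum: "coeff (sum f I) A = (\<Sum>i\<in>I. coeff (f i) A)"
  by (rule linear_sum [OF bounded_linear.linear, OF bounded_linear_coeff])

lemma coeff_tendsto_iff:
  fixes l :: "'n::{finite,linorder} cliff"
  shows "(f \<longlongrightarrow> l) F \<longleftrightarrow> (\<forall>A. ((\<lambda>x. coeff (f x) A) \<longlongrightarrow> coeff l A) F)"
proof
  assume lim: "\<forall>A. ((\<lambda>x. coeff (f x) A) \<longlongrightarrow> coeff l A) F"
  have "((\<lambda>x. \<Sum>A\<in>UNIV. \<bar>coeff (f x) A - coeff l A\<bar>) \<longlongrightarrow> (\<Sum>A\<in>(UNIV::'n set set). 0)) F"
    using lim by (intro tendsto_sum tendsto_rabs_zero LIM_zero) blast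
  then have "((\<lambda>x. norm (f x - l)) \<longlongrightarrow> 0) F"
    by (simp add: norm_cliff_def)
  then show "(f \<longlongrightarrow> l) F"
    by (rule LIM_zero_cancel [OF tendsto_norm_zero_cancel])
qed (auto intro: bounded_linear.tendsto [OF bounded_linear_coeff])

lemma cliff_expand: "a = (\<Sum>A\<in>UNIV. coeff a A *\<^sub>R cliff_basis A)"
  by (rule cliff_eqI) (simp add: cliff_coeff_sum if_distrib [of "(*) _"] cong: if_cong)

lemma bounded_linear_from_cliff:
  fixes f :: "'n::{finite,linorder} cliff \<Rightarrow> 'b::real_normed_vector"
  assumes "linear f"
  shows "bounded_linear f"
proof -
  interpret linear f by fact
  have eq: "f a = (\<Sum>A\<in>UNIV. coeff a A *\<^sub>R f (cliff_basis A))" for a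
    by (subst cliff_expand) (simp add: sum scale)
  have "bounded_linear (\<lambda>a. \<Sum>A\<in>UNIV. coeff a A *\<^sub>R f (cliff_basis A))"
    by (intro bounded_linear_sum bounded_linear_scaleR_const bounded_linear_coeff)
  then show ?thesis by (simp flip: eq)
qed

lemma cvec_linear:
  "cvec (v + w) = cvec v + cvec w" "cvec (v - w) = cvec v - cvec w" "cvec (r *\<^sub>R v) = r *\<^sub>R cvec v"
  "cvec (- v) = - cvec v"
  by (simp_all add: cvec_def algebra_simps sum.distrib sum_subtractf scaleR_sum_right flip: sum_negf)

lemma bounded_linear_cvec: "bounded_linear cvec"
  by (rule linear_conv_bounded_linear [THEN iffD1], rule linearI) (simp_all add: cvec_linear)

lemma cvec_sum: "cvec (sum f I) = (\<Sum>i\<in>I. cvec (f i))"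
  by (rule linear_sum [OF bounded_linear.linear, OF bounded_linear_cvec])

lemma cvec_axis [simp]: "cvec (axis i 1) = cliff_basis {i}"
  by (simp add: cvec_def axis_def if_distrib [of "\<lambda>r. r *\<^sub>R _"] cong: if_cong)

lemma coeff_cvec_singleton [simp]: "coeff (cvec v) {i} = v $ i"
  by (simp add: cvec_def cliff_coeff_sum if_distrib [of "(*) _"] cong: if_cong)

lemma cvec_mult: "cvec v * cvec w + cvec w * cvec v = - (2 * (v \<bullet> w)) *\<^sub>R 1"
proof -
  have "cvec v * cvec w + cvec w * cvec v =
      (\<Sum>i\<in>UNIV. \<Sum>j\<in>UNIV. (v $ i * w $ j) *\<^sub>R (cliff_basis {i} * cliff_basis {j} + cliff_basis {j} * cliff_basis {i}))"
    (is "?l = _")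
  proof -
    have "cvec w * cvec v = (\<Sum>i\<in>UNIV. \<Sum>j\<in>UNIV. (v $ i * w $ j) *\<^sub>R (cliff_basis {j} * cliff_basis {i}))"
      unfolding cvec_def sum_product by (subst sum.swap) (intro sum.cong refl, simp add: mult.commute)
    moreover have "cvec v * cvec w = (\<Sum>i\<in>UNIV. \<Sum>j\<in>UNIV. (v $ i * w $ j) *\<^sub>R (cliff_basis {i} * cliff_basis {j}))"
      unfolding cvec_def sum_product by (intro sum.cong refl) (simp add: mult.commute)
    ultimately show ?thesis by (simp add: sum.distrib scaleR_add_right)
  qed
  also have "\<dots> = (\<Sum>i\<in>UNIV. \<Sum>j\<in>UNIV. if i = j then (v $ i * w $ j) *\<^sub>R (-2) else 0)"
    by (intro sum.cong refl) (simp add: clifford_relation)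
  also have "\<dots> = (\<Sum>i\<in>UNIV. (v $ i * w $ i) *\<^sub>R (-2))"
    by simp
  also have "\<dots> = - (2 * (v \<bullet> w)) *\<^sub>R 1"
    by (simp add: inner_vec_def scaleR_conv_of_real sum_distrib_left mult_ac flip: sum_negf)
  finally show ?thesis .
qed

text \<open>For passing between sums over basis bivectors, indexed by i < j, and full double sums,
  to which changes of basis and tensor symmetries apply directly.\<close>

lemma sum_less_symmetric:
  fixes f :: "'n::{finite,linorder} \<Rightarrow> 'n \<Rightarrow> 'b::real_vector"
  assumes sym: "\<And>i j. f j i = f i j" and diag: "\<And>i. f i i = 0"
  shows "(\<Sum>i\<in>UNIV. \<Sum>j\<in>{i<..}. f i j) = (1/2) *\<^sub>R (\<Sum>i\<in>UNIV. \<Sum>j\<in>UNIV. f i j)"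
proof -
  define g where "g i j = (if i < j then f i j else 0)" for i j
  have g: "(\<Sum>j\<in>{i<..}. f i j) = (\<Sum>j\<in>UNIV. g i j)" for i
    unfolding g_def by (rule sum.mono_neutral_cong_left) auto
  have "f i j = g i j + g j i" for i j
    using sym [of i j] diag [of i] by (cases i j rule: linorder_cases) (auto simp: g_def)
  then have "(\<Sum>i\<in>UNIV. \<Sum>j\<in>UNIV. f i j) = (\<Sum>i\<in>UNIV. \<Sum>j\<in>UNIV. g i j) + (\<Sum>i\<in>UNIV. \<Sum>j\<in>UNIV. g j i)"
    by (simp add: sum.distrib)
  also have "(\<Sum>i\<in>UNIV. \<Sum>j\<in>UNIV. g j i) = (\<Sum>i\<in>UNIV. \<Sum>j\<in>UNIV. g i j)"
    by (rule sum.swap)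
  finally show ?thesis
    by (simp add: g flip: scaleR_2)
qed

section \<open>Even elements and the group structure of Spin(n)\<close>

definition grade_involution :: "'n::{finite,linorder} cliff \<Rightarrow> 'n cliff" where
  "grade_involution a = Cliff (\<lambda>A. (-1) ^ card A * coeff a A)"

lemma coeff_grade_involution [simp]: "coeff (grade_involution a) A = (-1) ^ card A * coeff a A"
  by (simp add: grade_involution_def)

lemma minus_one_power_card_sym_diff:
  "(-1::real) ^ card (sym_diff A B) = (-1) ^ card A * (-1) ^ card (B :: 'a::finite set)"
  using prod_sign_sym_diff [of "\<lambda>_. -1" A B] by simp

lemma grade_involution_mult: "grade_involution (a * b) = grade_involution a * grade_involution b"
proof (rule cliff_eqI)
  fix C :: "'a set"
  have "(-1) ^ card C = (-1) ^ card A * (-1::real) ^ card (sym_diff A C)" for A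
    by (simp only: minus_one_power_card_sym_diff) (simp add: minus_one_power_iff)
  then show "coeff (grade_involution (a * b)) C = coeff (grade_involution a * grade_involution b) C"
    unfolding coeff_times coeff_grade_involution sum_distrib_left by (intro sum.cong refl) (simp add: mult_ac)
qed

lemma bounded_linear_grade_involution: "bounded_linear grade_involution"
  by (intro bounded_linear_from_cliff linearI) (simp_all add: cliff_eqI algebra_simps)

text \<open>Evenness becomes the fixed-point condition of an algebra automorphism, so it passes to
  products and can be followed along a differential equation.\<close>

lemma grade_involution_eq_iff: "grade_involution a = a \<longleftrightarrow> (\<forall>A. odd (card A) \<longrightarrow> coeff a A = 0)"
proof
  assume "grade_involution a = a"
  then have "(-1) ^ card A * coeff a A = coeff a A" for A
    by (metis coeff_grade_involution)
  then show "\<forall>A. odd (card A) \<longrightarrow> coeff a A = 0"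
    by (metis minus_one_power_iff mult_minus1 neg_equal_zero)
next
  assume "\<forall>A. odd (card A) \<longrightarrow> coeff a A = 0"
  then show "grade_involution a = a"
    by (auto intro!: cliff_eqI simp: minus_one_power_iff)
qed

lemma spin_group_iff:
  "a \<in> spin_group \<longleftrightarrow> grade_involution a = a \<and> a * reversal a = 1 \<and> reversal a * a = 1 \<and>
    (\<forall>v. \<exists>w. a * cvec v * reversal a = cvec w)"
  by (simp add: spin_group_def grade_involution_eq_iff)

text \<open>\<open>spin_cover\<close> records only the coefficients at singletons. They determine
  the conjugate because membership in \<open>spin_group\<close> makes it a vector.\<close>

lemma spin_group_conj_cvec:
  assumes "a \<in> spin_group"
  shows "a * cvec v * reversal a = cvec (spin_cover a *v v)"
proof -
  have axis: "a * cvec (axis j 1) * reversal a = cvec (\<chi> i. spin_cover a $ i $ j)" for j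
  proof -
    obtain w where w: "a * cvec (axis j 1) * reversal a = cvec w"
      using assms unfolding spin_group_iff by blast
    have "w $ i = spin_cover a $ i $ j" for i
      using arg_cong [OF w, of "\<lambda>x. coeff x {i}"] by (simp add: spin_cover_def)
    then have "w = (\<chi> i. spin_cover a $ i $ j)" by (simp add: vec_eq_iff)
    then show ?thesis using w by simp
  qed
  have v: "v = (\<Sum>j\<in>UNIV. v $ j *\<^sub>R axis j 1)"
    by (simp add: vec_eq_iff axis_def if_distrib [of "(*) _"] cong: if_cong)
  have "a * cvec v * reversal a = (\<Sum>j\<in>UNIV. v $ j *\<^sub>R (a * cvec (axis j 1) * reversal a))"
    by (subst v) (simp only: cvec_sum cvec_linear sum_distrib_left sum_distrib_right mult_scaleR_left mult_scaleR_right)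
  also have "\<dots> = cvec (\<Sum>j\<in>UNIV. v $ j *\<^sub>R (\<chi> i. spin_cover a $ i $ j))"
    by (simp only: cvec_sum cvec_linear axis)
  also have "(\<Sum>j\<in>UNIV. v $ j *\<^sub>R (\<chi> i. spin_cover a $ i $ j)) = spin_cover a *v v"
    by (simp add: vec_eq_iff matrix_vector_mult_def mult.commute)
  finally show ?thesis .
qed

lemma cvec_inject [simp]: "cvec v = cvec w \<longleftrightarrow> v = w"
  by (metis coeff_cvec_singleton vec_eq_iff)

lemma spin_group_one [simp]: "1 \<in> spin_group"
  by (auto simp: spin_group_def)

lemma spin_group_mult:
  assumes "a \<in> spin_group" "b \<in> spin_group"
  shows "a * b \<in> spin_group"
proof -
  have "(a * b) * cvec v * reversal (a * b) = cvec (spin_cover a *v (spin_cover b *v v))" for v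
  proof -
    have "(a * b) * cvec v * reversal (a * b) = a * (b * cvec v * reversal b) * reversal a"
      by (simp only: reversal_mult mult.assoc)
    then show ?thesis using assms by (simp add: spin_group_conj_cvec)
  qed
  moreover have "a * b * reversal (a * b) = 1"
  proof -
    have "a * b * reversal (a * b) = a * (b * reversal b) * reversal a"
      by (simp only: reversal_mult mult.assoc)
    then show ?thesis using assms by (simp add: spin_group_iff)
  qed
  moreover have "reversal (a * b) * (a * b) = 1"
  proof -
    have "reversal (a * b) * (a * b) = reversal b * (reversal a * a) * b"
      by (simp only: reversal_mult mult.assoc)
    then show ?thesis using assms by (simp add: spin_group_iff)
  qed
  moreover have "grade_involution (a * b) = a * b"
    using assms by (simp add: spin_group_iff grade_involution_mult)
  ultimately show ?thesis
    unfolding spin_group_iff by blast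
qed

lemma spin_cover_mult:
  assumes "a \<in> spin_group" "b \<in> spin_group"
  shows "spin_cover (a * b) = spin_cover a ** spin_cover b"
proof -
  have "cvec (spin_cover (a * b) *v v) = cvec ((spin_cover a ** spin_cover b) *v v)" for v
  proof -
    have "(a * b) * cvec v * reversal (a * b) = a * (b * cvec v * reversal b) * reversal a"
      by (simp only: reversal_mult mult.assoc)
    then show ?thesis
      using assms spin_group_mult [OF assms] by (simp add: spin_group_conj_cvec matrix_vector_mul_assoc)
  qed
  then show ?thesis
    by (simp add: matrix_eq)
qed

text \<open>The condition on vectors is the one that needs an argument: conjugation by a acts on
  vectors by an injective linear map, which is onto in finite dimension. Hence every vector is the
  conjugate of another, and the reverse conjugation recovers that one.\<close>

lemma spin_group_reversal:
  assumes "a \<in> spin_group"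
  shows "reversal a \<in> spin_group"
proof -
  have a: "a * reversal a = 1" "reversal a * a = 1" "grade_involution a = a"
    using assms by (auto simp: spin_group_iff)
  have conj: "reversal a * cvec (spin_cover a *v v) * a = cvec v" for v
  proof -
    have "reversal a * (a * cvec v * reversal a) * a = (reversal a * a) * cvec v * (reversal a * a)"
      by (simp only: mult.assoc)
    then show ?thesis by (simp add: a spin_group_conj_cvec [OF assms])
  qed
  have "inj ((*v) (spin_cover a))"
    by (rule injI) (metis conj cvec_inject)
  then have "surj ((*v) (spin_cover a))"
    by (simp add: linear_injective_imp_surjective)
  then have "\<exists>w. reversal a * cvec v * a = cvec w" for v
    by (metis conj surjD)
  moreover have "grade_involution (reversal a) = reversal a"
    using a(3) unfolding grade_involution_eq_iff by simp
  ultimately show ?thesis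
    using a by (simp add: spin_group_iff)
qed

section \<open>The derivative of the covering and its inverse\<close>

lemma spin_lift_skew:
  assumes "transpose X = - X"
  shows "spin_lift X = (1/4) *\<^sub>R (\<Sum>i\<in>UNIV. \<Sum>j\<in>UNIV. X $ j $ i *\<^sub>R (cliff_basis {i} * cliff_basis {j}))"
proof -
  have X: "X $ i $ j = - X $ j $ i" for i j
    using arg_cong [OF assms, of "\<lambda>Y. Y $ j $ i"] by (simp add: transpose_def)
  have X0: "X $ i $ i = 0" for i
    using X [of i i] by simp
  have e: "cliff_basis {i} * cliff_basis {j} = - (cliff_basis {j} * cliff_basis {i})" if "i \<noteq> j" for i j :: 'a
    using clifford_relation [of i j] that by (simp add: eq_neg_iff_add_eq_0)
  have "X $ j $ i *\<^sub>R (cliff_basis {i} * cliff_basis {j}) = X $ i $ j *\<^sub>R (cliff_basis {j} * cliff_basis {i})" for i j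
    using e [of i j] X [of i j] by (cases "i = j") auto
  then have "(\<Sum>i\<in>UNIV. \<Sum>j\<in>{i<..}. X $ j $ i *\<^sub>R (cliff_basis {i} * cliff_basis {j})) =
      (1/2) *\<^sub>R (\<Sum>i\<in>UNIV. \<Sum>j\<in>UNIV. X $ j $ i *\<^sub>R (cliff_basis {i} * cliff_basis {j}))"
    by (intro sum_less_symmetric) (simp_all add: X0)
  moreover have "spin_lift X = (1/2) *\<^sub>R (\<Sum>i\<in>UNIV. \<Sum>j\<in>{i<..}. X $ j $ i *\<^sub>R (cliff_basis {i} * cliff_basis {j}))"
    unfolding spin_lift_def scaleR_sum_right by (simp add: mult.commute)
  ultimately show ?thesis by simp
qed

text \<open>Moving v past e_j and then past e_i leaves the contractions 2 v_i e_j and -2 v_j e_i. By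
  skewness of X the two resulting double sums agree up to sign and add up.\<close>

lemma spin_lift_commutator:
  assumes "transpose X = - X"
  shows "spin_lift X * cvec v - cvec v * spin_lift X = cvec (X *v v)"
proof -
  have X: "X $ i $ j = - X $ j $ i" for i j
    using arg_cong [OF assms, of "\<lambda>Y. Y $ j $ i"] by (simp add: transpose_def)
  have e: "cliff_basis {i} * cliff_basis {j} * cvec v - cvec v * (cliff_basis {i} * cliff_basis {j}) =
      2 *\<^sub>R (v $ i *\<^sub>R cliff_basis {j} - v $ j *\<^sub>R cliff_basis {i})" for i j
  proof -
    have k: "cliff_basis {k} * cvec v = - (2 * v $ k) *\<^sub>R 1 - cvec v * cliff_basis {k}" for k
      using cvec_mult [of "axis k 1" v] by (simp add: inner_axis' algebra_simps)
    have "cliff_basis {i} * cliff_basis {j} * cvec v = cliff_basis {i} * (- (2 * v $ j) *\<^sub>R 1 - cvec v * cliff_basis {j})"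
      by (simp add: mult.assoc k)
    also have "\<dots> = - (2 * v $ j) *\<^sub>R cliff_basis {i} - (cliff_basis {i} * cvec v) * cliff_basis {j}"
      by (simp add: algebra_simps)
    also have "\<dots> = - (2 * v $ j) *\<^sub>R cliff_basis {i} + (2 * v $ i) *\<^sub>R cliff_basis {j} + cvec v * (cliff_basis {i} * cliff_basis {j})"
      unfolding k by (simp add: algebra_simps)
    finally show ?thesis by (simp add: algebra_simps)
  qed
  have "spin_lift X * cvec v - cvec v * spin_lift X = (1/4) *\<^sub>R (\<Sum>i\<in>UNIV. \<Sum>j\<in>UNIV. X $ j $ i *\<^sub>R
      (cliff_basis {i} * cliff_basis {j} * cvec v - cvec v * (cliff_basis {i} * cliff_basis {j})))"
    unfolding spin_lift_skew [OF assms]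
    by (simp add: sum_distrib_left sum_distrib_right sum_subtractf scaleR_diff_right)
  also have "\<dots> = (1/2) *\<^sub>R ((\<Sum>i\<in>UNIV. \<Sum>j\<in>UNIV. (X $ j $ i * v $ i) *\<^sub>R cliff_basis {j})
      - (\<Sum>i\<in>UNIV. \<Sum>j\<in>UNIV. (X $ j $ i * v $ j) *\<^sub>R cliff_basis {i}))"
    unfolding e by (simp add: scaleR_diff_right sum_subtractf scaleR_sum_right mult_ac)
  also have "(\<Sum>i\<in>UNIV. \<Sum>j\<in>UNIV. (X $ j $ i * v $ i) *\<^sub>R cliff_basis {j}) = cvec (X *v v)"
    by (subst sum.swap) (simp add: cvec_def matrix_vector_mult_def scaleR_sum_left)
  also have "(\<Sum>i\<in>UNIV. \<Sum>j\<in>UNIV. (X $ j $ i * v $ j) *\<^sub>R cliff_basis {i}) = - cvec (X *v v)"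
  proof -
    have "X $ j $ i * v $ j = - (X $ i $ j * v $ j)" for i j
      using X [of j i] by simp
    then show ?thesis
      by (simp add: cvec_def matrix_vector_mult_def scaleR_sum_left sum_negf)
  qed
  finally show ?thesis by (simp flip: scaleR_2)
qed

lemma bounded_linear_matrix_vector_mult: "bounded_linear (\<lambda>X::real^'n^'m. X *v v)"
  by (rule linear_conv_bounded_linear [THEN iffD1], rule linearI)
    (simp_all add: matrix_vector_mult_add_rdistrib scaleR_matrix_vector_assoc)

lemma coeff_mult_basis:
  "coeff (a * cliff_basis B) C = csign (sym_diff C B) B * coeff a (sym_diff C B)"
proof -
  have "coeff (a * cliff_basis B) C =
      (\<Sum>A\<in>UNIV. if A = sym_diff C B then csign (sym_diff C B) B * coeff a (sym_diff C B) else 0)"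
    unfolding coeff_times
  proof (rule sum.cong [OF refl])
    fix A
    have "sym_diff A C = B \<longleftrightarrow> A = sym_diff C B" by blast
    then show "csign A (sym_diff A C) * coeff a A * coeff (cliff_basis B) (sym_diff A C) =
        (if A = sym_diff C B then csign (sym_diff C B) B * coeff a (sym_diff C B) else 0)"
      by (cases "A = sym_diff C B") (simp_all del: Un_iff)
  qed
  then show ?thesis by simp
qed

lemma coeff_basis_mult:
  "coeff (cliff_basis B * a) C = csign B (sym_diff B C) * coeff a (sym_diff B C)"
proof -
  have "coeff (cliff_basis B * a) C =
      (\<Sum>A\<in>UNIV. if A = B then csign B (sym_diff B C) * coeff a (sym_diff B C) else 0)"
    unfolding coeff_times by (rule sum.cong) auto
  then show ?thesis by simp
qed

text \<open>For even \<open>A\<close> containing j, e_A anticommutes with e_j, so the commutator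
  doubles this coefficient up to sign. All coefficients of an even element except the scalar one can
  be recovered in this way.\<close>

lemma coeff_commutator_basis:
  assumes "even (card A)" "j \<in> A"
  shows "coeff (a * cliff_basis {j} - cliff_basis {j} * a) (A - {j}) = 2 * csign A {j} * coeff a A"
proof -
  have e: "sym_diff (A - {j}) {j} = A" "sym_diff {j} (A - {j}) = A"
    using assms by auto
  have "csign {j} A = - csign A {j}"
    using csign_swap [of A "{j}"] assms by simp
  then show ?thesis
    by (simp only: coeff_simps coeff_mult_basis coeff_basis_mult e)
qed

lemma even_spin_lift: "odd (card A) \<Longrightarrow> coeff (spin_lift X) A = 0"
proof -
  assume A: "odd (card A)"
  have "grade_involution (cliff_basis {i} * cliff_basis {j}) = cliff_basis {i} * cliff_basis {j}" for i j :: 'a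
  proof -
    have "grade_involution (cliff_basis {k}) = - cliff_basis {k}" for k :: 'a
      by (rule cliff_eqI) auto
    then show ?thesis by (simp add: grade_involution_mult)
  qed
  then have "coeff (cliff_basis {i} * cliff_basis {j}) A = 0" for i j
    using A grade_involution_eq_iff by blast
  then show ?thesis by (simp add: spin_lift_def cliff_coeff_sum)
qed

lemma coeff_spin_lift_empty: "coeff (spin_lift X) {} = 0"
  by (auto simp: spin_lift_def cliff_coeff_sum coeff_mult_basis intro!: sum.neutral)

text \<open>The commutators with the \<open>e\<^sub>j\<close> determine an even element up to its scalar part, and they are
  controlled by the covering homomorphism; the scalar part is controlled by \<open>a * reversal a = 1\<close>.\<close>

lemma spin_cover_expansion:
  fixes h :: "'x \<Rightarrow> 'n::{finite,linorder} cliff" and r :: "'x \<Rightarrow> real"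
  assumes spin: "\<forall>\<^sub>F x in F. h x \<in> spin_group" and h1: "(h \<longlongrightarrow> 1) F"
    and r0: "(r \<longlongrightarrow> 0) F" and rnz: "\<forall>\<^sub>F x in F. r x \<noteq> 0"
    and S: "((\<lambda>x. (1 / r x) *\<^sub>R (spin_cover (h x) - mat 1)) \<longlongrightarrow> Y) F"
    and Y: "transpose Y = - Y"
  shows "((\<lambda>x. (1 / r x) *\<^sub>R (h x - 1)) \<longlongrightarrow> spin_lift Y) F"
proof -
  \<comment> \<open>Commutators do not see the scalar part, so it is split off here and treated at
    the end.\<close>
  define b where "b x = h x - coeff (h x) {} *\<^sub>R 1" for x
  have comm: "((\<lambda>x. (1 / r x) *\<^sub>R (h x * cliff_basis {j} - cliff_basis {j} * h x)) \<longlongrightarrow>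
      spin_lift Y * cliff_basis {j} - cliff_basis {j} * spin_lift Y) F" for j
  proof -
    have "((\<lambda>x. (1 / r x) *\<^sub>R (spin_cover (h x) - mat 1) *v axis j 1) \<longlongrightarrow> Y *v axis j 1) F"
      using S by (intro bounded_linear.tendsto [OF bounded_linear_matrix_vector_mult]) 
    then have "((\<lambda>x. cvec ((1 / r x) *\<^sub>R (spin_cover (h x) - mat 1) *v axis j 1) * h x) \<longlongrightarrow> cvec (Y *v axis j 1) * 1) F"
      by (intro tendsto_mult h1 bounded_linear.tendsto [OF bounded_linear_cvec])
    moreover have "cvec (Y *v axis j 1) = spin_lift Y * cliff_basis {j} - cliff_basis {j} * spin_lift Y"
      using spin_lift_commutator [OF Y, of "axis j 1"] by simp
    moreover have "\<forall>\<^sub>F x in F. cvec ((1 / r x) *\<^sub>R (spin_cover (h x) - mat 1) *v axis j 1) * h x =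
        (1 / r x) *\<^sub>R (h x * cliff_basis {j} - cliff_basis {j} * h x)"
      using spin
    proof eventually_elim
      case (elim x)
      have "h x * cliff_basis {j} * (reversal (h x) * h x) = h x * cliff_basis {j} * reversal (h x) * h x"
        by (simp only: mult.assoc)
      also have "\<dots> = cvec (spin_cover (h x) *v axis j 1) * h x"
        using spin_group_conj_cvec [OF elim, of "axis j 1"] by simp
      finally have "h x * cliff_basis {j} * (reversal (h x) * h x) = cvec (spin_cover (h x) *v axis j 1) * h x" .
      then have "cvec (spin_cover (h x) *v axis j 1) * h x = h x * cliff_basis {j}"
        using elim by (simp add: spin_group_iff)
      then show ?case
        by (simp add: cvec_linear matrix_vector_mult_diff_rdistrib algebra_simps scaleR_matrix_vector_assoc [symmetric])
    qed
    ultimately show ?thesis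
      by (simp add: tendsto_cong)
  qed
  have b: "((\<lambda>x. (1 / r x) *\<^sub>R b x) \<longlongrightarrow> spin_lift Y) F"
    unfolding coeff_tendsto_iff
  proof
    fix A :: "'n set"
    consider "odd (card A)" | "A = {}" | j where "even (card A)" "j \<in> A" by blast
    then show "((\<lambda>x. coeff ((1 / r x) *\<^sub>R b x) A) \<longlongrightarrow> coeff (spin_lift Y) A) F"
    proof cases
      case 1
      have "\<forall>\<^sub>F x in F. coeff ((1 / r x) *\<^sub>R b x) A = 0"
        using spin by eventually_elim (use 1 in \<open>auto simp: b_def spin_group_def\<close>)
      then show ?thesis using 1 by (simp add: even_spin_lift tendsto_eventually)
    next
      case 2
      then show ?thesis by (simp add: b_def coeff_spin_lift_empty)
    next
      case 3
      have nz: "csign A {j} \<noteq> 0" using abs_csign [of A "{j}"] by linarith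
      have "((\<lambda>x. coeff ((1 / r x) *\<^sub>R (h x * cliff_basis {j} - cliff_basis {j} * h x)) (A - {j}) / (2 * csign A {j})) \<longlongrightarrow>
        coeff (spin_lift Y * cliff_basis {j} - cliff_basis {j} * spin_lift Y) (A - {j}) / (2 * csign A {j})) F"
        using nz by (intro tendsto_divide tendsto_const bounded_linear.tendsto [OF bounded_linear_coeff comm]) simp
      moreover have "coeff (b x) A = coeff (h x) A" for x
        using 3 by (auto simp: b_def)
      ultimately show ?thesis
        using nz 3 by (simp add: coeff_commutator_basis coeff_simps(6) del: coeff_simps(4))
    qed
  qed
  have "((\<lambda>x. r x *\<^sub>R ((1 / r x) *\<^sub>R b x)) \<longlongrightarrow> 0) F"
    by (rule tendsto_eq_rhs [OF tendsto_scaleR [OF r0 b]]) simp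
  then have b0: "(b \<longlongrightarrow> 0) F"
    by (rule Lim_transform_eventually) (use rnz in \<open>auto elim!: eventually_mono\<close>)
  have c0: "((\<lambda>x. coeff (h x) {}) \<longlongrightarrow> 1) F"
    using bounded_linear.tendsto [OF bounded_linear_coeff h1, of "{}"] by simp
  \<comment> \<open>With c the scalar part of h, the relation h * reversal h = 1 gives (c - 1)(c +
    1) = - (scalar part of b * reversal b). The right side is quadratic in b and c + 1 tends to 2,
    so c - 1 is of smaller order than r.\<close>
  have "((\<lambda>x. - coeff (((1 / r x) *\<^sub>R b x) * reversal (b x)) {} / (coeff (h x) {} + 1)) \<longlongrightarrow>
      - coeff (spin_lift Y * reversal 0) {} / (1 + 1)) F"
    by (intro tendsto_divide tendsto_minus bounded_linear.tendsto [OF bounded_linear_coeff] tendsto_mult b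
        bounded_linear.tendsto [OF bounded_linear_reversal] b0 tendsto_add c0 tendsto_const) simp
  moreover have "reversal 0 = (0 :: 'n cliff)"
    by (rule cliff_eqI) simp
  moreover have "\<forall>\<^sub>F x in F. coeff (h x) {} > 0"
    using order_tendstoD(1) [OF c0, of 0] by simp
  then have "\<forall>\<^sub>F x in F. - coeff (((1 / r x) *\<^sub>R b x) * reversal (b x)) {} / (coeff (h x) {} + 1) =
      (1 / r x) * (coeff (h x) {} - 1)"
    using spin
  proof eventually_elim
    case (elim x)
    define c where "c = coeff (h x) {}"
    have h: "h x = b x + c *\<^sub>R 1" by (simp add: b_def c_def)
    have "h x * reversal (h x) = b x * reversal (b x) + c *\<^sub>R (b x + reversal (b x)) + (c * c) *\<^sub>R 1"
      unfolding h by (simp add: reversal_linear algebra_simps)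
    then have "coeff (b x * reversal (b x) + c *\<^sub>R (b x + reversal (b x)) + (c * c) *\<^sub>R 1) {} = 1"
      using elim by (simp add: spin_group_iff)
    moreover have "coeff (b x) {} = 0" by (simp add: b_def)
    ultimately have "coeff (b x * reversal (b x)) {} = - ((c - 1) * (c + 1))"
      by (simp add: algebra_simps)
    then show ?case
      using elim(1) unfolding c_def [symmetric] by (simp add: divide_simps)
  qed
  ultimately have "((\<lambda>x. (1 / r x) * (coeff (h x) {} - 1)) \<longlongrightarrow> 0) F"
    by (simp add: tendsto_cong)
  then have "((\<lambda>x. (1 / r x) *\<^sub>R b x + ((1 / r x) * (coeff (h x) {} - 1)) *\<^sub>R 1) \<longlongrightarrow> spin_lift Y + 0 *\<^sub>R 1) F"
    by (intro tendsto_add b tendsto_scaleR tendsto_const)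
  then show ?thesis
    by (simp add: b_def algebra_simps)
qed

section \<open>Powers near the identity, closed subgroups and one-parameter groups\<close>

lemma norm_power_diff_le:
  fixes x y :: "'a::real_normed_algebra_1"
  assumes "norm x \<le> K" "norm y \<le> K"
  shows "norm (x ^ Suc n - y ^ Suc n) \<le> real (Suc n) * K ^ n * norm (x - y)"
proof (induction n)
  case (Suc n)
  have K: "0 \<le> K" using assms norm_ge_zero order_trans by blast
  have "x ^ Suc (Suc n) - y ^ Suc (Suc n) = x * (x ^ Suc n - y ^ Suc n) + (x - y) * y ^ Suc n"
    by (simp add: algebra_simps)
  also have "norm \<dots> \<le> norm x * norm (x ^ Suc n - y ^ Suc n) + norm (x - y) * norm (y ^ Suc n)"
    by (meson norm_triangle_mono norm_mult_ineq)
  also have "\<dots> \<le> K * (real (Suc n) * K ^ n * norm (x - y)) + norm (x - y) * K ^ Suc n"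
    using K assms Suc
    by (intro add_mono mult_mono order_trans [OF norm_power_ineq] power_mono) auto
  finally show ?case by (simp add: algebra_simps)
qed simp

lemma has_vector_derivative_quotient:
  assumes "(f has_vector_derivative D) (at 0 within S)"
  shows "((\<lambda>h. (1 / h) *\<^sub>R (f h - f 0)) \<longlongrightarrow> D) (at 0 within S)"
proof -
  have "((\<lambda>h. (1 / norm (h - 0)) *\<^sub>R (f h - (f 0 + (h - 0) *\<^sub>R D))) \<longlongrightarrow> 0) (at 0 within S)"
    using assms by (simp add: has_vector_derivative_def has_derivative_within divide_inverse)
  then have "((\<lambda>h. norm ((1 / norm (h - 0)) *\<^sub>R (f h - (f 0 + (h - 0) *\<^sub>R D)))) \<longlongrightarrow> 0) (at 0 within S)"
    by (rule tendsto_norm_zero)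
  moreover have "norm ((1 / norm (h - 0)) *\<^sub>R (f h - (f 0 + (h - 0) *\<^sub>R D))) = norm ((1 / h) *\<^sub>R (f h - f 0) - D)"
    if "h \<noteq> 0" for h
  proof -
    have "(1 / h) *\<^sub>R (f h - f 0) - D = (1 / h) *\<^sub>R (f h - (f 0 + (h - 0) *\<^sub>R D))"
      using that by (simp add: scaleR_diff_right scaleR_add_right)
    then show ?thesis by simp
  qed
  then have "\<forall>\<^sub>F h in at 0 within S. norm ((1 / norm (h - 0)) *\<^sub>R (f h - (f 0 + (h - 0) *\<^sub>R D))) = norm ((1 / h) *\<^sub>R (f h - f 0) - D)"
    by (simp add: eventually_at_filter)
  ultimately have "((\<lambda>h. norm ((1 / h) *\<^sub>R (f h - f 0) - D)) \<longlongrightarrow> 0) (at 0 within S)"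
    by (simp only: tendsto_cong)
  then show ?thesis
    by (rule LIM_zero_cancel [OF tendsto_norm_zero_cancel])
qed

lemma exp_scaleR_add:
  fixes L :: "'a::{real_normed_algebra_1,banach}"
  shows "exp ((s + t) *\<^sub>R L) = exp (s *\<^sub>R L) * exp (t *\<^sub>R L)"
  by (simp add: scaleR_add_left exp_add_commuting)

lemma exp_scaleR_power:
  fixes L :: "'a::{real_normed_algebra_1,banach}"
  shows "exp (t *\<^sub>R L) ^ n = exp ((real n * t) *\<^sub>R L)"
proof (induction n)
  case (Suc n)
  then show ?case
    using exp_scaleR_add [of t "real n * t" L] by (simp add: algebra_simps)
qed simp

text \<open>exp L is the n-th power of y n = exp (L / n), and n (g n - y n) tends to 0. Taking n-th
  powers multiplies distances by at most n times a fixed constant, because both bases are within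
  O(1/n) of 1.\<close>

lemma power_tendsto_exp:
  fixes g :: "nat \<Rightarrow> 'a::{real_normed_algebra_1,banach}"
  assumes "(\<lambda>n. real n *\<^sub>R (g n - 1)) \<longlonglongrightarrow> L"
  shows "(\<lambda>n. g n ^ n) \<longlonglongrightarrow> exp L"
proof -
  define y where "y n = exp ((1 / real n) *\<^sub>R L)" for n
  have yn: "y n ^ n = exp L" if "n > 0" for n
    using that by (simp add: y_def exp_scaleR_power)
  have "((\<lambda>t. exp (t *\<^sub>R L)) has_vector_derivative exp (0 *\<^sub>R L) * L) (at 0)"
    by (rule exp_scaleR_has_vector_derivative_right)
  then have "((\<lambda>h. (1 / h) *\<^sub>R (exp (h *\<^sub>R L) - 1)) \<longlongrightarrow> L) (at 0)"
    by (auto dest: has_vector_derivative_quotient)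
  then have "((\<lambda>n. (1 / (1 / real n)) *\<^sub>R (exp ((1 / real n) *\<^sub>R L) - 1)) \<longlonglongrightarrow> L)"
    by (rule filterlim_compose) (auto simp: filterlim_at lim_1_over_n eventually_sequentially intro!: exI [of _ 1])
  then have y: "(\<lambda>n. real n *\<^sub>R (y n - 1)) \<longlonglongrightarrow> L"
    by (simp add: y_def)
  obtain C where C: "\<And>n. norm (real n *\<^sub>R (g n - 1)) \<le> C"
    using convergent_imp_Bseq [OF convergentI [OF assms]] by (auto simp: Bseq_def)
  obtain D where D: "\<And>n. norm (real n *\<^sub>R (y n - 1)) \<le> D"
    using convergent_imp_Bseq [OF convergentI [OF y]] by (auto simp: Bseq_def)
  \<comment> \<open>A common bound for n (g n - 1) and n (y n - 1): both bases have norm at most 1 +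
    E / n, and (1 + E / n)^n stays below exp E.\<close>
  define E where "E = max C D"
  have E0: "E \<ge> 0" using C [of 0] unfolding E_def by simp
  have bound: "norm z \<le> 1 + E / real n" if "norm (real n *\<^sub>R (z - 1)) \<le> E" "n > 0" for z :: 'a and n
  proof -
    have "norm (z - 1) \<le> E / real n"
      using that unfolding norm_scaleR by (simp add: pos_le_divide_eq mult.commute)
    moreover have "norm z \<le> norm (z - 1) + norm (1::'a)"
      using norm_triangle_ineq [of "z - 1" 1] by simp
    ultimately show ?thesis by simp
  qed
  have le: "norm (g n ^ n - y n ^ n) \<le> exp E * norm (real n *\<^sub>R (g n - 1) - real n *\<^sub>R (y n - 1))" if n: "n > 0" for n
  proof -
    obtain m where m: "n = Suc m" using n by (cases n) auto
    have "norm (g n ^ Suc m - y n ^ Suc m) \<le> real (Suc m) * (1 + E / real n) ^ m * norm (g n - y n)"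
      by (rule norm_power_diff_le; rule bound; use C [of n] D [of n] n in \<open>auto simp: E_def le_max_iff_disj\<close>)
    also have "(1 + E / real n) ^ m \<le> (1 + E / real n) ^ n"
      using E0 by (intro power_increasing) (auto simp: m)
    also have "\<dots> \<le> exp E"
      by (rule exp_ge_one_plus_x_over_n_power_n) (use n E0 in auto)
    finally have "norm (g n ^ n - y n ^ n) \<le> exp E * (real n * norm (g n - y n))"
      unfolding m [symmetric] by (simp add: mult_right_mono mult_ac)
    also have "real n * norm (g n - y n) = norm (real n *\<^sub>R (g n - 1) - real n *\<^sub>R (y n - 1))"
      unfolding scaleR_diff_right [symmetric] norm_scaleR by simp
    finally show ?thesis .
  qed
  have "(\<lambda>n. exp E * norm (real n *\<^sub>R (g n - 1) - real n *\<^sub>R (y n - 1))) \<longlonglongrightarrow> exp E * norm (L - L)"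
    by (intro tendsto_intros assms y)
  then have lim: "(\<lambda>n. exp E * norm (real n *\<^sub>R (g n - 1) - real n *\<^sub>R (y n - 1))) \<longlonglongrightarrow> 0"
    by simp
  have "\<forall>\<^sub>F n in sequentially. norm (g n ^ n - y n ^ n) \<le> exp E * norm (real n *\<^sub>R (g n - 1) - real n *\<^sub>R (y n - 1))"
    using eventually_gt_at_top [of 0] by eventually_elim (rule le)
  then have "(\<lambda>n. g n ^ n - y n ^ n) \<longlonglongrightarrow> 0"
    using lim by (rule Lim_null_comparison)
  moreover have "\<forall>\<^sub>F n in sequentially. g n ^ n - y n ^ n = g n ^ n - exp L"
    using eventually_gt_at_top [of 0] by eventually_elim (simp add: yn)
  ultimately have "(\<lambda>n. g n ^ n - exp L) \<longlonglongrightarrow> 0"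
    by (rule Lim_transform_eventually)
  then show ?thesis by (rule LIM_zero_cancel)
qed

lemma spin_lift_linear:
  "spin_lift (X + Y) = spin_lift X + spin_lift Y" "spin_lift (r *\<^sub>R X) = r *\<^sub>R spin_lift X"
  "spin_lift (- X) = - spin_lift X"
  by (simp_all add: spin_lift_def scaleR_sum_right scaleR_add_left add_divide_distrib sum.distrib sum_negf)

text \<open>For t > 0 the parameter s = sqrt (t / n) turns the second-order scale into t / n. So h s
  is 1 + (t / n) times the lift of Y up to o(1/n), and its n-th power, which lies in the closed set
  G, tends to the exponential. Negative t follows by inversion, which in G is reversal.\<close>

lemma lie_algebra_memI:
  fixes h :: "real \<Rightarrow> 'n::{finite,linorder} cliff"
  assumes G: "compact_connected_subgroup G" and Y: "transpose Y = - Y"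
    and hG: "\<forall>\<^sub>F s in at_right 0. h s \<in> G"
    and h: "((\<lambda>s. (1 / s\<^sup>2) *\<^sub>R (h s - 1)) \<longlongrightarrow> spin_lift Y) (at_right 0)"
  shows "Y \<in> lie_algebra G"
proof -
  have pow: "a ^ n \<in> G" if "a \<in> G" for a n
    using G that by (induction n) (auto simp: compact_connected_subgroup_def)
  have pos: "exp (t *\<^sub>R spin_lift Y) \<in> G" if t: "t > 0" for t
  proof -
    define g where "g n = h (sqrt (t / real n))" for n
    have "((\<lambda>n. sqrt (t / real n)) \<longlongrightarrow> sqrt 0) sequentially"
      by (intro tendsto_real_sqrt lim_const_over_n)
    then have lim: "filterlim (\<lambda>n. sqrt (t / real n)) (at_right 0) sequentially"
      using t by (auto simp: filterlim_at eventually_sequentially intro!: exI [of _ 1])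
    have "(\<lambda>n. t *\<^sub>R ((1 / (sqrt (t / real n))\<^sup>2) *\<^sub>R (g n - 1))) \<longlonglongrightarrow> t *\<^sub>R spin_lift Y"
      unfolding g_def by (intro tendsto_scaleR tendsto_const filterlim_compose [OF h lim])
    then have "(\<lambda>n. real n *\<^sub>R (g n - 1)) \<longlonglongrightarrow> t *\<^sub>R spin_lift Y"
      by (rule Lim_transform_eventually) (use t in \<open>auto simp: eventually_sequentially intro!: exI [of _ 1]\<close>)
    then have limg: "(\<lambda>n. g n ^ n) \<longlonglongrightarrow> exp (t *\<^sub>R spin_lift Y)"
      by (rule power_tendsto_exp)
    have evG: "\<forall>\<^sub>F n in sequentially. g n ^ n \<in> G"
      using filterlim_iff [THEN iffD1, OF lim, rule_format, OF hG]
      by eventually_elim (simp add: g_def pow)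
    have "closed G"
      using G by (simp add: compact_connected_subgroup_def compact_imp_closed)
    then show ?thesis
      by (rule Lim_in_closed_set [OF _ evG sequentially_bot limg])
  qed
  have "exp (t *\<^sub>R spin_lift Y) \<in> G" for t
  proof (cases t "0::real" rule: linorder_cases)
    case less
    define a where "a = exp ((- t) *\<^sub>R spin_lift Y)"
    have a: "a \<in> G" using pos [of "-t"] less by (simp add: a_def)
    then have "a \<in> spin_group" "reversal a \<in> G"
      using G by (auto simp: compact_connected_subgroup_def)
    moreover have "exp (t *\<^sub>R spin_lift Y) * a = 1"
      using exp_scaleR_add [of t "- t" "spin_lift Y"] by (simp add: a_def)
    then have "exp (t *\<^sub>R spin_lift Y) * (a * reversal a) = reversal a"
      by (simp flip: mult.assoc)
    ultimately show ?thesis by (simp add: spin_group_iff)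
  next
    case equal
    then show ?thesis using G by (simp add: compact_connected_subgroup_def)
  qed (rule pos)
  then show ?thesis
    using Y by (simp add: lie_algebra_def)
qed

lemma bounded_bilinear_matrix_mult:
  "bounded_bilinear ((**) :: 'a::{real_normed_algebra_1,comm_ring_1,euclidean_space}^'m^'n \<Rightarrow> 'a^'k^'m \<Rightarrow> 'a^'k^'n)"
proof (rule bilinear_conv_bounded_bilinear [THEN iffD1], unfold bilinear_def, intro conjI allI)
  show "linear ((**) A)" for A :: "'a^'m^'n"
    by (rule linearI) (simp_all add: vec_eq_iff matrix_matrix_mult_def algebra_simps sum.distrib scaleR_sum_right)
  show "linear (\<lambda>A. A ** B)" for B :: "'a^'k^'m"
    by (rule linearI) (simp_all add: vec_eq_iff matrix_matrix_mult_def algebra_simps sum.distrib scaleR_sum_right)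
qed

text \<open>P t times the integral of P over {0..d} is the integral over {t..t + d}, which is
  differentiable in t. For small d the mean over {0..d} is close to the identity, hence invertible,
  and can be divided out.\<close>

lemma one_parameter_differentiable:
  fixes P :: "real \<Rightarrow> 'a::{real_normed_field,euclidean_space}^'k^'k"
  assumes hom: "\<And>s t. P (s + t) = P s ** P t" and P0: "P 0 = mat 1" and cont: "continuous_on UNIV P"
  shows "\<exists>D. (P has_vector_derivative D) (at 0)"
proof -
  interpret mm: bounded_bilinear "(**) :: 'a^'k^'k \<Rightarrow> 'a^'k^'k \<Rightarrow> _"
    by (rule bounded_bilinear_matrix_mult)
  \<comment> \<open>The base point -2 lies to the left of every point that occurs, so all integrals
    are differences of J, and J is differentiable from both sides on {-1..1}.\<close>
  define J where "J u = integral {-2..u} P" for u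
  have contP: "continuous_on S P" for S
    using cont continuous_on_subset by blast
  have Jd: "(J has_vector_derivative P u) (at u)" if "u \<in> {-1..1}" for u
  proof -
    have "(J has_vector_derivative P u) (at u within {-2..2})"
      unfolding J_def using that by (intro integral_has_vector_derivative contP) auto
    then show ?thesis using that by (simp add: at_within_Icc_at)
  qed
  have J: "integral {s..t} P = J t - J s" if "-2 \<le> s" "s \<le> t" for s t
    using Henstock_Kurzweil_Integration.integral_combine [OF that integrable_continuous_real [OF contP]]
    by (simp add: J_def algebra_simps)
  have "((\<lambda>h. (1 / h) *\<^sub>R (J h - J 0)) \<longlongrightarrow> mat 1) (at 0)"
    using has_vector_derivative_quotient [OF Jd [of 0]] by (simp add: P0)
  then have "((\<lambda>h. det ((1 / h) *\<^sub>R (J h - J 0))) \<longlongrightarrow> det (mat 1 :: 'a^'k^'k)) (at 0)"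
    unfolding det_def by (intro tendsto_intros)
  then have "((\<lambda>h. det ((1 / h) *\<^sub>R (J h - J 0))) \<longlongrightarrow> 1) (at_right 0)"
    by (auto simp: filterlim_at_split)
  then have "\<forall>\<^sub>F h in at_right 0. det ((1 / h) *\<^sub>R (J h - J 0)) \<noteq> 0"
    by (rule tendsto_imp_eventually_ne) simp
  moreover have "\<forall>\<^sub>F h::real in at_right 0. 0 < h \<and> h < 1"
    using eventually_at_right_less eventually_at_right_field by (auto simp: eventually_at_right_field intro!: exI [of _ 1])
  ultimately have "\<forall>\<^sub>F h::real in at_right 0. (0 < h \<and> h < 1) \<and> det ((1 / h) *\<^sub>R (J h - J 0)) \<noteq> 0"
    by (simp add: eventually_conj_iff)
  then obtain d where d: "0 < d" "d < 1" "det ((1 / d) *\<^sub>R (J d - J 0)) \<noteq> 0"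
    using eventually_happens' [OF trivial_limit_at_right_real] by blast
  define R where "R = (1 / d) *\<^sub>R (J d - J 0)"
  obtain R' where R': "R ** R' = mat 1"
    using d(3) unfolding R_def [symmetric] by (meson invertible_def invertible_det_nz)
  have "P t = ((1 / d) *\<^sub>R (J (t + d) - J t)) ** R'" if "t \<in> {-1..1}" for t
  proof -
    have "P t ** (J d - J 0) = integral {0..d} (\<lambda>s. P t ** P s)"
      using d J [of 0 d]
      by (simp add: integral_linear [OF integrable_continuous_real [OF contP] mm.bounded_linear_right, unfolded o_def])
    also have "\<dots> = integral {0..d} (P \<circ> (+) t)"
      by (simp add: o_def hom)
    also have "\<dots> = integral {0 + t..d + t} P"
      by (rule integral_shift_Icc_real)
    also have "\<dots> = J (t + d) - J t"
      using d that by (simp add: J add.commute)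
    finally have "P t ** R = (1 / d) *\<^sub>R (J (t + d) - J t)"
      by (simp add: R_def mm.scaleR_right)
    then show ?thesis
      by (metis R' matrix_mul_assoc matrix_mul_rid)
  qed
  note P_eq = this
  have "((\<lambda>t. J (t + d)) has_vector_derivative P d) (at 0)"
    using Jd [of d] d by (simp add: has_vector_derivative_def has_derivative_at add.commute shift_has_derivative_id) 
  then have "((\<lambda>t. ((1 / d) *\<^sub>R (J (t + d) - J t)) ** R') has_vector_derivative
      ((1 / d) *\<^sub>R (P d - P 0)) ** R') (at 0)"
    by (intro bounded_linear.has_vector_derivative [OF mm.bounded_linear_left]
        bounded_linear.has_vector_derivative [OF bounded_linear_scaleR_right] has_vector_derivative_diff Jd) auto
  then show ?thesis
    by (intro exI, rule has_vector_derivative_transform_within_open [where S = "{-1<..<1}"]) (simp_all add: P_eq)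
qed

section \<open>Lie algebras of closed subgroups and their representations\<close>

lemma exp_lie_algebra: "X \<in> lie_algebra G \<Longrightarrow> exp (t *\<^sub>R spin_lift X) \<in> G"
  by (simp add: lie_algebra_def)

lemma lie_algebra_uminus:
  assumes "X \<in> lie_algebra G"
  shows "- X \<in> lie_algebra G"
proof -
  have "exp (t *\<^sub>R spin_lift (- X)) \<in> G" for t
    using exp_lie_algebra [OF assms, of "- t"] by (simp add: spin_lift_linear)
  moreover have "transpose (- X) = - transpose X"
    by (simp add: transpose_def vec_eq_iff)
  ultimately show ?thesis
    using assms by (simp add: lie_algebra_def)
qed

lemma continuous_on_exp_scaleR:
  fixes L :: "'a::{real_normed_algebra_1,banach}"
  shows "continuous_on S (\<lambda>t. exp (t *\<^sub>R L))"
  using exp_scaleR_has_vector_derivative_right [of L] by (rule continuous_on_vector_derivative)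

text \<open>\<open>d_rep\<close> is a \<open>vector_derivative\<close>, which is meaningful only
  where the derivative exists. It does here because \<pi> along the exponentials is a continuous
  one-parameter group.\<close>

lemma rep_exp_has_vector_derivative:
  assumes "unitary_rep G \<pi>" "X \<in> lie_algebra G"
  shows "((\<lambda>t. \<pi> (exp (t *\<^sub>R spin_lift X))) has_vector_derivative d_rep \<pi> X) (at 0)"
proof -
  have "continuous_on UNIV (\<lambda>t. \<pi> (exp (t *\<^sub>R spin_lift X)))"
  proof (rule continuous_on_compose2 [of G \<pi> UNIV "\<lambda>t. exp (t *\<^sub>R spin_lift X)"])
    show "continuous_on G \<pi>" using assms by (simp add: unitary_rep_def)
    show "continuous_on UNIV (\<lambda>t. exp (t *\<^sub>R spin_lift X))"
      by (rule continuous_on_exp_scaleR)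
  qed (use assms in \<open>auto simp: exp_lie_algebra\<close>)
  moreover have "\<pi> (exp ((s + t) *\<^sub>R spin_lift X)) = \<pi> (exp (s *\<^sub>R spin_lift X)) ** \<pi> (exp (t *\<^sub>R spin_lift X))" for s t
    unfolding exp_scaleR_add using assms by (simp add: unitary_rep_def exp_lie_algebra)
  moreover have "\<pi> (exp (0 *\<^sub>R spin_lift X)) = mat 1"
    using assms by (simp add: unitary_rep_def)
  ultimately obtain D where D: "((\<lambda>t. \<pi> (exp (t *\<^sub>R spin_lift X))) has_vector_derivative D) (at 0)"
    using one_parameter_differentiable [of "\<lambda>t. \<pi> (exp (t *\<^sub>R spin_lift X))"] by blast
  then show ?thesis
    unfolding d_rep_def vector_derivative_at [OF D] .
qed

text \<open>The powers \<open>g n ^ k\<close>, \<open>k \<le> n\<close>, tend to \<open>1\<close> uniformly, so \<open>\<pi> (g n ^ n) - 1 =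
  (\<pi> (g n) - 1) (\<Sum>k<n. \<pi> (g n ^ k))\<close> is close to \<open>n (\<pi> (g n) - 1)\<close>.\<close>

lemma rep_quotient_tendsto_zero:
  fixes \<pi> :: "'n::{finite,linorder} cliff \<Rightarrow> complex^'k^'k"
  assumes G: "compact_connected_subgroup G" and \<pi>: "unitary_rep G \<pi>"
    and gG: "\<And>n. g n \<in> G" and g: "(\<lambda>n. real n *\<^sub>R (g n - 1)) \<longlonglongrightarrow> 0"
  shows "(\<lambda>n. real n *\<^sub>R (\<pi> (g n) - mat 1)) \<longlonglongrightarrow> 0"
proof -
  interpret mm: bounded_bilinear "(**) :: complex^'k^'k \<Rightarrow> complex^'k^'k \<Rightarrow> _"
    by (rule bounded_bilinear_matrix_mult)
  from mm.pos_bounded obtain K where K: "0 < K" "\<forall>(A :: complex^'k^'k) (B :: complex^'k^'k). norm (A ** B) \<le> norm A * norm B * K"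
    by (elim exE conjE) (rule that)
  have one: "1 \<in> G" and mult: "\<And>a b. a \<in> G \<Longrightarrow> b \<in> G \<Longrightarrow> a * b \<in> G"
    using G by (auto simp: compact_connected_subgroup_def)
  have pow: "a ^ k \<in> G" if "a \<in> G" for a k
    using that by (induction k) (auto intro: one mult)
  have hom: "\<pi> (a * b) = \<pi> a ** \<pi> b" if "a \<in> G" "b \<in> G" for a b
    using \<pi> that by (simp add: unitary_rep_def)
  have \<pi>1: "\<pi> 1 = mat 1" using \<pi> by (simp add: unitary_rep_def)
  have small: "\<forall>\<^sub>F n in sequentially. \<forall>k\<le>n. norm (g n ^ k - 1) < d" if "d > 0" for d
  proof -
    \<comment> \<open>For all k up to n, \<open>norm_power_diff_le\<close> bounds the distance of g
      n ^ k from 1 by \<epsilon> n * exp (\<epsilon> n), a bound free of k.\<close>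
    define \<epsilon> where "\<epsilon> n = norm (real n *\<^sub>R (g n - 1))" for n
    have "(\<lambda>n. \<epsilon> n * exp (\<epsilon> n)) \<longlonglongrightarrow> 0 * exp 0"
      unfolding \<epsilon>_def by (intro tendsto_intros tendsto_norm_zero g)
    then have "\<forall>\<^sub>F n in sequentially. \<epsilon> n * exp (\<epsilon> n) < d"
      using that by (auto dest: order_tendstoD(2))
    then show ?thesis
      using eventually_gt_at_top [of 0]
    proof eventually_elim
      case (elim n)
      have "norm (g n ^ k - 1) < d" if "k \<le> n" for k
      proof (cases k)
        case (Suc m)
        define e where "e = norm (g n - 1)"
        have e: "\<epsilon> n = real n * e" by (simp add: \<epsilon>_def e_def flip: scaleR_diff_right)
        have "norm (g n) \<le> 1 + e"
          using norm_triangle_ineq [of "g n - 1" 1] by (simp add: e_def)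
        then have "norm (g n ^ k - 1) \<le> real k * (1 + e) ^ m * e"
          using norm_power_diff_le [of "g n" "1 + e" 1 m] by (simp add: Suc e_def)
        also have "\<dots> \<le> real n * (1 + e) ^ n * e"
          using that Suc by (intro mult_mono power_increasing) (auto simp: e_def)
        also have "(1 + e) ^ n \<le> exp e ^ n"
          by (intro power_mono) (auto simp: e_def)
        also have "\<dots> = exp (\<epsilon> n)"
          by (simp add: e exp_of_nat_mult)
        finally have "norm (g n ^ k - 1) \<le> \<epsilon> n * exp (\<epsilon> n)"
          by (simp add: e e_def mult_left_mono mult_right_mono mult_ac)
        then show ?thesis using elim by simp
      qed (use that \<open>d > 0\<close> in simp)
      then show ?case by blast
    qed
  qed
  show ?thesis
  proof (rule LIMSEQ_I)
    fix r :: real assume "0 < r"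
    \<comment> \<open>The bound 1 / (2 * K) lets the error sum be absorbed into half of n * norm U;
      the bound r / 3 leaves 2 * \<epsilon> < r in the last line.\<close>
    define \<epsilon> where "\<epsilon> = min (r / 3) (1 / (2 * K))"
    have \<epsilon>: "0 < \<epsilon>" "2 * \<epsilon> < r" "2 * (K * \<epsilon>) \<le> 1"
      using \<open>0 < r\<close> K(1) by (auto simp: \<epsilon>_def min_def field_simps)
    obtain d where d: "d > 0" "\<And>a. a \<in> G \<Longrightarrow> norm (a - 1) < d \<Longrightarrow> norm (\<pi> a - mat 1) < \<epsilon>"
    proof -
      have "\<exists>d>0. \<forall>a\<in>G. dist a 1 < d \<longrightarrow> dist (\<pi> a) (\<pi> 1) < \<epsilon>"
        using \<pi> one \<epsilon>(1) unfolding unitary_rep_def continuous_on_iff by blast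
      then show ?thesis
        using that by (auto simp: dist_norm \<pi>1)
    qed
    obtain N where N: "\<And>n k. n \<ge> N \<Longrightarrow> k \<le> n \<Longrightarrow> norm (g n ^ k - 1) < d"
      using small [OF d(1)] by (auto simp: eventually_sequentially)
    have "norm (real n *\<^sub>R (\<pi> (g n) - mat 1)) < r" if "n \<ge> N" for n
    proof -
      define U where "U = \<pi> (g n) - mat 1"
      have near: "norm (\<pi> (g n ^ k) - mat 1) < \<epsilon>" if "k \<le> n" for k
        using d(2) pow [OF gG] N [OF \<open>n \<ge> N\<close> that] by blast
      have "\<pi> (g n ^ n) - mat 1 = (\<Sum>k<n. \<pi> (g n ^ Suc k) - \<pi> (g n ^ k))"
        using sum_lessThan_telescope [of "\<lambda>k. \<pi> (g n ^ k)" n] by (simp add: \<pi>1)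
      also have "\<dots> = (\<Sum>k<n. U + U ** (\<pi> (g n ^ k) - mat 1))"
        using gG pow by (simp add: hom U_def mm.diff_left mm.diff_right)
      also have "\<dots> = real n *\<^sub>R U + (\<Sum>k<n. U ** (\<pi> (g n ^ k) - mat 1))"
        by (simp add: sum.distrib scaleR_conv_of_real flip: sum_constant_scaleR)
      finally have eq: "real n *\<^sub>R U = (\<pi> (g n ^ n) - mat 1) - (\<Sum>k<n. U ** (\<pi> (g n ^ k) - mat 1))"
        by simp
      have "norm (\<Sum>k<n. U ** (\<pi> (g n ^ k) - mat 1)) \<le> (\<Sum>k<n. norm U * \<epsilon> * K)"
      proof (rule sum_norm_le)
        fix k assume "k \<in> {..<n}"
        then have "norm U * norm (\<pi> (g n ^ k) - mat 1) * K \<le> norm U * \<epsilon> * K"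
          using K(1) near [of k] by (intro mult_right_mono mult_left_mono) auto
        then show "norm (U ** (\<pi> (g n ^ k) - mat 1)) \<le> norm U * \<epsilon> * K"
          using K(2) [rule_format, of U "\<pi> (g n ^ k) - mat 1"] by (rule order_trans [rotated])
      qed
      then have "real n * norm U \<le> \<epsilon> + real n * (norm U * \<epsilon> * K)"
        using near [of n] norm_triangle_ineq4 [of "\<pi> (g n ^ n) - mat 1" "\<Sum>k<n. U ** (\<pi> (g n ^ k) - mat 1)"]
        unfolding eq [symmetric] by simp
      moreover have "2 * (real n * (norm U * \<epsilon> * K)) \<le> real n * norm U"
        using mult_left_mono [OF \<epsilon>(3), of "real n * norm U"] by (simp add: mult_ac)
      ultimately have "real n * norm U \<le> 2 * \<epsilon>"
        by linarith
      then show ?thesis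
        using \<epsilon>(2) by (simp add: U_def flip: scaleR_diff_right)
    qed
    then show "\<exists>no. \<forall>n\<ge>no. norm (real n *\<^sub>R (\<pi> (g n) - mat 1) - 0) < r"
      by auto
  qed
qed

lemma has_vector_derivative_at_zero_sequentially:
  assumes "(f has_vector_derivative D) (at (0::real))"
  shows "(\<lambda>n. real n *\<^sub>R (f (1 / real n) - f 0)) \<longlonglongrightarrow> D"
proof -
  have "filterlim (\<lambda>n. 1 / real n) (at 0) sequentially"
    by (auto simp: filterlim_at lim_1_over_n eventually_sequentially intro!: exI [of _ 1])
  from filterlim_compose [OF has_vector_derivative_quotient [OF assms] this]
  show ?thesis by simp
qed

text \<open>The product of the exponentials of X / n, Y / n and -(X + Y) / n is 1 + o(1/n), hence so
  is its image under \<pi> by \<open>rep_quotient_tendsto_zero\<close>. Multiplying by the image of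
  the exponential of (X + Y) / n compares the two sides to first order.\<close>

lemma d_rep_add:
  fixes \<pi> :: "'n::{finite,linorder} cliff \<Rightarrow> complex^'k^'k"
  assumes G: "compact_connected_subgroup G" and \<pi>: "unitary_rep G \<pi>"
    and X: "X \<in> lie_algebra G" and Y: "Y \<in> lie_algebra G" and XY: "X + Y \<in> lie_algebra G"
  shows "d_rep \<pi> (X + Y) = d_rep \<pi> X + d_rep \<pi> Y"
proof -
  interpret mm: bounded_bilinear "(**) :: complex^'k^'k \<Rightarrow> complex^'k^'k \<Rightarrow> _"
    by (rule bounded_bilinear_matrix_mult)
  define W where "W = X + Y"
  have XYW: "W \<in> lie_algebra G" using XY by (simp add: W_def)
  define E where "E X t = exp (t *\<^sub>R spin_lift X)" for X :: "'n rmat" and t :: real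
  have E: "(E X has_vector_derivative spin_lift X) (at 0)" for X
    using exp_scaleR_has_vector_derivative_right [of "spin_lift X" 0] by (simp add: E_def [abs_def])
  have E0: "E X 0 = 1" for X by (simp add: E_def)
  have \<pi>1: "\<pi> 1 = mat 1" using \<pi> by (simp add: unitary_rep_def)
  have EG: "E Z t \<in> G" if "Z \<in> lie_algebra G" for Z t
    using that by (simp add: E_def exp_lie_algebra)
  have Z: "- W \<in> lie_algebra G"
    using XYW by (rule lie_algebra_uminus)
  have inv: "E (- W) t * E W t = 1" for t
    using exp_scaleR_add [of "-t" t "spin_lift W"] by (simp add: E_def spin_lift_linear)
  define g where "g n = E X (1 / real n) * E Y (1 / real n) * E (- W) (1 / real n)" for n
  have gG: "g n \<in> G" for n
    using G EG [OF X] EG [OF Y] EG [OF Z] by (simp add: g_def compact_connected_subgroup_def)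
  have "((\<lambda>t. E X t * E Y t * E (- W) t) has_vector_derivative 0) (at 0)"
    using has_vector_derivative_mult [OF has_vector_derivative_mult [OF E [of X] E [of Y]] E [of "- W"]]
    by (simp add: E0 W_def spin_lift_linear(3) spin_lift_linear(1) del: minus_add_distrib)
  then have "(\<lambda>n. real n *\<^sub>R (g n - 1)) \<longlonglongrightarrow> 0"
    using has_vector_derivative_at_zero_sequentially by (fastforce simp: g_def E0)
  then have "(\<lambda>n. real n *\<^sub>R (\<pi> (g n) - mat 1)) \<longlonglongrightarrow> 0"
    by (rule rep_quotient_tendsto_zero [OF G \<pi> gG])
  moreover have P: "((\<lambda>t. \<pi> (E Z t)) has_vector_derivative d_rep \<pi> Z) (at 0)" if "Z \<in> lie_algebra G" for Z
    using rep_exp_has_vector_derivative [OF \<pi> that] by (simp add: E_def)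
  have "(\<lambda>n. \<pi> (E W (1 / real n))) \<longlonglongrightarrow> \<pi> (E W 0)"
    using has_vector_derivative_continuous [OF P [OF XYW]] lim_1_over_n [where 'a = real]
    by (rule isCont_tendsto_compose)
  ultimately have lim0: "(\<lambda>n. (real n *\<^sub>R (\<pi> (g n) - mat 1)) ** \<pi> (E W (1 / real n))) \<longlonglongrightarrow> 0 ** \<pi> (E W 0)"
    by (rule mm.tendsto)
  have "(\<pi> (g n) - mat 1) ** \<pi> (E W t) = \<pi> (E X t) ** \<pi> (E Y t) - \<pi> (E W t)" if "t = 1 / real n" for n t
  proof -
    have "g n * E W t = E X t * E Y t"
      unfolding g_def that [symmetric] using inv [of t] by (simp add: mult.assoc)
    moreover have "\<pi> (a * b) = \<pi> a ** \<pi> b" if "a \<in> G" "b \<in> G" for a b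
      using \<pi> that by (simp add: unitary_rep_def)
    ultimately show ?thesis
      using EG [OF X] EG [OF Y] EG [OF XYW] gG by (simp add: mm.diff_left flip: \<open>\<And>b a. a \<in> G \<Longrightarrow> b \<in> G \<Longrightarrow> \<pi> (a * b) = \<pi> a ** \<pi> b\<close>)
  qed
  with lim0 have "(\<lambda>n. real n *\<^sub>R (\<pi> (E X (1 / real n)) ** \<pi> (E Y (1 / real n)) - \<pi> (E W (1 / real n)))) \<longlonglongrightarrow> 0"
    by (simp add: mm.scaleR_left mm.zero_left del: scaleR_diff_right)
  moreover have "((\<lambda>t. \<pi> (E X t) ** \<pi> (E Y t) - \<pi> (E W t)) has_vector_derivative
      (\<pi> (E X 0) ** d_rep \<pi> Y + d_rep \<pi> X ** \<pi> (E Y 0)) - d_rep \<pi> W) (at 0)"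
    by (intro has_vector_derivative_diff mm.has_vector_derivative P X Y XYW)
  from has_vector_derivative_at_zero_sequentially [OF this]
  have "(\<lambda>n. real n *\<^sub>R (\<pi> (E X (1 / real n)) ** \<pi> (E Y (1 / real n)) - \<pi> (E W (1 / real n)))) \<longlonglongrightarrow>
      d_rep \<pi> Y + d_rep \<pi> X - d_rep \<pi> W"
    by (simp add: E0 \<pi>1 del: scaleR_diff_right)
  ultimately have "d_rep \<pi> Y + d_rep \<pi> X - d_rep \<pi> W = 0"
    using LIMSEQ_unique by blast
  then show ?thesis by (simp add: W_def algebra_simps)
qed

lemma d_rep_scaleR:
  assumes \<pi>: "unitary_rep G \<pi>" and X: "X \<in> lie_algebra G"
  shows "d_rep \<pi> (r *\<^sub>R X) = r *\<^sub>R d_rep \<pi> X"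
proof -
  have "((\<lambda>t. r * t) has_vector_derivative r) (at 0)"
    by (auto intro!: derivative_eq_intros simp flip: has_real_derivative_iff_has_vector_derivative)
  moreover have "((\<lambda>t. \<pi> (exp (t *\<^sub>R spin_lift X))) has_vector_derivative d_rep \<pi> X) (at (r * 0))"
    using rep_exp_has_vector_derivative [OF assms] by simp
  ultimately have "((\<lambda>t. \<pi> (exp (t *\<^sub>R spin_lift X))) \<circ> (\<lambda>t. r * t) has_vector_derivative r *\<^sub>R d_rep \<pi> X) (at 0)"
    by (rule vector_diff_chain_at)
  then show ?thesis
    by (simp add: d_rep_def o_def spin_lift_linear mult.commute vector_derivative_at)
qed

section \<open>Linear differential equations\<close>

text \<open>The bound makes the Picard operator a contraction, so no Gronwall estimate is needed.\<close>


locale bounded_action = bounded_bilinear act for act :: "'a::real_normed_vector \<Rightarrow> 'b::banach \<Rightarrow> 'b"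
begin

lemma linear_ode_exists:
  assumes A: "continuous_on {0..1} A"
    and bound: "\<And>t x. t \<in> {0..1} \<Longrightarrow> norm (act (A t) x) \<le> norm x / 2"
  shows "\<exists>f. f 0 = f0 \<and> (\<forall>t\<in>{0..1::real}. (f has_vector_derivative act (A t) (f t)) (at t within {0..1}))"
proof -
  define J where "J f u = f0 + integral {0..u} (\<lambda>t. act (A t) (f t))" for f and u :: real
  have cont: "continuous_on {0..1} (\<lambda>t. act (A t) (apply_bcontfun f t))" for f
    by (intro continuous_on A continuous_on_apply_bcontfun)
  have J: "continuous_on {0..1} (J (apply_bcontfun f))" for f
    unfolding J_def by (intro continuous_intros indefinite_integral_continuous_1 integrable_continuous_real cont)
  \<comment> \<open>The fixed point is sought among bounded continuous functions on the whole line;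
    clamping extends the integral constantly outside {0..1}.\<close>
  have "\<exists>g. \<forall>t. apply_bcontfun g t = J (apply_bcontfun f) (clamp 0 1 t)" for f
  proof -
    have "continuous_on (cbox 0 1) (J (apply_bcontfun f))"
      using J by simp
    from continuous_on_cbox_bcontfunE [OF this] show ?thesis by metis
  qed
  then obtain T where T: "\<And>f t. apply_bcontfun (T f) t = J (apply_bcontfun f) (clamp 0 1 t)"
    by metis
  have "dist (T f) (T g) \<le> 1 / 2 * dist f g" for f g
  proof (rule dist_bound)
    fix t
    define u :: real where "u = clamp 0 1 t"
    have u: "u \<in> {0..1}"
      using clamp_in_interval [of 0 1 t] by (simp add: u_def)
    have "dist (apply_bcontfun (T f) t) (apply_bcontfun (T g) t) =
        norm (integral {0..u} (\<lambda>t. act (A t) (apply_bcontfun f t)) - integral {0..u} (\<lambda>t. act (A t) (apply_bcontfun g t)))"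
      by (simp add: T J_def dist_norm u_def)
    also have "\<dots> = norm (integral {0..u} (\<lambda>t. act (A t) (apply_bcontfun f t) - act (A t) (apply_bcontfun g t)))"
      using u by (subst Henstock_Kurzweil_Integration.integral_diff)
        (auto intro!: integrable_continuous_real continuous_on_subset [OF cont])
    also have "\<dots> \<le> (dist f g / 2) * (u - 0)"
    proof (rule integral_bound)
      show "continuous_on {0..u} (\<lambda>t. act (A t) (apply_bcontfun f t) - act (A t) (apply_bcontfun g t))"
        using u by (intro continuous_on_diff continuous_on_subset [OF cont]) auto
      fix s assume s: "s \<in> {0..u}"
      have "norm (act (A s) (apply_bcontfun f s - apply_bcontfun g s)) \<le> norm (apply_bcontfun f s - apply_bcontfun g s) / 2"
        using s u by (intro bound) auto
      also have "\<dots> \<le> dist f g / 2"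
        using dist_bounded [of f s g] by (simp add: dist_norm)
      finally show "norm (act (A s) (apply_bcontfun f s) - act (A s) (apply_bcontfun g s)) \<le> dist f g / 2"
        by (simp add: diff_right)
    qed (use u in auto)
    also have "\<dots> \<le> (dist f g / 2) * 1"
      using u by (intro mult_left_mono) auto
    finally show "dist (apply_bcontfun (T f) t) (apply_bcontfun (T g) t) \<le> 1 / 2 * dist f g" by simp
  qed
  then obtain f where f: "T f = f"
    using banach_fix_type [of "1/2" T] by auto
  have fJ: "apply_bcontfun f t = J (apply_bcontfun f) t" if "t \<in> {0..1}" for t
    using T [of f t] that by (simp add: f clamp_cancel_cbox)
  show ?thesis
  proof (intro exI conjI ballI)
    show "apply_bcontfun f 0 = f0"
      using fJ [of 0] by (simp add: J_def)
    fix t :: real assume t: "t \<in> {0..1}"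
    have "(J (apply_bcontfun f) has_vector_derivative 0 + act (A t) (apply_bcontfun f t)) (at t within {0..1})"
      unfolding J_def by (intro has_vector_derivative_add has_vector_derivative_const integral_has_vector_derivative cont t)
    then have d: "(J (apply_bcontfun f) has_vector_derivative act (A t) (apply_bcontfun f t)) (at t within {0..1})"
      by simp
    show "(apply_bcontfun f has_vector_derivative act (A t) (apply_bcontfun f t)) (at t within {0..1})"
      by (rule has_vector_derivative_transform [OF t fJ d])
  qed
qed

end

text \<open>Little-o of s^k as s tends to 0 from the right, uniformly in t. In the application s is
  the length of a coordinate segment and t the parameter along it.\<close>

definition uniformly_small :: "nat \<Rightarrow> (real \<Rightarrow> real \<Rightarrow> 'a::real_normed_vector) \<Rightarrow> bool" where
  "uniformly_small k f \<longleftrightarrow> (\<forall>\<epsilon>>0. \<forall>\<^sub>F s in at_right 0. \<forall>t\<in>{0..1}. norm (f s t) \<le> \<epsilon> * s ^ k)"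

lemma uniformly_smallD:
  "uniformly_small k f \<Longrightarrow> \<epsilon> > 0 \<Longrightarrow> \<forall>\<^sub>F s in at_right 0. \<forall>t\<in>{0..1}. norm (f s t) \<le> \<epsilon> * s ^ k"
  by (simp add: uniformly_small_def)

lemma uniformly_small_add:
  assumes "uniformly_small k f" "uniformly_small k g"
  shows "uniformly_small k (\<lambda>s t. f s t + g s t)"
  unfolding uniformly_small_def
proof (intro allI impI)
  fix \<epsilon> :: real assume "\<epsilon> > 0"
  then have "\<epsilon> / 2 > 0" by simp
  from assms [THEN uniformly_smallD, OF this] show "\<forall>\<^sub>F s in at_right 0. \<forall>t\<in>{0..1}. norm (f s t + g s t) \<le> \<epsilon> * s ^ k"
  proof eventually_elim
    case (elim s)
    show ?case
    proof
      fix t :: real assume "t \<in> {0..1}"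
      then have "norm (f s t) \<le> \<epsilon>/2 * s ^ k" "norm (g s t) \<le> \<epsilon>/2 * s ^ k" using elim by auto
      then show "norm (f s t + g s t) \<le> \<epsilon> * s ^ k"
        using norm_triangle_ineq [of "f s t" "g s t"] by linarith
    qed
  qed
qed

lemma uniformly_small_bound:
  assumes f: "uniformly_small k f" and C: "\<forall>\<^sub>F s in at_right 0. \<forall>t\<in>{0..1}. norm (g s t) \<le> C * s ^ m * norm (f s t)"
  shows "uniformly_small (k + m) g"
  unfolding uniformly_small_def
proof (intro allI impI)
  fix \<epsilon> :: real assume "\<epsilon> > 0"
  \<comment> \<open>C may be zero or negative; D is a positive bound by which \<epsilon> can be
    divided.\<close>
  define D where "D = \<bar>C\<bar> + 1"
  have D: "D > 0" "C \<le> D" by (auto simp: D_def)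
  have "\<forall>\<^sub>F s in at_right 0. \<forall>t\<in>{0..1}. norm (f s t) \<le> \<epsilon> / D * s ^ k"
    using D \<open>\<epsilon> > 0\<close> by (intro uniformly_smallD [OF f] divide_pos_pos)
  then show "\<forall>\<^sub>F s in at_right 0. \<forall>t\<in>{0..1}. norm (g s t) \<le> \<epsilon> * s ^ (k + m)"
    using C eventually_at_right_less
  proof eventually_elim
    case (elim s)
    show ?case
    proof
      fix t :: real assume "t \<in> {0..1}"
      then have "norm (g s t) \<le> C * s ^ m * norm (f s t)" "norm (f s t) \<le> \<epsilon> / D * s ^ k" using elim by auto
      moreover have "C * s ^ m * norm (f s t) \<le> D * s ^ m * norm (f s t)"
        using D elim by (intro mult_right_mono) auto
      moreover have "D * s ^ m * norm (f s t) \<le> D * s ^ m * (\<epsilon> / D * s ^ k)"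
        using D elim calculation by (intro mult_left_mono) auto
      ultimately show "norm (g s t) \<le> \<epsilon> * s ^ (k + m)"
        using D by (simp add: power_add mult_ac)
    qed
  qed
qed

lemma norm_le_of_vector_derivative_bound:
  fixes f :: "real \<Rightarrow> 'a::real_normed_vector"
  assumes "\<And>t. t \<in> {0..1} \<Longrightarrow> (f has_vector_derivative f' t) (at t within {0..1})"
    and "\<And>t. t \<in> {0..1} \<Longrightarrow> norm (f' t) \<le> B" and "t \<in> {0..1}"
  shows "norm (f t - f 0) \<le> B"
proof -
  have "norm (f t - f 0) \<le> B * norm (t - 0)"
  proof (rule differentiable_bound [of "{0..1}"])
    show "(f has_derivative (\<lambda>h. h *\<^sub>R f' x)) (at x within {0..1})" if "x \<in> {0..1}" for x
      using assms(1) [OF that] by (simp add: has_vector_derivative_def)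
    show "onorm (\<lambda>h. h *\<^sub>R f' x) \<le> B" if "x \<in> {0..1}" for x
      using assms(2) [OF that] by (simp add: onorm_scaleR_left onorm_id)
  qed (use assms(3) in auto)
  also have "\<dots> \<le> B * 1"
    using assms(3) order_trans [OF norm_ge_zero assms(2) [OF assms(3)]] by (intro mult_left_mono) auto
  finally show ?thesis by simp
qed

text \<open>For raising the accuracy of an expansion: a remainder that vanishes at t = 0 has the
  order of its derivative, and the differential equation expresses that derivative through a coarser
  remainder.\<close>

lemma uniformly_small_integrate:
  assumes g: "uniformly_small k g"
    and d: "\<forall>\<^sub>F s in at_right 0. \<forall>t\<in>{0..1}. (f s has_vector_derivative g s t) (at t within {0..1})"
    and f0: "\<And>s. f s 0 = 0"
  shows "uniformly_small k f"
  unfolding uniformly_small_def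
proof (intro allI impI)
  fix \<epsilon> :: real assume "\<epsilon> > 0"
  then have "\<forall>\<^sub>F s in at_right 0. \<forall>t\<in>{0..1}. norm (g s t) \<le> \<epsilon> * s ^ k"
    using g by (simp add: uniformly_small_def)
  then show "\<forall>\<^sub>F s in at_right 0. \<forall>t\<in>{0..1}. norm (f s t) \<le> \<epsilon> * s ^ k"
    using d
  proof eventually_elim
    case (elim s)
    then show ?case
      using norm_le_of_vector_derivative_bound [of "f s" "g s" "\<epsilon> * s ^ k"] f0 [of s] by auto
  qed
qed

lemma uniformly_smallI:
  assumes "\<forall>\<^sub>F s in at_right 0. \<forall>t\<in>{0..1}. norm (f s t) \<le> C * s ^ Suc k"
  shows "uniformly_small k f"
  unfolding uniformly_small_def
proof (intro allI impI)
  fix \<epsilon> :: real assume "\<epsilon> > 0"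
  have "((\<lambda>s. C * s) \<longlongrightarrow> C * 0) (at_right 0)"
    by (intro tendsto_intros)
  then have "\<forall>\<^sub>F s in at_right 0. C * s < \<epsilon>"
    using \<open>\<epsilon> > 0\<close> by (auto dest: order_tendstoD(2))
  then show "\<forall>\<^sub>F s in at_right 0. \<forall>t\<in>{0..1}. norm (f s t) \<le> \<epsilon> * s ^ k"
    using assms eventually_at_right_less
  proof eventually_elim
    case (elim s)
    then have "C * s * s ^ k \<le> \<epsilon> * s ^ k" by (intro mult_right_mono) auto
    then have "C * s ^ Suc k \<le> \<epsilon> * s ^ k" by (simp add: mult.assoc)
    then show ?case using elim(2) by (meson order_trans)
  qed
qed

lemma uniformly_small_mono:
  assumes "uniformly_small (Suc k) f"
  shows "uniformly_small k f"
  using uniformly_smallI [of f 1 k] uniformly_smallD [OF assms, of 1] by simp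

lemma has_vector_derivative_scaleR_const:
  assumes "(g has_real_derivative g') F"
  shows "((\<lambda>t. g t *\<^sub>R c) has_vector_derivative g' *\<^sub>R c) F"
  using bounded_linear.has_vector_derivative [OF bounded_linear_scaleR_left]
    assms [unfolded has_real_derivative_iff_has_vector_derivative] by blast

context bounded_action
begin

text \<open>At the point u where the norm is largest, the mean value inequality bounds norm (F u) by
  norm (F 0) + c * norm (F u), and c \<le> 1/2 lets the last term be absorbed.\<close>

lemma linear_ode_bound:
  assumes d: "\<And>t. t \<in> {0..1} \<Longrightarrow> (F has_vector_derivative act (A t) (F t)) (at t within {0..1})"
    and bound: "\<And>t x. t \<in> {0..1} \<Longrightarrow> norm (act (A t) x) \<le> c * norm x" and c: "c \<le> 1/2"
    and t: "t \<in> {0..1}"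
  shows "norm (F t) \<le> 2 * norm (F 0)" "norm (F t - F 0) \<le> 2 * c * norm (F 0)"
proof -
  have "continuous_on {0..1} (\<lambda>t. norm (F t))"
    using d by (intro continuous_on_norm continuous_on_vector_derivative)
  then obtain u where u: "u \<in> {0..1}" "\<And>t. t \<in> {0..1} \<Longrightarrow> norm (F t) \<le> norm (F u)"
    using continuous_attains_sup [of "{0..1::real}" "\<lambda>t. norm (F t)"] by auto
  \<comment> \<open>The bound forces c to be nonnegative only in the presence of a nonzero vector,
    so zero values are treated apart below.\<close>
  have c0: "c \<ge> 0" if "y \<noteq> 0" for y :: 'b
    using order_trans [OF norm_ge_zero bound [OF t, of y]] that by (simp add: zero_le_mult_iff)
  have le: "norm (F t - F 0) \<le> c * norm (F u)" if "t \<in> {0..1}" for t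
  proof (rule norm_le_of_vector_derivative_bound [OF d _ that])
    fix t :: real assume t: "t \<in> {0..1}"
    show "norm (act (A t) (F t)) \<le> c * norm (F u)"
    proof (cases "F t = 0")
      case True
      then show ?thesis
        using c0 [of "F u"] by (cases "F u = 0") (auto simp: zero_right)
    next
      case False
      then have "c * norm (F t) \<le> c * norm (F u)"
        using u(2) [OF t] c0 [OF False] by (intro mult_left_mono)
      then show ?thesis using bound [OF t, of "F t"] by linarith
    qed
  qed
  have "c * norm (F u) \<le> norm (F u) / 2"
    using c mult_right_mono [OF c norm_ge_zero [of "F u"]] by simp
  then have Fu: "norm (F u) \<le> 2 * norm (F 0)"
    using le [OF u(1)] norm_triangle_ineq2 [of "F u" "F 0"] by linarith
  then show "norm (F t) \<le> 2 * norm (F 0)"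
    using u(2) [OF t] by linarith
  have "c * norm (F u) \<le> c * (2 * norm (F 0))"
  proof (cases "F u = 0")
    case True
    then have "F 0 = 0" using u(2) [of 0] by simp
    then show ?thesis using True by simp
  qed (use Fu c0 in \<open>auto intro!: mult_left_mono\<close>)
  then show "norm (F t - F 0) \<le> 2 * c * norm (F 0)"
    using le [OF t] by simp
qed

text \<open>G is the coefficient at the base point, U its change caused by a displaced starting
  point, V its change along the segment. V and the iterated G carry the factor 1/2, the integral of
  t over {0..1}. The first-order term is taken at F s 0 and not at the limit x, since F s 0 may
  itself move at first order.\<close>

lemma segment_expansion:
  assumes F: "\<forall>\<^sub>F s in at_right 0. \<forall>t\<in>{0..1}. (F s has_vector_derivative act (A s t) (F s t)) (at t within {0..1})"
    and A: "uniformly_small 2 (\<lambda>s t. A s t - s *\<^sub>R (G + s *\<^sub>R U + (s * t) *\<^sub>R V))"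
    and F0: "((\<lambda>s. F s 0) \<longlongrightarrow> x) (at_right 0)"
  shows "((\<lambda>s. (1 / s\<^sup>2) *\<^sub>R (F s 1 - F s 0 - s *\<^sub>R act G (F s 0))) \<longlongrightarrow>
    act U x + (1/2) *\<^sub>R act V x + (1/2) *\<^sub>R act G (act G x)) (at_right 0)"
proof -
  obtain K where K: "K > 0" "\<And>a b. norm (act a b) \<le> norm a * norm b * K"
    using pos_bounded by metis
  define e where "e s t = A s t - s *\<^sub>R (G + s *\<^sub>R U + (s * t) *\<^sub>R V)" for s t
  have A_eq: "A s t = s *\<^sub>R G + (s * s) *\<^sub>R (U + t *\<^sub>R V) + e s t" for s t
    by (simp add: e_def scaleR_add_right mult_ac)
  have e: "uniformly_small 2 e" using A by (simp add: e_def [abs_def])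
  define C where "C = norm G + norm U + norm V + 1"
  have C: "C > 0" by (simp add: C_def add_nonneg_pos)
  have s1: "\<forall>\<^sub>F s::real in at_right 0. 0 < s \<and> s < 1"
    by (auto simp: eventually_at_right_field intro!: exI [of _ 1])
  have UV: "norm (U + t *\<^sub>R V) \<le> norm U + norm V" if "t \<in> {0..1}" for t
  proof -
    have "norm (t *\<^sub>R V) \<le> 1 * norm V"
      unfolding norm_scaleR using that by (intro mult_right_mono) auto
    then show ?thesis using norm_triangle_ineq [of U "t *\<^sub>R V"] by linarith
  qed
  have A_le: "\<forall>\<^sub>F s in at_right 0. \<forall>t\<in>{0..1}. norm (A s t) \<le> C * s"
    using s1 uniformly_smallD [OF e zero_less_one]
  proof eventually_elim
    case (elim s)
    show ?case
    proof
      fix t :: real assume t: "t \<in> {0..1}"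
      have "s * s \<le> s * 1" using elim by (intro mult_left_mono) auto
      then have ss: "s * s \<le> s" by simp
      have "norm (e s t) \<le> s * s" using elim t by (auto simp: power2_eq_square)
      moreover have "norm ((s * s) *\<^sub>R (U + t *\<^sub>R V)) \<le> s * (norm U + norm V)"
        unfolding norm_scaleR using ss UV [OF t] elim by (intro mult_mono) auto
      moreover have "norm (s *\<^sub>R G) = s * norm G" using elim by simp
      moreover have "norm (A s t) \<le> norm (s *\<^sub>R G) + norm ((s * s) *\<^sub>R (U + t *\<^sub>R V)) + norm (e s t)"
        unfolding A_eq by (intro norm_triangle_le add_mono norm_triangle_ineq) simp
      ultimately show "norm (A s t) \<le> C * s"
      proof -
        assume *: "norm (e s t) \<le> s * s" "norm ((s * s) *\<^sub>R (U + t *\<^sub>R V)) \<le> s * (norm U + norm V)"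
          "norm (s *\<^sub>R G) = s * norm G"
          "norm (A s t) \<le> norm (s *\<^sub>R G) + norm ((s * s) *\<^sub>R (U + t *\<^sub>R V)) + norm (e s t)"
        have "C * s = s * norm G + s * (norm U + norm V) + s" by (simp add: C_def algebra_simps)
        then show ?thesis using * ss by linarith
      qed
    qed
  qed
  \<comment> \<open>\<open>norm x + 1\<close> bounds the starting values for small s, and the factor
    2 is that of \<open>linear_ode_bound\<close>.\<close>
  define D where "D = 2 * (norm x + 1)"
  have D: "D > 0" by (simp add: D_def add_nonneg_pos)
  have "((\<lambda>s. K * (C * s)) \<longlongrightarrow> K * (C * 0)) (at_right 0)"
    by (intro tendsto_intros)
  then have "\<forall>\<^sub>F s in at_right 0. K * (C * s) < 1/2"
    by (rule order_tendstoD(2)) simp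
  moreover have "\<forall>\<^sub>F s in at_right 0. norm (F s 0) < norm x + 1"
    using tendsto_norm [OF F0] by (rule order_tendstoD(2)) simp
  ultimately have F_le: "\<forall>\<^sub>F s in at_right 0. \<forall>t\<in>{0..1}. norm (F s t) \<le> D"
    using F A_le s1
  proof eventually_elim
    case (elim s)
    show ?case
    proof
      fix t :: real assume t: "t \<in> {0..1}"
      have "norm (F s t) \<le> 2 * norm (F s 0)"
      proof (rule linear_ode_bound [where A = "A s" and c = "K * (C * s)", OF _ _ _ t])
        fix t :: real and y :: 'b assume "t \<in> {0..1}"
        then have "norm (A s t) * norm y * K \<le> C * s * norm y * K"
          using elim K(1) by (intro mult_right_mono) auto
        then show "norm (act (A s t) y) \<le> K * (C * s) * norm y"
          using K(2) [of "A s t" y] by (simp add: mult_ac)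
      qed (use elim in auto)
      then show "norm (F s t) \<le> D" using elim by (simp add: D_def)
    qed
  qed
  have act_bound: "norm (act a b) \<le> p * q * K" if "norm a \<le> p" "norm b \<le> q" for a b p q
  proof -
    have "norm a * norm b * K \<le> p * q * K"
      using that K(1) by (intro mult_right_mono mult_mono) (auto intro: order_trans [OF norm_ge_zero])
    then show ?thesis using K(2) [of a b] by linarith
  qed
  have eF: "uniformly_small 2 (\<lambda>s t. act (e s t) (F s t))"
  proof -
    have "\<forall>\<^sub>F s in at_right 0. \<forall>t\<in>{0..1}. norm (act (e s t) (F s t)) \<le> (D * K) * s ^ 0 * norm (e s t)"
      using F_le by eventually_elim (use act_bound [OF order_refl] in \<open>auto simp: mult_ac\<close>)
    from uniformly_small_bound [OF e this] show ?thesis by simp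
  qed
  \<comment> \<open>The remainders in h0, h1 and h2 are estimated in turn: inserting one into the
    equation gains a factor s for the next.\<close>
  have h0: "uniformly_small 0 (\<lambda>s t. F s t - F s 0)"
  proof (rule uniformly_small_integrate)
    show "uniformly_small 0 (\<lambda>s t. act (A s t) (F s t))"
      by (rule uniformly_smallI [where C = "C * D * K"], use A_le F_le in eventually_elim)
        (use act_bound in \<open>fastforce simp: mult_ac\<close>)
    show "\<forall>\<^sub>F s in at_right 0. \<forall>t\<in>{0..1}. ((\<lambda>t. F s t - F s 0) has_vector_derivative act (A s t) (F s t)) (at t within {0..1})"
      using F by eventually_elim (auto intro!: derivative_eq_intros)
  qed simp
  have h1: "uniformly_small 1 (\<lambda>s t. F s t - F s 0 - (s * t) *\<^sub>R act G (F s 0))"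
  proof (rule uniformly_small_integrate)
    have a: "uniformly_small (0 + 1) (\<lambda>s t. s *\<^sub>R act G (F s t - F s 0))"
    proof (rule uniformly_small_bound [OF h0])
      show "\<forall>\<^sub>F s in at_right 0. \<forall>t\<in>{0..1}. norm (s *\<^sub>R act G (F s t - F s 0)) \<le> (norm G * K) * s ^ 1 * norm (F s t - F s 0)"
        using s1 by eventually_elim (use K(2) in \<open>auto simp: mult_ac intro!: mult_left_mono\<close>)
    qed
    have b: "uniformly_small 1 (\<lambda>s t. (s * s) *\<^sub>R act (U + t *\<^sub>R V) (F s t))"
    proof (rule uniformly_smallI)
      show "\<forall>\<^sub>F s in at_right 0. \<forall>t\<in>{0..1}. norm ((s * s) *\<^sub>R act (U + t *\<^sub>R V) (F s t)) \<le> ((norm U + norm V) * D * K) * s ^ Suc 1"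
        using s1 F_le
      proof eventually_elim
        case (elim s)
        show ?case
        proof
          fix t :: real assume "t \<in> {0..1}"
          then have "norm (act (U + t *\<^sub>R V) (F s t)) \<le> (norm U + norm V) * D * K"
            using elim by (intro act_bound UV) auto
          then have "(s * s) * norm (act (U + t *\<^sub>R V) (F s t)) \<le> (s * s) * ((norm U + norm V) * D * K)"
            by (intro mult_left_mono) auto
          then show "norm ((s * s) *\<^sub>R act (U + t *\<^sub>R V) (F s t)) \<le> ((norm U + norm V) * D * K) * s ^ Suc 1"
            by (simp add: mult_ac)
        qed
      qed
    qed
    have c: "uniformly_small 1 (\<lambda>s t. act (e s t) (F s t))"
      by (rule uniformly_small_mono) (use eF in \<open>simp add: numeral_2_eq_2\<close>)
    show "uniformly_small 1 (\<lambda>s t. s *\<^sub>R act G (F s t - F s 0) + (s * s) *\<^sub>R act (U + t *\<^sub>R V) (F s t) + act (e s t) (F s t))"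
      by (rule uniformly_small_add [OF uniformly_small_add [OF a [unfolded add_0] b] c])
    show "\<forall>\<^sub>F s in at_right 0. \<forall>t\<in>{0..1}. ((\<lambda>t. F s t - F s 0 - (s * t) *\<^sub>R act G (F s 0)) has_vector_derivative
       (s *\<^sub>R act G (F s t - F s 0) + (s * s) *\<^sub>R act (U + t *\<^sub>R V) (F s t) + act (e s t) (F s t))) (at t within {0..1})"
      using F
    proof eventually_elim
      case (elim s)
      show ?case
      proof
        fix t :: real assume "t \<in> {0..1}"
        with elim have "(F s has_vector_derivative act (A s t) (F s t)) (at t within {0..1})" by blast
        moreover have "((\<lambda>t. (s * t) *\<^sub>R act G (F s 0)) has_vector_derivative s *\<^sub>R act G (F s 0)) (at t within {0..1})"
          by (rule has_vector_derivative_scaleR_const) (auto intro!: derivative_eq_intros)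
        ultimately have "((\<lambda>t. F s t - F s 0 - (s * t) *\<^sub>R act G (F s 0)) has_vector_derivative
            (act (A s t) (F s t) - 0 - s *\<^sub>R act G (F s 0))) (at t within {0..1})"
          by (intro has_vector_derivative_diff has_vector_derivative_const)
        then show "((\<lambda>t. F s t - F s 0 - (s * t) *\<^sub>R act G (F s 0)) has_vector_derivative
            (s *\<^sub>R act G (F s t - F s 0) + (s * s) *\<^sub>R act (U + t *\<^sub>R V) (F s t) + act (e s t) (F s t))) (at t within {0..1})"
          by (simp add: A_eq add_left diff_right scaleR_left algebra_simps)
      qed
    qed
  qed simp
  \<comment> \<open>F minus its second-order Taylor polynomial in s, with the dependence on t kept:
    t for the constant part U, and t^2 / 2 for the part V that grows with t and for the iterated
    G.\<close>
  define H where "H s t = F s t - F s 0 - (s * t) *\<^sub>R act G (F s 0) - (s * s * t) *\<^sub>R act U (F s 0)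
    - (s * s * t\<^sup>2 / 2) *\<^sub>R (act V (F s 0) + act G (act G (F s 0)))" for s t
  have h2: "uniformly_small 2 H"
  proof (rule uniformly_small_integrate)
    have a: "uniformly_small (1 + 1) (\<lambda>s t. s *\<^sub>R act G (F s t - F s 0 - (s * t) *\<^sub>R act G (F s 0)))"
    proof (rule uniformly_small_bound [OF h1])
      show "\<forall>\<^sub>F s in at_right 0. \<forall>t\<in>{0..1}. norm (s *\<^sub>R act G (F s t - F s 0 - (s * t) *\<^sub>R act G (F s 0))) \<le>
          (norm G * K) * s ^ 1 * norm (F s t - F s 0 - (s * t) *\<^sub>R act G (F s 0))"
        using s1 by eventually_elim (use K(2) in \<open>auto simp: mult_ac intro!: mult_left_mono\<close>)
    qed
    have b: "uniformly_small (0 + 2) (\<lambda>s t. (s * s) *\<^sub>R act (U + t *\<^sub>R V) (F s t - F s 0))"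
    proof (rule uniformly_small_bound [OF h0])
      show "\<forall>\<^sub>F s in at_right 0. \<forall>t\<in>{0..1}. norm ((s * s) *\<^sub>R act (U + t *\<^sub>R V) (F s t - F s 0)) \<le>
          ((norm U + norm V) * K) * s ^ 2 * norm (F s t - F s 0)"
      proof (intro always_eventually allI ballI)
        fix s t :: real assume "t \<in> {0..1}"
        then have "norm (act (U + t *\<^sub>R V) (F s t - F s 0)) \<le> (norm U + norm V) * norm (F s t - F s 0) * K"
          by (intro act_bound UV) auto
        then have "(s * s) * norm (act (U + t *\<^sub>R V) (F s t - F s 0)) \<le> (s * s) * ((norm U + norm V) * norm (F s t - F s 0) * K)"
          by (intro mult_left_mono) auto
        then show "norm ((s * s) *\<^sub>R act (U + t *\<^sub>R V) (F s t - F s 0)) \<le> ((norm U + norm V) * K) * s ^ 2 * norm (F s t - F s 0)"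
          by (simp add: mult_ac power2_eq_square)
      qed
    qed
    show "uniformly_small 2 (\<lambda>s t. s *\<^sub>R act G (F s t - F s 0 - (s * t) *\<^sub>R act G (F s 0))
        + (s * s) *\<^sub>R act (U + t *\<^sub>R V) (F s t - F s 0) + act (e s t) (F s t))"
      using uniformly_small_add [OF uniformly_small_add [OF a [unfolded one_add_one] b [unfolded add_0]] eF] .
    show "\<forall>\<^sub>F s in at_right 0. \<forall>t\<in>{0..1}. (H s has_vector_derivative
       (s *\<^sub>R act G (F s t - F s 0 - (s * t) *\<^sub>R act G (F s 0))
        + (s * s) *\<^sub>R act (U + t *\<^sub>R V) (F s t - F s 0) + act (e s t) (F s t))) (at t within {0..1})"
      using F
    proof eventually_elim
      case (elim s)
      show ?case
      proof
        fix t :: real assume "t \<in> {0..1}"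
        with elim have "(F s has_vector_derivative act (A s t) (F s t)) (at t within {0..1})" by blast
        moreover have "((\<lambda>t. (s * t) *\<^sub>R act G (F s 0)) has_vector_derivative s *\<^sub>R act G (F s 0)) (at t within {0..1})"
          "((\<lambda>t. (s * s * t) *\<^sub>R act U (F s 0)) has_vector_derivative (s * s) *\<^sub>R act U (F s 0)) (at t within {0..1})"
          "((\<lambda>t. (s * s * t\<^sup>2 / 2) *\<^sub>R (act V (F s 0) + act G (act G (F s 0)))) has_vector_derivative
            (s * s * t) *\<^sub>R (act V (F s 0) + act G (act G (F s 0)))) (at t within {0..1})"
          by (rule has_vector_derivative_scaleR_const; auto intro!: derivative_eq_intros)+
        ultimately have "(H s has_vector_derivative
            (act (A s t) (F s t) - 0 - s *\<^sub>R act G (F s 0) - (s * s) *\<^sub>R act U (F s 0)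
             - (s * s * t) *\<^sub>R (act V (F s 0) + act G (act G (F s 0))))) (at t within {0..1})"
          unfolding H_def by (intro has_vector_derivative_diff has_vector_derivative_const)
        then show "(H s has_vector_derivative
            (s *\<^sub>R act G (F s t - F s 0 - (s * t) *\<^sub>R act G (F s 0))
            + (s * s) *\<^sub>R act (U + t *\<^sub>R V) (F s t - F s 0) + act (e s t) (F s t))) (at t within {0..1})"
          by (simp add: A_eq add_left diff_right add_right scaleR_left scaleR_right algebra_simps)
      qed
    qed
  qed (simp add: H_def)
  have "((\<lambda>s. (1 / s\<^sup>2) *\<^sub>R H s 1) \<longlongrightarrow> 0) (at_right 0)"
  proof (rule tendstoI)
    fix \<epsilon> :: real assume "\<epsilon> > 0"
    then have "\<epsilon> / 2 > 0" by simp
    from uniformly_smallD [OF h2 this] show "\<forall>\<^sub>F s in at_right 0. dist ((1 / s\<^sup>2) *\<^sub>R H s 1) 0 < \<epsilon>"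
      using s1
    proof eventually_elim
      case (elim s)
      then have "norm (H s 1) \<le> \<epsilon> / 2 * s\<^sup>2" by auto
      then have "norm (H s 1) / s\<^sup>2 \<le> \<epsilon> / 2" using elim by (simp add: pos_divide_le_eq)
      then have "norm (H s 1) / s\<^sup>2 < \<epsilon>" using \<open>\<epsilon> > 0\<close> by linarith
      then show ?case by simp
    qed
  qed
  then have "((\<lambda>s. (1 / s\<^sup>2) *\<^sub>R H s 1 + (act U (F s 0) + (1/2) *\<^sub>R (act V (F s 0) + act G (act G (F s 0))))) \<longlongrightarrow>
      0 + (act U x + (1/2) *\<^sub>R (act V x + act G (act G x)))) (at_right 0)"
    by (intro tendsto_intros tendsto F0)
  moreover have "\<forall>\<^sub>F s in at_right 0. (1 / s\<^sup>2) *\<^sub>R H s 1 + (act U (F s 0) + (1/2) *\<^sub>R (act V (F s 0) + act G (act G (F s 0)))) =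
      (1 / s\<^sup>2) *\<^sub>R (F s 1 - F s 0 - s *\<^sub>R act G (F s 0))"
    using s1
  proof eventually_elim
    case (elim s)
    have "H s 1 = (F s 1 - F s 0 - s *\<^sub>R act G (F s 0)) - s\<^sup>2 *\<^sub>R (act U (F s 0) + (1/2) *\<^sub>R (act V (F s 0) + act G (act G (F s 0))))"
      by (simp add: H_def power2_eq_square scaleR_add_right)
    then show ?case using elim by (simp add: scaleR_diff_right)
  qed
  ultimately show ?thesis
    by (simp add: tendsto_cong scaleR_add_right add.assoc)
qed

end

section \<open>The transport equation on the spin group\<close>

lemma bounded_linear_spin_lift: "bounded_linear spin_lift"
  by (rule linear_conv_bounded_linear [THEN iffD1], rule linearI) (simp_all add: spin_lift_linear)

lemma reversal_cvec_basis [simp]: "reversal (cliff_basis {i}) = cliff_basis {i}"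
  by (rule cliff_eqI) (auto simp: rsign_def numeral_2_eq_2)

lemma reversal_spin_lift: "reversal (spin_lift X) = - spin_lift X"
proof -
  have e: "cliff_basis {j} * cliff_basis {i} = - (cliff_basis {i} * cliff_basis {j})" if "i < j" for i j :: 'a
    using clifford_relation [of j i] that by (simp add: eq_neg_iff_add_eq_0)
  interpret r: bounded_linear "reversal :: 'a cliff \<Rightarrow> _" by (rule bounded_linear_reversal)
  have "reversal (spin_lift X) = (\<Sum>i\<in>UNIV. \<Sum>j\<in>{i<..}. X $ j $ i *\<^sub>R ((1/2) *\<^sub>R (cliff_basis {j} * cliff_basis {i})))"
    by (simp add: spin_lift_def r.sum r.scaleR reversal_mult)
  also have "\<dots> = - spin_lift X"
    unfolding spin_lift_def sum_negf [symmetric] by (intro sum.cong refl) (simp add: e)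
  finally show ?thesis .
qed

lemma grade_involution_spin_lift: "grade_involution (spin_lift X) = spin_lift X"
  by (simp add: grade_involution_eq_iff even_spin_lift)

lemma vector_derivative_zero_const:
  fixes f :: "real \<Rightarrow> 'a::real_normed_vector"
  assumes "\<And>t. t \<in> {0..1} \<Longrightarrow> (f has_vector_derivative 0) (at t within {0..1})" "t \<in> {0..1}"
  shows "f t = f 0"
  using norm_le_of_vector_derivative_bound [of f "\<lambda>_. 0" 0 t] assms by simp

lemma has_vector_derivative_reversal:
  "(a has_vector_derivative a') F \<Longrightarrow> ((\<lambda>t. reversal (a t)) has_vector_derivative reversal a') F"
  by (rule bounded_linear.has_vector_derivative [OF bounded_linear_reversal])

lemma idempotent_eq_zero:
  fixes p :: "'a::real_normed_algebra"
  assumes "p * p = p" "norm p < 1"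
  shows "p = 0"
proof (rule ccontr)
  assume "p \<noteq> 0"
  then have "norm p * norm p < 1 * norm p"
    using assms(2) by (intro mult_strict_right_mono) auto
  then show False
    using norm_mult_ineq [of p p] assms(1) by simp
qed

text \<open>From b * a = 1 the element 1 - a * b is idempotent, and an idempotent of norm below 1 is
  zero. Below, the transport equation shows directly that \<open>reversal (b t) * b t\<close> is
  constant, but for the product in the other order it yields only a commutator.\<close>

lemma one_sided_inverse_near_one:
  fixes a b :: "'a::real_normed_algebra_1"
  assumes "b * a = 1" "norm (a - 1) \<le> 1/4" "norm (b - 1) \<le> 1/4"
  shows "a * b = 1"
proof -
  have "(1 - a * b) * (1 - a * b) = 1 - a * b - a * b + a * (b * a) * b"
    by (simp add: algebra_simps)
  then have "(1 - a * b) * (1 - a * b) = 1 - a * b"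
    using assms(1) by simp
  moreover have "norm (1 - a * b) < 1"
  proof -
    have "1 - a * b = - ((a - 1) * (b - 1) + (a - 1) + (b - 1))"
      by (simp add: algebra_simps)
    then have "norm (1 - a * b) = norm ((a - 1) * (b - 1) + (a - 1) + (b - 1))"
      by (metis norm_minus_cancel)
    also have "\<dots> \<le> norm ((a - 1) * (b - 1)) + norm (a - 1) + norm (b - 1)"
      by (intro norm_triangle_le add_mono norm_triangle_ineq order_refl)
    also have "norm ((a - 1) * (b - 1)) \<le> 1/4 * (1/4)"
      using assms by (intro order_trans [OF norm_mult_ineq] mult_mono) auto
    finally show ?thesis using assms by simp
  qed
  ultimately have "1 - a * b = 0" by (rule idempotent_eq_zero)
  then show ?thesis by simp
qed

text \<open>The equation is solved from 1, where the solution b stays close to 1, and the result is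
  multiplied by a0 from the right. Each defining condition of the spin group follows from an
  expression with zero derivative: the product of reversal b with b, with the grade involution of b,
  and with a curve of vectors times b. The constants \<delta> and L serve all X, r and a0.\<close>

lemma spin_cover_transport_exists:
  "\<exists>\<delta>>0. \<exists>L. \<forall>(X :: real \<Rightarrow> 'n::{finite,linorder} rmat) r a0.
    continuous_on {0..1} X \<and> (\<forall>t\<in>{0..1}. transpose (X t) = - X t \<and> norm (X t) \<le> r) \<and> r \<le> \<delta> \<and> a0 \<in> spin_group \<longrightarrow>
    (\<exists>a. a 0 = a0 \<and> (\<forall>t\<in>{0..1}. a t \<in> spin_group \<and> norm (a t - a0) \<le> L * r * norm a0 \<and>
      (a has_vector_derivative spin_lift (X t) * a t) (at t within {0..1})))"
proof -
  interpret mult: bounded_action "(*) :: 'n cliff \<Rightarrow> 'n cliff \<Rightarrow> _"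
    by (simp add: bounded_action_def bounded_bilinear_mult)
  have mv: "bounded_bilinear ((*v) :: 'n rmat \<Rightarrow> 'n rvec \<Rightarrow> _)"
    by (rule bilinear_conv_bounded_bilinear [THEN iffD1])
      (auto simp: bilinear_def intro!: linearI simp: matrix_vector_mult_add_rdistrib scaleR_matrix_vector_assoc)
  then interpret mv: bounded_action "(*v) :: 'n rmat \<Rightarrow> 'n rvec \<Rightarrow> _"
    by (simp add: bounded_action_def)
  obtain K where K: "K > 0" "\<And>X :: 'n rmat. norm (spin_lift X) \<le> norm X * K"
    using bounded_linear.pos_bounded [OF bounded_linear_spin_lift] by metis
  obtain M where M: "M > 0" "\<And>(X :: 'n rmat) v. norm (X *v v) \<le> norm X * norm v * M"
    using mv.pos_bounded by metis
  \<comment> \<open>r * K \<le> 1/8 gives norm (b t - 1) \<le> 1/4, as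
    \<open>one_sided_inverse_near_one\<close> asks; r * M \<le> 1/2 is the existence condition for
    the equation on vectors.\<close>
  define \<delta> where "\<delta> = min (1 / (8 * K)) (1 / (2 * M))"
  have \<delta>: "\<delta> > 0" "\<delta> \<le> 1 / (8 * K)" "\<delta> \<le> 1 / (2 * M)"
    using K(1) M(1) by (auto simp: \<delta>_def)
  have main: "\<exists>a. a 0 = a0 \<and> (\<forall>t\<in>{0..1}. a t \<in> spin_group \<and> norm (a t - a0) \<le> (2 * K) * r * norm a0 \<and>
      (a has_vector_derivative spin_lift (X t) * a t) (at t within {0..1}))"
    if cont: "continuous_on {0..1} X" and X: "\<And>t. t \<in> {0..1} \<Longrightarrow> transpose (X t) = - X t"
      "\<And>t. t \<in> {0..1} \<Longrightarrow> norm (X t) \<le> r" and r: "r \<le> \<delta>" and a0: "a0 \<in> spin_group"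
    for X :: "real \<Rightarrow> 'n rmat" and r a0
  proof -
    define A where "A t = spin_lift (X t)" for t
    have "r * K \<le> 1 / (8 * K) * K" "r * M \<le> 1 / (2 * M) * M"
      using r \<delta>(2,3) K(1) M(1) by (intro mult_right_mono; linarith)+
    then have rK: "r * K \<le> 1/8" and rM: "r * M \<le> 1/2"
      using K(1) M(1) by auto
    have A_le: "norm (A t * x) \<le> r * K * norm x" if "t \<in> {0..1}" for t x
    proof -
      have "norm (A t) \<le> r * K"
        unfolding A_def using X(2) [OF that] K(1)
        by (intro order_trans [OF K(2)] mult_right_mono) auto
      then show ?thesis
        by (meson norm_mult_ineq mult_right_mono norm_ge_zero order_trans)
    qed
    have "continuous_on {0..1} A"
      unfolding A_def by (intro bounded_linear.continuous_on [OF bounded_linear_spin_lift] cont)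
    moreover have "norm (A t * x) \<le> norm x / 2" if "t \<in> {0..1}" for t x
      using A_le [OF that, of x] mult_right_mono [OF rK norm_ge_zero [of x]] norm_ge_zero [of x] by linarith
    ultimately obtain b where b: "b 0 = 1"
      "\<And>t. t \<in> {0..1} \<Longrightarrow> (b has_vector_derivative A t * b t) (at t within {0..1})"
      using mult.linear_ode_exists [of A 1] by blast
    have near: "norm (b t - 1) \<le> 2 * (r * K)" if "t \<in> {0..1}" for t
      using mult.linear_ode_bound(2) [OF b(2) A_le _ that] rK b(1) by simp
    have db: "((\<lambda>t. reversal (b t)) has_vector_derivative - (reversal (b t) * A t)) (at t within {0..1})" if "t \<in> {0..1}" for t
      using has_vector_derivative_reversal [OF b(2) [OF that]] by (simp add: reversal_mult A_def reversal_spin_lift)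
    have left: "reversal (b t) * b t = 1" if t: "t \<in> {0..1}" for t
    proof -
      have "((\<lambda>t. reversal (b t) * b t) has_vector_derivative 0) (at t within {0..1})" if "t \<in> {0..1}" for t
        using has_vector_derivative_mult [OF db [OF that] b(2) [OF that]] by (simp add: mult.assoc)
      from vector_derivative_zero_const [OF this t] show ?thesis by (simp add: b(1))
    qed
    have right: "b t * reversal (b t) = 1" if t: "t \<in> {0..1}" for t
    proof (rule one_sided_inverse_near_one [OF left [OF t]])
      show n: "norm (b t - 1) \<le> 1/4" using near [OF t] rK by simp
      have "reversal (b t) - 1 = reversal (b t - 1)" by (simp add: reversal_linear)
      then show "norm (reversal (b t) - 1) \<le> 1/4" using n by (simp only: norm_reversal)
    qed
    have grade: "grade_involution (b t) = b t" if t: "t \<in> {0..1}" for t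
    proof -
      have dg: "((\<lambda>t. grade_involution (b t)) has_vector_derivative A t * grade_involution (b t)) (at t within {0..1})" if "t \<in> {0..1}" for t
        using bounded_linear.has_vector_derivative [OF bounded_linear_grade_involution b(2) [OF that]]
        by (simp add: grade_involution_mult A_def grade_involution_spin_lift)
      have "((\<lambda>t. reversal (b t) * grade_involution (b t)) has_vector_derivative 0) (at t within {0..1})" if "t \<in> {0..1}" for t
        using has_vector_derivative_mult [OF db [OF that] dg [OF that]] by (simp add: mult.assoc)
      from vector_derivative_zero_const [OF this t] have "reversal (b t) * grade_involution (b t) = grade_involution 1"
        by (simp add: b(1))
      moreover have "grade_involution 1 = (1 :: 'n cliff)" by (rule cliff_eqI) simp
      ultimately have "b t * (reversal (b t) * grade_involution (b t)) = b t" by simp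
      then show ?thesis by (simp add: right [OF t] flip: mult.assoc)
    qed
    have conj: "\<exists>w. b t * cvec v * reversal (b t) = cvec w" if t: "t \<in> {0..1}" for t v
    proof -
      have "norm (X t *v x) \<le> norm x / 2" if "t \<in> {0..1}" for t x
      proof -
        have "norm (X t) * norm x * M \<le> r * norm x * M"
          using X(2) [OF that] M(1) by (intro mult_right_mono) auto
        moreover have "r * norm x * M \<le> norm x / 2"
          using mult_right_mono [OF rM norm_ge_zero [of x]] by (simp add: mult_ac)
        ultimately show ?thesis using M(2) [of "X t" x] by linarith
      qed
      \<comment> \<open>z is the expected image of v under conjugation by b. Conjugating it back
        gives a curve with zero derivative, hence with constant value v.\<close>
      then obtain z where z: "z 0 = v" "\<And>t. t \<in> {0..1} \<Longrightarrow> (z has_vector_derivative X t *v z t) (at t within {0..1})"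
        using mv.linear_ode_exists [OF cont, of v] by blast
      have dz: "((\<lambda>t. cvec (z t)) has_vector_derivative A t * cvec (z t) - cvec (z t) * A t) (at t within {0..1})" if "t \<in> {0..1}" for t
        using bounded_linear.has_vector_derivative [OF bounded_linear_cvec z(2) [OF that]]
        by (simp add: A_def spin_lift_commutator [OF X(1) [OF that]])
      have "((\<lambda>t. reversal (b t) * cvec (z t) * b t) has_vector_derivative 0) (at t within {0..1})" if "t \<in> {0..1}" for t
        using has_vector_derivative_mult [OF has_vector_derivative_mult [OF db [OF that] dz [OF that]] b(2) [OF that]]
        by (simp add: algebra_simps)
      from vector_derivative_zero_const [OF this t] have "reversal (b t) * cvec (z t) * b t = cvec v"
        by (simp add: b(1) z(1))
      then have "b t * cvec v * reversal (b t) = b t * (reversal (b t) * cvec (z t) * b t) * reversal (b t)"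
        by simp
      also have "\<dots> = (b t * reversal (b t)) * cvec (z t) * (b t * reversal (b t))"
        by (simp only: mult.assoc)
      finally have "b t * cvec v * reversal (b t) = cvec (z t)"
        by (simp add: right [OF t])
      then show ?thesis by blast
    qed
    have spin: "b t \<in> spin_group" if "t \<in> {0..1}" for t
      using left right grade conj that by (simp add: spin_group_iff)
    have "norm (b t * a0 - a0) \<le> 2 * K * r * norm a0" if "t \<in> {0..1}" for t
    proof -
      have "b t * a0 - a0 = (b t - 1) * a0" by (simp add: algebra_simps)
      then have "norm (b t * a0 - a0) \<le> norm (b t - 1) * norm a0"
        by (simp only: norm_mult_ineq)
      also have "\<dots> \<le> 2 * (r * K) * norm a0"
        using near [OF that] by (intro mult_right_mono) auto
      finally show ?thesis by (simp add: mult_ac)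
    qed
    moreover have "((\<lambda>t. b t * a0) has_vector_derivative A t * (b t * a0)) (at t within {0..1})" if "t \<in> {0..1}" for t
      using has_vector_derivative_mult [OF b(2) [OF that] has_vector_derivative_const] by (simp add: mult.assoc)
    ultimately show ?thesis
      using spin spin_group_mult [OF _ a0] b(1) by (intro exI [of _ "\<lambda>t. b t * a0"]) (simp add: A_def)
  qed
  show ?thesis
    by (rule exI [of _ \<delta>], rule conjI [OF \<delta>(1)], rule exI [of _ "2 * K"]) (use main in blast)
qed

section \<open>The Levi-Civita connection\<close>

lemma smooth_on_differentiable: "smooth_on S f \<Longrightarrow> f differentiable_on S"
  unfolding smooth_on_def by (metis Ck_on.simps(2))

lemma smooth_on_frechet_derivative: "smooth_on S f \<Longrightarrow> smooth_on S (\<lambda>x. frechet_derivative f (at x) v)"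
  unfolding smooth_on_def by (metis Ck_on.simps(2))

lemma smooth_on_has_derivative:
  assumes "smooth_on S f" "open S" "y \<in> S"
  shows "(f has_derivative frechet_derivative f (at y)) (at y)"
  using smooth_on_differentiable [OF assms(1)] assms(2,3)
  by (metis differentiable_on_def at_within_open frechet_derivative_works)

lemma differentiable_det:
  fixes A :: "'a::real_normed_vector \<Rightarrow> real^'n^'n"
  assumes "\<And>i j. (\<lambda>y. A y $ i $ j) differentiable (at y within S)"
  shows "(\<lambda>y. det (A y)) differentiable (at y within S)"
proof -
  have prod: "(\<lambda>y. \<Prod>i\<in>I. A y $ i $ p i) differentiable (at y within S)" if "finite I" for I p
    using that by (induction I) (simp_all add: assms differentiable_mult)
  have "(\<lambda>y. of_int (sign p) * (\<Prod>i\<in>UNIV. A y $ i $ p i)) differentiable (at y within S)" for p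
    by (rule differentiable_mult [OF differentiable_const prod]) simp
  then show ?thesis
    unfolding det_def by (intro differentiable_sum) (simp_all add: finite_permutations)
qed

lemma
  fixes A :: "real^'n^'n"
  assumes "invertible A"
  shows matrix_inv_right: "A ** matrix_inv A = mat 1" and matrix_inv_left: "matrix_inv A ** A = mat 1"
proof -
  have "\<exists>A'. A ** A' = mat 1 \<and> A' ** A = mat 1"
    using assms by (simp add: invertible_def)
  then have "A ** matrix_inv A = mat 1 \<and> matrix_inv A ** A = mat 1"
    unfolding matrix_inv_def by (rule someI_ex)
  then show "A ** matrix_inv A = mat 1" "matrix_inv A ** A = mat 1" by auto
qed

text \<open>Cramer's rule writes the entries of the inverse as quotients of determinants, from which
  the Christoffel symbols inherit differentiability.\<close>

lemma matrix_inv_component: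
  fixes A :: "real^'n^'n"
  assumes "invertible A"
  shows "matrix_inv A $ k $ l = det (\<chi> i j. if j = k then (if i = l then 1 else 0) else A $ i $ j) / det A"
proof -
  have "A ** matrix_inv A = mat 1"
    using assms by (simp add: matrix_inv_right)
  then have "A *v column l (matrix_inv A) = axis l 1"
    by (metis matrix_vector_mul_assoc matrix_vector_mul_lid matrix_vector_mult_basis)
  then have "column l (matrix_inv A) =
      (\<chi> k. det (\<chi> i j. if j = k then axis l 1 $ i else A $ i $ j) / det A)"
    using cramer [of A] assms by (simp add: invertible_det_nz)
  then have "column l (matrix_inv A) $ k = det (\<chi> i j. if j = k then axis l 1 $ i else A $ i $ j) / det A"
    by simp
  then show ?thesis
    by (simp add: column_def axis_def eq_commute cong: if_cong)
qed

lemma differentiable_matrixI: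
  fixes f :: "'a::real_normed_vector \<Rightarrow> real^'n^'m"
  assumes "\<And>i j. (\<lambda>y. f y $ i $ j) differentiable (at y within S)"
  shows "f differentiable (at y within S)"
proof -
  have "f y \<bullet> axis i (axis j 1) = f y $ i $ j" for y i j
    by (simp add: inner_axis)
  then show ?thesis
    using assms by (subst differentiable_componentwise_within) (auto simp: Basis_vec_def)
qed

lemma differentiable_matrix_component:
  fixes f :: "'a::real_normed_vector \<Rightarrow> real^'n^'m"
  assumes "f differentiable (at y within S)"
  shows "(\<lambda>y. f y $ i $ j) differentiable (at y within S)"
proof -
  obtain f' where "(f has_derivative f') (at y within S)"
    using assms unfolding differentiable_def by blast
  then have "((\<lambda>y. f y $ i $ j) has_derivative (\<lambda>x. f' x $ i $ j)) (at y within S)"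
    by (intro bounded_linear.has_derivative [OF bounded_linear_vec_nth])
  then show ?thesis unfolding differentiable_def by blast
qed

lemma positive_definite_invertible:
  fixes A :: "real^'n^'n"
  assumes "\<And>v. v \<noteq> 0 \<Longrightarrow> v \<bullet> (A *v v) > 0"
  shows "invertible A"
  using assms by (metis inner_zero_right invertible_left_inverse less_irrefl matrix_left_invertible_ker)

section \<open>The metric and its Christoffel symbols\<close>

context closed_spin_manifold
begin

lemma open_chart_image:
  assumes "(D, \<phi>) \<in> charts M" "open U"
  shows "open (\<phi> ` (D \<inter> U))"
proof -
  have h: "open D" "open (\<phi> ` D)" "homeomorphism D (\<phi> ` D) \<phi> (inv_into D \<phi>)"
    using chart_homeo [OF assms(1)] by auto
  have "openin (top_of_set D) (D \<inter> U)"
    using assms(2) by (simp add: openin_open_Int)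
  then have "openin (top_of_set (\<phi> ` D)) (\<phi> ` (D \<inter> U))"
    using homeomorphism_imp_open_map [OF h(3)] by blast
  then show ?thesis
    using h(2) openin_open_trans by blast
qed

lemma gram_invertible:
  assumes "(D, \<phi>) \<in> charts M" "y \<in> \<phi> ` D"
  shows "invertible (gram M (D, \<phi>) y)"
  using gram_pos [OF assms(1)] assms(2) by (intro positive_definite_invertible) auto

lemma gram_symmetric:
  assumes "(D, \<phi>) \<in> charts M" "y \<in> \<phi> ` D"
  shows "gram M (D, \<phi>) y $ i $ j = gram M (D, \<phi>) y $ j $ i"
proof -
  have "transpose (gram M (D, \<phi>) y) = gram M (D, \<phi>) y"
    using gram_sym [OF assms(1)] assms(2) by auto
  from arg_cong [OF this, of "\<lambda>A. A $ i $ j"] show ?thesis by (simp add: transpose_def)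
qed

lemma partial_gram:
  assumes "(D, \<phi>) \<in> charts M" "y \<in> \<phi> ` D"
  shows "partial i (\<lambda>z. gram M (D, \<phi>) z $ j $ l) y = partial i (gram M (D, \<phi>)) y $ j $ l"
proof -
  have "(gram M (D, \<phi>) has_derivative frechet_derivative (gram M (D, \<phi>)) (at y)) (at y)"
    using smooth_on_has_derivative [OF gram_smooth [OF assms(1)]] chart_homeo [OF assms(1)] assms(2) by blast
  then have "((\<lambda>z. gram M (D, \<phi>) z $ j $ l) has_derivative (\<lambda>v. frechet_derivative (gram M (D, \<phi>)) (at y) v $ j $ l)) (at y)"
    by (intro bounded_linear.has_derivative [OF bounded_linear_vec_nth])
  from frechet_derivative_at [OF this] show ?thesis
    unfolding partial_def by metis
qed

lemma partial_gram_symmetric: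
  assumes "(D, \<phi>) \<in> charts M" "y \<in> \<phi> ` D"
  shows "partial i (gram M (D, \<phi>)) y $ j $ l = partial i (gram M (D, \<phi>)) y $ l $ j"
proof -
  have d: "((\<lambda>z. gram M (D, \<phi>) z $ j $ l) has_derivative (\<lambda>v. frechet_derivative (gram M (D, \<phi>)) (at y) v $ j $ l)) (at y)" for j l
    using smooth_on_has_derivative [OF gram_smooth [OF assms(1)]] chart_homeo [OF assms(1)] assms(2)
    by (intro bounded_linear.has_derivative [OF bounded_linear_vec_nth]) blast
  have "((\<lambda>z. gram M (D, \<phi>) z $ l $ j) has_derivative (\<lambda>v. frechet_derivative (gram M (D, \<phi>)) (at y) v $ j $ l)) (at y)"
    using d chart_homeo [OF assms(1)] assms(2) gram_symmetric [OF assms(1)]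
    by (intro has_derivative_transform_within_open [OF d [of j l], where s = "\<phi> ` D"]) blast+
  from has_derivative_unique [OF this d] show ?thesis
    unfolding partial_def by (rule fun_cong)
qed

lemma christoffel_component:
  assumes "(D, \<phi>) \<in> charts M" "y \<in> \<phi> ` D"
  defines "g \<equiv> gram M (D, \<phi>)"
  shows "christoffel M (D, \<phi>) y i $ k $ j = (1/2) * (\<Sum>l\<in>UNIV. matrix_inv (g y) $ k $ l *
     (partial i g y $ j $ l + partial j g y $ i $ l - partial l g y $ i $ j))"
  by (simp add: christoffel_def partial_gram [OF assms(1,2)] g_def)

lemma christoffel_symmetric:
  assumes "(D, \<phi>) \<in> charts M" "y \<in> \<phi> ` D"
  shows "christoffel M (D, \<phi>) y i $ k $ j = christoffel M (D, \<phi>) y j $ k $ i"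
  unfolding christoffel_component [OF assms]
  using partial_gram_symmetric [OF assms, of _ i j] by (simp add: add.commute)

text \<open>Compatibility of the connection with the metric. Multiplication by the Gram matrix
  lowers the upper index and leaves half of three derivatives of the metric; adding the transpose
  cancels all but the derivative in direction i.\<close>

lemma christoffel_metric:
  assumes "(D, \<phi>) \<in> charts M" "y \<in> \<phi> ` D"
  defines "g \<equiv> gram M (D, \<phi>)"
  shows "partial i g y = g y ** christoffel M (D, \<phi>) y i + transpose (g y ** christoffel M (D, \<phi>) y i)"
proof -
  have gg: "g y ** matrix_inv (g y) = mat 1"
    using gram_invertible [OF assms(1,2)] by (simp add: g_def matrix_inv_right)
  have inv: "(\<Sum>k\<in>UNIV. g y $ m $ k * matrix_inv (g y) $ k $ l) = (if m = l then 1 else 0)" for m l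
    using arg_cong [OF gg, of "\<lambda>A. A $ m $ l"] by (simp add: mat_def matrix_matrix_mult_def)
  have low: "(g y ** christoffel M (D, \<phi>) y i) $ m $ j =
      (1/2) * (partial i g y $ j $ m + partial j g y $ i $ m - partial m g y $ i $ j)" for m j
  proof -
    define c where "c l = partial i g y $ j $ l + partial j g y $ i $ l - partial l g y $ i $ j" for l
    have "(g y ** christoffel M (D, \<phi>) y i) $ m $ j =
        (\<Sum>k\<in>UNIV. g y $ m $ k * ((1/2) * (\<Sum>l\<in>UNIV. matrix_inv (g y) $ k $ l * c l)))"
      by (simp add: matrix_matrix_mult_def christoffel_component [OF assms(1,2)] c_def g_def)
    also have "\<dots> = (1/2) * (\<Sum>k\<in>UNIV. \<Sum>l\<in>UNIV. g y $ m $ k * matrix_inv (g y) $ k $ l * c l)"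
      by (simp add: sum_distrib_left mult_ac)
    also have "(\<Sum>k\<in>UNIV. \<Sum>l\<in>UNIV. g y $ m $ k * matrix_inv (g y) $ k $ l * c l) =
        (\<Sum>l\<in>UNIV. (\<Sum>k\<in>UNIV. g y $ m $ k * matrix_inv (g y) $ k $ l) * c l)"
      by (subst sum.swap) (simp add: sum_distrib_right)
    also have "\<dots> = c m"
      by (simp add: inv if_distrib [of "\<lambda>x. x * _"] cong: if_cong)
    finally show ?thesis by (simp add: c_def)
  qed
  have sym: "partial k g y $ a $ b = partial k g y $ b $ a" for k a b
    unfolding g_def by (rule partial_gram_symmetric [OF assms(1,2)])
  show ?thesis
  proof (simp only: vec_eq_iff, intro allI)
    fix m j
    show "partial i g y $ m $ j = (g y ** christoffel M (D, \<phi>) y i + transpose (g y ** christoffel M (D, \<phi>) y i)) $ m $ j"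
      unfolding plus_vec_def transpose_def using sym [of i j m] sym [of j i m] sym [of m i j]
      by (simp add: low add_divide_distrib diff_divide_distrib)
  qed
qed

lemma christoffel_differentiable:
  assumes "(D, \<phi>) \<in> charts M" "y \<in> \<phi> ` D"
  shows "(\<lambda>z. christoffel M (D, \<phi>) z i) differentiable (at y)"
proof (rule differentiable_matrixI)
  fix k j
  define g where "g = gram M (D, \<phi>)"
  have op: "open (\<phi> ` D)" using chart_homeo [OF assms(1)] by blast
  have smooth: "smooth_on (\<phi> ` D) g" "smooth_on (\<phi> ` D) (\<lambda>z. partial i g z)" for i
    unfolding g_def partial_def using gram_smooth [OF assms(1)] by (simp_all add: smooth_on_frechet_derivative)
  have diff: "f differentiable (at y)" if "smooth_on (\<phi> ` D) f" for f :: "_ \<Rightarrow> 'n rmat"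
    using smooth_on_has_derivative [OF that op assms(2)] unfolding differentiable_def by blast
  have d: "(\<lambda>z. g z $ a $ b) differentiable (at y)" "(\<lambda>z. partial l g z $ a $ b) differentiable (at y)" for a b l
    by (intro differentiable_matrix_component diff smooth)+
  have dinv: "(\<lambda>z. det (\<chi> i j. if j = a then (if i = b then 1 else 0) else g z $ i $ j) / det (g z)) differentiable (at y)" for a b
  proof (rule differentiable_divide)
    show "(\<lambda>z. det (\<chi> i j. if j = a then (if i = b then 1 else 0) else g z $ i $ j)) differentiable (at y)"
    proof (rule differentiable_det)
      show "(\<lambda>z. (\<chi> i j. if j = a then (if i = b then 1 else 0) else g z $ i $ j) $ i' $ j') differentiable (at y)" for i' j'
        using d by (cases "j' = a") auto
    qed
    show "(\<lambda>z. det (g z)) differentiable (at y)" by (rule differentiable_det [OF d(1)])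
    show "det (g y) \<noteq> 0" using gram_invertible [OF assms] by (simp add: g_def invertible_det_nz)
  qed
  have "(\<lambda>z. (1/2) * (\<Sum>l\<in>UNIV. det (\<chi> i j. if j = k then (if i = l then 1 else 0) else g z $ i $ j) / det (g z) *
     (partial i g z $ j $ l + partial j g z $ i $ l - partial l g z $ i $ j))) differentiable (at y)"
    by (intro differentiable_mult differentiable_const differentiable_sum ballI differentiable_diff
        differentiable_add d dinv) simp
  then obtain L where "((\<lambda>z. (1/2) * (\<Sum>l\<in>UNIV. det (\<chi> i j. if j = k then (if i = l then 1 else 0) else g z $ i $ j) / det (g z) *
     (partial i g z $ j $ l + partial j g z $ i $ l - partial l g z $ i $ j))) has_derivative L) (at y)"
    unfolding differentiable_def by blast
  then have "((\<lambda>z. christoffel M (D, \<phi>) z i $ k $ j) has_derivative L) (at y)"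
  proof (rule has_derivative_transform_within_open [OF _ op assms(2)])
    fix z assume z: "z \<in> \<phi> ` D"
    show "(1/2) * (\<Sum>l\<in>UNIV. det (\<chi> i j. if j = k then (if i = l then 1 else 0) else g z $ i $ j) / det (g z) *
     (partial i g z $ j $ l + partial j g z $ i $ l - partial l g z $ i $ j)) = christoffel M (D, \<phi>) z i $ k $ j"
      unfolding christoffel_component [OF assms(1) z] g_def matrix_inv_component [OF gram_invertible [OF assms(1) z]] ..
  qed
  then show "(\<lambda>z. christoffel M (D, \<phi>) z i $ k $ j) differentiable (at y)"
    unfolding differentiable_def by blast
qed

end

section \<open>Parallel transport and holonomy\<close>

lemma has_vector_derivative_reflect:
  fixes f :: "real \<Rightarrow> 'a::real_normed_vector"
  assumes "(f has_vector_derivative f') (at (1 - t) within {0..1})"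
  shows "((\<lambda>s. f (1 - s)) has_vector_derivative - f') (at t within {0..1})"
proof -
  have "((\<lambda>s::real. 1 - s) has_vector_derivative 0 - 1) (at t within {0..1})"
    by (intro has_vector_derivative_diff has_vector_derivative_const has_vector_derivative_id)
  moreover have "(\<lambda>s::real. 1 - s) ` {0..1} = {0..1}"
    by (auto simp: image_iff intro!: bexI [of _ "1 - _"])
  ultimately show ?thesis
    using vector_diff_chain_within [of "\<lambda>s::real. 1 - s" "0 - 1" t "{0..1}" f f'] assms
    by (simp add: o_def)
qed

lemma parallel_curveE:
  assumes "parallel_curve M \<gamma>"
  obtains D \<phi> x' where "continuous_on {0..1} \<gamma>" "(D, \<phi>) \<in> charts M" "\<And>t. t \<in> {0..1} \<Longrightarrow> base M (\<gamma> t) \<in> D"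
    "continuous_on {0..1} x'"
    "\<And>t. t \<in> {0..1} \<Longrightarrow> ((\<lambda>s. \<phi> (base M (\<gamma> s))) has_vector_derivative x' t) (at t within {0..1})"
    "\<And>t. t \<in> {0..1} \<Longrightarrow> ((\<lambda>s. frame M (D, \<phi>) (\<gamma> s)) has_vector_derivative
           - ((\<Sum>i\<in>UNIV. x' t $ i *\<^sub>R christoffel M (D, \<phi>) (\<phi> (base M (\<gamma> t))) i) **
              frame M (D, \<phi>) (\<gamma> t))) (at t within {0..1})"
  using assms unfolding parallel_curve_def by (auto simp: image_subset_iff)

lemma parallel_curveI:
  assumes "continuous_on {0..1} \<gamma>" "(D, \<phi>) \<in> charts M" "\<And>t. t \<in> {0..1} \<Longrightarrow> base M (\<gamma> t) \<in> D"
    "continuous_on {0..1} x'"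
    "\<And>t. t \<in> {0..1} \<Longrightarrow> ((\<lambda>s. \<phi> (base M (\<gamma> s))) has_vector_derivative x' t) (at t within {0..1})"
    "\<And>t. t \<in> {0..1} \<Longrightarrow> ((\<lambda>s. frame M (D, \<phi>) (\<gamma> s)) has_vector_derivative
           - ((\<Sum>i\<in>UNIV. x' t $ i *\<^sub>R christoffel M (D, \<phi>) (\<phi> (base M (\<gamma> t))) i) **
              frame M (D, \<phi>) (\<gamma> t))) (at t within {0..1})"
  shows "parallel_curve M \<gamma>"
proof -
  have "\<exists>x'. continuous_on {0..1} x' \<and> (\<forall>t\<in>{0..1}.
        ((\<lambda>s. \<phi> (base M (\<gamma> s))) has_vector_derivative x' t) (at t within {0..1}) \<and>
        ((\<lambda>s. frame M (D, \<phi>) (\<gamma> s)) has_vector_derivative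
           - ((\<Sum>i\<in>UNIV. x' t $ i *\<^sub>R christoffel M (D, \<phi>) (\<phi> (base M (\<gamma> t))) i) **
              frame M (D, \<phi>) (\<gamma> t))) (at t within {0..1}))"
    by (intro exI [of _ x'] conjI ballI assms(4-6))
  moreover have "\<gamma> ` {0..1} \<subseteq> base M -` D"
    using assms(3) by blast
  ultimately show ?thesis
    unfolding parallel_curve_def using assms(1,2) by blast
qed

context closed_spin_manifold
begin

text \<open>In a local trivialisation the action of a is right multiplication on the group
  coordinate, which is continuous.\<close>

lemma continuous_on_act:
  assumes "a \<in> spin_group"
  shows "continuous_on UNIV (\<lambda>p. act M p a)"
proof -
  have "\<exists>N. open N \<and> p \<in> N \<and> continuous_on N (\<lambda>p. act M p a)" for p
  proof -
    obtain U \<sigma> h where U: "base M p \<in> U"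
      and h: "homeomorphism (U \<times> spin_group) (base M -` U) (\<lambda>(y, a). act M (\<sigma> y) a) h" "open (base M -` U)"
      using locally_trivial [of "base M p"] by blast
    define \<Psi> where "\<Psi> = (\<lambda>(y, a). act M (\<sigma> y) a)"
    have \<Psi>: "continuous_on (U \<times> spin_group) \<Psi>" and ch: "continuous_on (base M -` U) h"
      and h_in: "h q \<in> U \<times> spin_group" and \<Psi>h: "\<Psi> (h q) = q" if "q \<in> base M -` U" for q
      using h(1) that unfolding homeomorphism_def \<Psi>_def [symmetric] by blast+
    have p: "p \<in> base M -` U" using U by simp
    have "continuous_on (base M -` U) (\<lambda>q. \<Psi> (fst (h q), snd (h q) * a))"
    proof (rule continuous_on_compose2 [OF \<Psi> [OF p]])
      show "continuous_on (base M -` U) (\<lambda>q. (fst (h q), snd (h q) * a))"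
        by (intro continuous_intros ch [OF p])
      show "(\<lambda>q. (fst (h q), snd (h q) * a)) ` (base M -` U) \<subseteq> U \<times> spin_group"
        using h_in assms by (fastforce intro: spin_group_mult)
    qed
    moreover have "\<Psi> (fst (h q), snd (h q) * a) = act M q a" if "q \<in> base M -` U" for q
      using h_in [OF that] \<Psi>h [OF that] assms by (auto simp: \<Psi>_def act_mult)
    ultimately have "continuous_on (base M -` U) (\<lambda>q. act M q a)"
      by (rule continuous_on_eq)
    then show ?thesis
      using p h(2) by blast
  qed
  then have "continuous_on (\<Union>{N. open N \<and> continuous_on N (\<lambda>p. act M p a)}) (\<lambda>p. act M p a)"
    "\<Union>{N. open N \<and> continuous_on N (\<lambda>p. act M p a)} = UNIV"
    by (auto intro!: continuous_on_open_Union)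
  then show ?thesis by simp
qed

text \<open>The Christoffel matrices multiply frames from the left and the structure group acts from
  the right, so the transport equation is preserved.\<close>

lemma parallel_curve_act:
  assumes a: "a \<in> spin_group" and "parallel_curve M \<gamma>"
  shows "parallel_curve M (\<lambda>t. act M (\<gamma> t) a)"
  using assms(2)
proof (rule parallel_curveE)
  fix D \<phi> x'
  assume \<gamma>: "continuous_on {0..1} \<gamma>" "(D, \<phi>) \<in> charts M" "\<And>t. t \<in> {0..1} \<Longrightarrow> base M (\<gamma> t) \<in> D"
    "continuous_on {0..1} x'"
    "\<And>t. t \<in> {0..1} \<Longrightarrow> ((\<lambda>s. \<phi> (base M (\<gamma> s))) has_vector_derivative x' t) (at t within {0..1})"
    "\<And>t. t \<in> {0..1} \<Longrightarrow> ((\<lambda>s. frame M (D, \<phi>) (\<gamma> s)) has_vector_derivative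
           - ((\<Sum>i\<in>UNIV. x' t $ i *\<^sub>R christoffel M (D, \<phi>) (\<phi> (base M (\<gamma> t))) i) **
              frame M (D, \<phi>) (\<gamma> t))) (at t within {0..1})"
  interpret mm: bounded_bilinear "(**) :: 'n rmat \<Rightarrow> 'n rmat \<Rightarrow> 'n rmat"
    by (rule bounded_bilinear_matrix_mult)
  show "parallel_curve M (\<lambda>t. act M (\<gamma> t) a)"
  proof (rule parallel_curveI [OF _ \<gamma>(2) _ \<gamma>(4)])
    show "continuous_on {0..1} (\<lambda>t. act M (\<gamma> t) a)"
      by (rule continuous_on_compose2 [OF continuous_on_act [OF a] \<gamma>(1)]) simp
    fix t :: real assume t: "t \<in> {0..1}"
    show "base M (act M (\<gamma> t) a) \<in> D"
      using \<gamma>(3) [OF t] by (simp add: act_base a)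
    show "((\<lambda>s. \<phi> (base M (act M (\<gamma> s) a))) has_vector_derivative x' t) (at t within {0..1})"
      using \<gamma>(5) [OF t] by (simp add: act_base a)
    let ?\<Gamma> = "\<Sum>i\<in>UNIV. x' t $ i *\<^sub>R christoffel M (D, \<phi>) (\<phi> (base M (\<gamma> t))) i"
    have eq: "frame M (D, \<phi>) (act M (\<gamma> s) a) = frame M (D, \<phi>) (\<gamma> s) ** spin_cover a" if "s \<in> {0..1}" for s
      using frame_equivariant [OF \<gamma>(2) \<gamma>(3) [OF that] a] .
    have "((\<lambda>s. frame M (D, \<phi>) (\<gamma> s) ** spin_cover a) has_vector_derivative
        (- (?\<Gamma> ** frame M (D, \<phi>) (\<gamma> t))) ** spin_cover a) (at t within {0..1})"
      by (rule bounded_linear.has_vector_derivative [OF mm.bounded_linear_left \<gamma>(6) [OF t]])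
    then have d: "((\<lambda>s. frame M (D, \<phi>) (\<gamma> s) ** spin_cover a) has_vector_derivative
        - (?\<Gamma> ** frame M (D, \<phi>) (act M (\<gamma> t) a))) (at t within {0..1})"
      by (simp add: eq [OF t] mm.minus_left matrix_mul_assoc)
    show "((\<lambda>s. frame M (D, \<phi>) (act M (\<gamma> s) a)) has_vector_derivative
      - ((\<Sum>i\<in>UNIV. x' t $ i *\<^sub>R christoffel M (D, \<phi>) (\<phi> (base M (act M (\<gamma> t) a))) i) **
              frame M (D, \<phi>) (act M (\<gamma> t) a))) (at t within {0..1})"
      using has_vector_derivative_transform [OF t eq d] by (simp only: act_base [OF a])
  qed
qed

lemma parallel_curve_reverse:
  assumes "parallel_curve M \<gamma>"
  shows "parallel_curve M (\<lambda>t. \<gamma> (1 - t))"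
  using assms
proof (rule parallel_curveE)
  fix D \<phi> x'
  assume \<gamma>: "continuous_on {0..1} \<gamma>" "(D, \<phi>) \<in> charts M" "\<And>t. t \<in> {0..1} \<Longrightarrow> base M (\<gamma> t) \<in> D"
    "continuous_on {0..1} x'"
    "\<And>t. t \<in> {0..1} \<Longrightarrow> ((\<lambda>s. \<phi> (base M (\<gamma> s))) has_vector_derivative x' t) (at t within {0..1})"
    "\<And>t. t \<in> {0..1} \<Longrightarrow> ((\<lambda>s. frame M (D, \<phi>) (\<gamma> s)) has_vector_derivative
           - ((\<Sum>i\<in>UNIV. x' t $ i *\<^sub>R christoffel M (D, \<phi>) (\<phi> (base M (\<gamma> t))) i) **
              frame M (D, \<phi>) (\<gamma> t))) (at t within {0..1})"
  interpret mm: bounded_bilinear "(**) :: 'n rmat \<Rightarrow> 'n rmat \<Rightarrow> 'n rmat"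
    by (rule bounded_bilinear_matrix_mult)
  have cont: "continuous_on {0..1} (\<lambda>t. f (1 - t))" if "continuous_on {0..1} f" for f :: "real \<Rightarrow> 'z::topological_space"
    by (rule continuous_on_compose2 [OF that]) (auto intro!: continuous_intros)
  show "parallel_curve M (\<lambda>t. \<gamma> (1 - t))"
  proof (rule parallel_curveI [OF cont [OF \<gamma>(1)] \<gamma>(2), where x' = "\<lambda>t. - x' (1 - t)"])
    show "continuous_on {0..1} (\<lambda>t. - x' (1 - t))"
      by (intro continuous_on_minus cont \<gamma>(4))
    fix t :: real assume "t \<in> {0..1}"
    then have t: "1 - t \<in> {0..1}" by simp
    show "base M (\<gamma> (1 - t)) \<in> D" by (rule \<gamma>(3) [OF t])
    show "((\<lambda>s. \<phi> (base M (\<gamma> (1 - s)))) has_vector_derivative - x' (1 - t)) (at t within {0..1})"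
      by (rule has_vector_derivative_reflect [OF \<gamma>(5) [OF t]])
    have "(\<Sum>i\<in>UNIV. (- x' (1 - t)) $ i *\<^sub>R christoffel M (D, \<phi>) (\<phi> (base M (\<gamma> (1 - t)))) i) =
        - (\<Sum>i\<in>UNIV. x' (1 - t) $ i *\<^sub>R christoffel M (D, \<phi>) (\<phi> (base M (\<gamma> (1 - t)))) i)"
      by (simp add: sum_negf)
    then show "((\<lambda>s. frame M (D, \<phi>) (\<gamma> (1 - s))) has_vector_derivative
      - ((\<Sum>i\<in>UNIV. (- x' (1 - t)) $ i *\<^sub>R christoffel M (D, \<phi>) (\<phi> (base M (\<gamma> (1 - t)))) i) **
              frame M (D, \<phi>) (\<gamma> (1 - t)))) (at t within {0..1})"
      using has_vector_derivative_reflect [OF \<gamma>(6) [OF t]] by (simp only: mm.minus_left)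
  qed
qed

lemma parallel_related_refl: "parallel_related M p p"
  by (simp add: parallel_related_def)

lemma parallel_related_trans: "parallel_related M p q \<Longrightarrow> parallel_related M q r \<Longrightarrow> parallel_related M p r"
  unfolding parallel_related_def by (rule rtranclp_trans)

lemma parallel_curve_related:
  "parallel_curve M \<gamma> \<Longrightarrow> parallel_related M (\<gamma> 0) (\<gamma> 1)"
  unfolding parallel_related_def by (rule r_into_rtranclp) blast

lemma parallel_related_sym:
  assumes "parallel_related M p q"
  shows "parallel_related M q p"
  using assms unfolding parallel_related_def
proof (induction rule: rtranclp_induct)
  case (step q r)
  then obtain \<gamma> where "parallel_curve M \<gamma>" "\<gamma> 0 = q" "\<gamma> 1 = r" by blast
  then have "\<exists>\<gamma>. parallel_curve M \<gamma> \<and> \<gamma> 0 = r \<and> \<gamma> 1 = q"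
    using parallel_curve_reverse by (intro exI [of _ "\<lambda>t. \<gamma> (1 - t)"]) auto
  then show ?case
    using step.IH by (rule converse_rtranclp_into_rtranclp)
qed simp

lemma parallel_related_act:
  assumes "parallel_related M p q" "a \<in> spin_group"
  shows "parallel_related M (act M p a) (act M q a)"
  using assms(1) unfolding parallel_related_def
proof (induction rule: rtranclp_induct)
  case (step q r)
  then obtain \<gamma> where "parallel_curve M \<gamma>" "\<gamma> 0 = q" "\<gamma> 1 = r" by blast
  then have "\<exists>\<gamma>. parallel_curve M \<gamma> \<and> \<gamma> 0 = act M q a \<and> \<gamma> 1 = act M r a"
    using parallel_curve_act [OF assms(2)] by (intro exI [of _ "\<lambda>t. act M (\<gamma> t) a"]) auto
  with step.IH show ?case
    by (rule rtranclp.rtrancl_into_rtrancl)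
qed simp

lemma reduction_act:
  assumes G: "compact_connected_subgroup G" and q: "q \<in> reduction M G u" and a: "a \<in> G"
  shows "act M q a \<in> reduction M G u"
proof -
  obtain b where b: "b \<in> G" "parallel_related M (act M u b) q"
    using q by (auto simp: reduction_def)
  have spin: "a \<in> spin_group" "b \<in> spin_group" and ba: "b * a \<in> G"
    using G a b(1) by (auto simp: compact_connected_subgroup_def)
  have "parallel_related M (act M u (b * a)) (act M q a)"
    using parallel_related_act [OF b(2) spin(1)] spin by (simp add: act_mult)
  then show ?thesis using ba by (auto simp: reduction_def)
qed

text \<open>\<open>h\<close> is the holonomy of the loop at \<open>q\<close>; conjugating it back to \<open>u\<close> makes it an element of
  the holonomy group at \<open>u\<close>.\<close>

lemma parallel_loop_in_group:
  assumes G: "compact_connected_subgroup G" and hol: "holonomy_group M u \<subseteq> G"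
    and q: "q \<in> reduction M G u" and h: "h \<in> spin_group"
    and p: "parallel_related M q p" and ph: "parallel_related M q (act M p h)"
  shows "h \<in> G"
proof -
  obtain a where a: "a \<in> G" "parallel_related M (act M u a) q"
    using q by (auto simp: reduction_def)
  have aG: "reversal a \<in> G" and spin: "a \<in> spin_group" "reversal a \<in> spin_group"
    using G a(1) by (auto simp: compact_connected_subgroup_def spin_group_reversal)
  have inv: "a * reversal a = 1" "reversal a * a = 1" using spin by (auto simp: spin_group_iff)
  have "parallel_related M (act M (act M u a) h) (act M p h)"
    by (intro parallel_related_act [OF _ h] parallel_related_trans [OF a(2) p])
  then have "parallel_related M (act M (act M u a) h) (act M u a)"
    using ph a(2) parallel_related_sym parallel_related_trans by blast
  then have "parallel_related M (act M (act M (act M u a) h) (reversal a)) (act M (act M u a) (reversal a))"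
    by (rule parallel_related_act [OF _ spin(2)])
  then have "parallel_related M (act M u (a * h * reversal a)) u"
    using spin h by (simp add: act_mult [symmetric] spin_group_mult inv act_one)
  then have "a * h * reversal a \<in> G"
    using hol spin h unfolding holonomy_group_def by (blast intro: parallel_related_sym spin_group_mult)
  then have "reversal a * (a * h * reversal a) * a \<in> G"
    using G aG a(1) by (simp add: compact_connected_subgroup_def)
  also have "reversal a * (a * h * reversal a) * a = (reversal a * a) * h * (reversal a * a)"
    by (simp only: mult.assoc)
  finally show ?thesis by (simp add: inv)
qed

end

text \<open>Differentiating a * e_j * reversal a gives the commutator of the lift of X with that
  vector, and by \<open>spin_lift_commutator\<close> this is X applied to it.\<close>

lemma spin_cover_has_vector_derivative:
  fixes a :: "real \<Rightarrow> 'n::{finite,linorder} cliff"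
  assumes d: "(a has_vector_derivative spin_lift X * a t) (at t within S)"
    and X: "transpose X = - X" and at: "a t \<in> spin_group"
  shows "((\<lambda>t. spin_cover (a t)) has_vector_derivative X ** spin_cover (a t)) (at t within S)"
proof -
  \<comment> \<open>P j places the singleton coefficients in column j, so \<open>spin_cover\<close>
    is a finite sum of bounded linear images of curves in the Clifford algebra.\<close>
  define P :: "'n \<Rightarrow> 'n cliff \<Rightarrow> 'n rmat" where "P j b = (\<chi> i k. if k = j then coeff b {i} else 0)" for j b
  have P: "bounded_linear (P j)" for j
    by (intro bounded_linear_from_cliff linearI) (auto simp: P_def vec_eq_iff)
  have cover: "spin_cover b = (\<Sum>j\<in>UNIV. P j (b * cliff_basis {j} * reversal b))" for b
    by (simp add: vec_eq_iff spin_cover_def P_def)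
  have "((\<lambda>t. a t * cliff_basis {j} * reversal (a t)) has_vector_derivative
      cvec (X *v (spin_cover (a t) *v axis j 1))) (at t within S)" for j
  proof -
    define w where "w = spin_cover (a t) *v axis j 1"
    have w: "a t * cliff_basis {j} * reversal (a t) = cvec w"
      using spin_group_conj_cvec [OF at, of "axis j 1"] by (simp add: w_def)
    have "((\<lambda>t. a t * cliff_basis {j} * reversal (a t)) has_vector_derivative
        a t * cliff_basis {j} * reversal (spin_lift X * a t) + (a t * 0 + spin_lift X * a t * cliff_basis {j}) * reversal (a t)) (at t within S)"
      by (intro has_vector_derivative_mult has_vector_derivative_reversal d has_vector_derivative_const)
    also have "a t * cliff_basis {j} * reversal (spin_lift X * a t) + (a t * 0 + spin_lift X * a t * cliff_basis {j}) * reversal (a t) =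
        spin_lift X * (a t * cliff_basis {j} * reversal (a t)) - (a t * cliff_basis {j} * reversal (a t)) * spin_lift X"
      by (simp add: reversal_mult reversal_spin_lift mult.assoc)
    also have "\<dots> = cvec (X *v w)"
      unfolding w by (rule spin_lift_commutator [OF X])
    finally show ?thesis by (simp add: w_def)
  qed
  then have "((\<lambda>t. \<Sum>j\<in>UNIV. P j (a t * cliff_basis {j} * reversal (a t))) has_vector_derivative
      (\<Sum>j\<in>UNIV. P j (cvec (X *v (spin_cover (a t) *v axis j 1))))) (at t within S)"
    by (intro has_vector_derivative_sum bounded_linear.has_vector_derivative [OF P])
  also have "(\<Sum>j\<in>UNIV. P j (cvec (X *v (spin_cover (a t) *v axis j 1)))) = X ** spin_cover (a t)"
    unfolding matrix_vector_mult_basis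
    by (simp add: vec_eq_iff P_def column_def matrix_vector_mult_def matrix_matrix_mult_def)
  finally show ?thesis
    by (simp add: cover)
qed

section \<open>The connection in a local frame and parallel lifts of segments\<close>

lemma bounded_linear_transpose: "bounded_linear (transpose :: real^'n^'m \<Rightarrow> real^'m^'n)"
  by (rule linear_conv_bounded_linear [THEN iffD1], rule linearI) (simp_all add: transpose_def vec_eq_iff)

lemma smooth_on_continuous: "smooth_on S f \<Longrightarrow> continuous_on S f"
  unfolding smooth_on_def by (metis Ck_on.simps(1))

context closed_spin_manifold
begin

lemma christoffel_continuous:
  assumes "(D, \<phi>) \<in> charts M"
  shows "continuous_on (\<phi> ` D) (\<lambda>y. christoffel M (D, \<phi>) y i)"
proof (rule continuous_at_imp_continuous_on, rule ballI)
  fix y assume "y \<in> \<phi> ` D"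
  from christoffel_differentiable [OF assms this] show "isCont (\<lambda>y. christoffel M (D, \<phi>) y i) y"
    by (rule differentiable_imp_continuous_within)
qed

text \<open>\<omega> k is the connection matrix in the orthonormal frame E, whose inverse is
  transpose E times the Gram matrix. Skewness comes from differentiating the orthonormality relation
  and inserting \<open>christoffel_metric\<close>; it is what allows \<open>spin_lift\<close> to
  represent \<omega> in the Clifford algebra.\<close>

lemma smooth_frame_connection:
  fixes E :: "'n rvec \<Rightarrow> 'n rmat"
  assumes c: "(D, \<phi>) \<in> charts M" and V: "open V" "V \<subseteq> \<phi> ` D"
    and E: "smooth_on V E" and orth: "\<And>y. y \<in> V \<Longrightarrow> transpose (E y) ** gram M (D, \<phi>) y ** E y = mat 1"
  defines "\<omega> k y \<equiv> transpose (E y) ** gram M (D, \<phi>) y ** (partial k E y + christoffel M (D, \<phi>) y k ** E y)"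
  shows "continuous_on V (\<omega> k)"
    and "y \<in> V \<Longrightarrow> transpose (\<omega> k y) = - \<omega> k y"
    and "y \<in> V \<Longrightarrow> E y ** \<omega> k y = partial k E y + christoffel M (D, \<phi>) y k ** E y"
proof -
  interpret mm: bounded_bilinear "(**) :: 'n rmat \<Rightarrow> 'n rmat \<Rightarrow> 'n rmat"
    by (rule bounded_bilinear_matrix_mult)
  define g where "g = gram M (D, \<phi>)"
  define \<Gamma> where "\<Gamma> y = christoffel M (D, \<phi>) y k" for y
  have g: "smooth_on (\<phi> ` D) g" using gram_smooth [OF c] by (simp add: g_def)
  have op: "open (\<phi> ` D)" using chart_homeo [OF c] by blast
  have cP: "continuous_on V (\<lambda>y. partial k E y)"
    unfolding partial_def by (rule smooth_on_continuous [OF smooth_on_frechet_derivative [OF E]])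
  have cT: "continuous_on V (\<lambda>y. transpose (E y))"
    by (rule bounded_linear.continuous_on [OF bounded_linear_transpose smooth_on_continuous [OF E]])
  have cG: "continuous_on V \<Gamma>" and cg: "continuous_on V g"
    unfolding \<Gamma>_def using christoffel_continuous [OF c] smooth_on_continuous [OF g] V(2) continuous_on_subset by blast+
  show "continuous_on V (\<omega> k)"
    unfolding \<omega>_def g_def [symmetric] \<Gamma>_def [symmetric]
    by (rule mm.continuous_on [OF mm.continuous_on [OF cT cg]
          continuous_on_add [OF cP mm.continuous_on [OF cG smooth_on_continuous [OF E]]]])
  fix y assume y: "y \<in> V"
  have "E y ** (transpose (E y) ** g y) = mat 1"
    using orth [OF y] matrix_left_right_inverse by (metis g_def)
  then have "E y ** (transpose (E y) ** g y) ** (partial k E y + \<Gamma> y ** E y) = partial k E y + \<Gamma> y ** E y"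
    by simp
  then show "E y ** \<omega> k y = partial k E y + christoffel M (D, \<phi>) y k ** E y"
    by (simp add: \<omega>_def g_def \<Gamma>_def matrix_mul_assoc)
  have yD: "y \<in> \<phi> ` D" using y V(2) by blast
  have dE: "(E has_derivative frechet_derivative E (at y)) (at y)"
    by (rule smooth_on_has_derivative [OF E V(1) y])
  have dET: "((\<lambda>y. transpose (E y)) has_derivative (\<lambda>h. transpose (frechet_derivative E (at y) h))) (at y)"
    by (rule bounded_linear.has_derivative [OF bounded_linear_transpose dE])
  have dg: "(g has_derivative frechet_derivative g (at y)) (at y)"
    by (rule smooth_on_has_derivative [OF g op yD])
  have "((\<lambda>y. transpose (E y) ** g y ** E y) has_derivative
      (\<lambda>h. (transpose (E y) ** g y) ** frechet_derivative E (at y) h +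
        (transpose (E y) ** frechet_derivative g (at y) h + transpose (frechet_derivative E (at y) h) ** g y) ** E y)) (at y)"
    by (rule mm.FDERIV [OF mm.FDERIV [OF dET dg] dE])
  moreover have "((\<lambda>y. transpose (E y) ** g y ** E y) has_derivative (\<lambda>h. 0)) (at y)"
    by (rule has_derivative_transform_within_open [OF has_derivative_const V(1) y]) (simp add: orth g_def)
  ultimately have "(\<lambda>h. (transpose (E y) ** g y) ** frechet_derivative E (at y) h +
        (transpose (E y) ** frechet_derivative g (at y) h + transpose (frechet_derivative E (at y) h) ** g y) ** E y) = (\<lambda>h. 0)"
    by (rule has_derivative_unique)
  from fun_cong [OF this, of "axis k 1"]
  have "(transpose (E y) ** g y) ** partial k E y +
        (transpose (E y) ** partial k g y + transpose (partial k E y) ** g y) ** E y = 0"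
    by (simp add: partial_def)
  moreover have "partial k g y = g y ** \<Gamma> y + transpose (\<Gamma> y) ** g y"
    using christoffel_metric [OF c yD, of k] gram_sym [OF c] yD by (auto simp: g_def \<Gamma>_def matrix_transpose_mul)
  moreover have "transpose (g y) = g y"
    using gram_sym [OF c] yD by (auto simp: g_def)
  moreover have "transpose (A + B) = transpose A + transpose B" for A B :: "'n rmat"
    by (simp add: transpose_def vec_eq_iff)
  ultimately have "\<omega> k y + transpose (\<omega> k y) = 0"
    unfolding \<omega>_def g_def [symmetric] \<Gamma>_def [symmetric]
    by (simp add: matrix_transpose_mul mm.add_left mm.add_right matrix_mul_assoc algebra_simps)
  then show "transpose (\<omega> k y) = - \<omega> k y"
    by (simp add: eq_neg_iff_add_eq_0 add.commute)
qed

text \<open>Relative to the section \<sigma>, parallel transport becomes an equation for the group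
  coordinate, a' = - s * lift(\<omega>) * a. The constants s0 and L are uniform in the direction,
  the segment and the initial value, because the second leg of the square starts at a point and a
  group element that depend on s.\<close>

lemma parallel_lift:
  assumes c: "(D, \<phi>) \<in> charts M" and U: "open U" "\<And>y. y \<in> U \<Longrightarrow> base M (\<sigma> y) = y"
    and cont: "continuous_on (U \<times> spin_group) (\<lambda>(y, a). act M (\<sigma> y) a)"
    and smooth: "smooth_on (\<phi> ` (D \<inter> U)) (\<lambda>y. frame M (D, \<phi>) (\<sigma> (inv_into D \<phi> y)))"
    and y0: "y0 \<in> \<phi> ` (D \<inter> U)"
  defines "P y a \<equiv> act M (\<sigma> (inv_into D \<phi> y)) a"
  shows "\<exists>s0>0. \<exists>L. ball y0 s0 \<subseteq> \<phi> ` (D \<inter> U) \<and> (\<forall>k y1 s a0.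
    (\<forall>t\<in>{0..1}. y1 + (s * t) *\<^sub>R axis k 1 \<in> ball y0 s0) \<and> 0 < s \<and> s < s0 \<and> a0 \<in> spin_group \<longrightarrow>
    (\<exists>a. a 0 = a0 \<and> a 1 \<in> spin_group \<and> norm (a 1 - a0) \<le> L * s * norm a0 \<and>
      parallel_curve M (\<lambda>t. P (y1 + (s * t) *\<^sub>R axis k 1) (a t)) \<and>
      (\<forall>t\<in>{0..1}. ((\<lambda>t. frame M (D, \<phi>) (P (y1 + (s * t) *\<^sub>R axis k 1) (a t))) has_vector_derivative
        - (s *\<^sub>R (christoffel M (D, \<phi>) (y1 + (s * t) *\<^sub>R axis k 1) k ** frame M (D, \<phi>) (P (y1 + (s * t) *\<^sub>R axis k 1) (a t)))))
        (at t within {0..1}))))"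
proof -
  interpret mm: bounded_bilinear "(**) :: 'n rmat \<Rightarrow> 'n rmat \<Rightarrow> 'n rmat"
    by (rule bounded_bilinear_matrix_mult)
  define V where "V = \<phi> ` (D \<inter> U)"
  define E where "E y = frame M (D, \<phi>) (\<sigma> (inv_into D \<phi> y))" for y
  define \<Gamma> where "\<Gamma> k y = christoffel M (D, \<phi>) y k" for k y
  define \<omega> where "\<omega> k y = transpose (E y) ** gram M (D, \<phi>) y ** (partial k E y + christoffel M (D, \<phi>) y k ** E y)" for k y
  have homeo: "homeomorphism D (\<phi> ` D) \<phi> (inv_into D \<phi>)" using chart_homeo [OF c] by blast
  have V: "open V" "V \<subseteq> \<phi> ` D" unfolding V_def using open_chart_image [OF c U(1)] by auto
  have inv: "inv_into D \<phi> y \<in> D" "inv_into D \<phi> y \<in> U" "\<phi> (inv_into D \<phi> y) = y" if "y \<in> V" for y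
  proof -
    have "inj_on \<phi> D"
      using homeo unfolding homeomorphism_def by (metis inj_on_inverseI)
    then show "inv_into D \<phi> y \<in> D" "inv_into D \<phi> y \<in> U" "\<phi> (inv_into D \<phi> y) = y"
      using that by (auto simp: V_def)
  qed
  have orth: "transpose (E y) ** gram M (D, \<phi>) y ** E y = mat 1" if "y \<in> V" for y
    using frame_orthonormal [OF c, of "\<sigma> (inv_into D \<phi> y)"] inv [OF that] by (simp add: E_def U(2))
  have smE: "smooth_on V E" using smooth by (simp add: V_def E_def [abs_def])
  note conn = smooth_frame_connection [OF c V smE]
  have co: "continuous_on V (\<omega> k)" for k
    unfolding \<omega>_def by (rule conn(1)) (rule orth)
  have skew: "transpose (\<omega> k y) = - \<omega> k y" if "y \<in> V" for k y
    unfolding \<omega>_def by (rule conn(2) [OF _ that]) (rule orth)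
  have E\<omega>: "E y ** \<omega> k y = partial k E y + christoffel M (D, \<phi>) y k ** E y" if "y \<in> V" for k y
    unfolding \<omega>_def by (rule conn(3) [OF _ that]) (rule orth)
  obtain r0 where r0: "r0 > 0" "cball y0 r0 \<subseteq> V"
    using V(1) y0 open_contains_cball unfolding V_def by blast
  have "\<exists>B. \<forall>y\<in>cball y0 r0. norm (\<omega> k y) \<le> B" for k
  proof -
    have "compact (\<omega> k ` cball y0 r0)"
      using continuous_on_subset [OF co r0(2)] by (intro compact_continuous_image) auto
    then show ?thesis using compact_imp_bounded by (force simp: bounded_iff)
  qed
  then obtain B where B: "\<And>k y. y \<in> cball y0 r0 \<Longrightarrow> norm (\<omega> k y) \<le> B k" by metis
  \<comment> \<open>One bound for the finitely many \<omega> k on the closed ball; the summand 1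
    keeps it positive, since \<delta> is divided by it.\<close>
  define C where "C = (\<Sum>k\<in>UNIV. \<bar>B k\<bar>) + 1"
  have C: "C > 0" unfolding C_def by (intro add_nonneg_pos sum_nonneg) auto
  have BC: "norm (\<omega> k y) \<le> C" if "y \<in> cball y0 r0" for k y
  proof -
    have "\<bar>B k\<bar> \<le> (\<Sum>k\<in>UNIV. \<bar>B k\<bar>)" by (rule member_le_sum) auto
    then show ?thesis using B [OF that, of k] by (simp add: C_def)
  qed
  obtain \<delta> L where \<delta>: "\<delta> > 0" and L: "\<And>(X :: real \<Rightarrow> 'n rmat) r a0.
    continuous_on {0..1} X \<and> (\<forall>t\<in>{0..1}. transpose (X t) = - X t \<and> norm (X t) \<le> r) \<and> r \<le> \<delta> \<and> a0 \<in> spin_group \<Longrightarrow>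
    (\<exists>a. a 0 = a0 \<and> (\<forall>t\<in>{0..1}. a t \<in> spin_group \<and> norm (a t - a0) \<le> L * r * norm a0 \<and>
      (a has_vector_derivative spin_lift (X t) * a t) (at t within {0..1})))"
    using spin_cover_transport_exists by metis
  define s0 where "s0 = min r0 (\<delta> / C)"
  have s0: "s0 > 0" using r0 \<delta> C by (simp add: s0_def)
  have ballV: "ball y0 s0 \<subseteq> cball y0 r0" by (auto simp: s0_def)
  have "\<exists>a. a 0 = a0 \<and> a 1 \<in> spin_group \<and> norm (a 1 - a0) \<le> (L * C) * s * norm a0 \<and>
      parallel_curve M (\<lambda>t. P (y1 + (s * t) *\<^sub>R axis k 1) (a t)) \<and>
      (\<forall>t\<in>{0..1}. ((\<lambda>t. frame M (D, \<phi>) (P (y1 + (s * t) *\<^sub>R axis k 1) (a t))) has_vector_derivative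
        - (s *\<^sub>R (christoffel M (D, \<phi>) (y1 + (s * t) *\<^sub>R axis k 1) k ** frame M (D, \<phi>) (P (y1 + (s * t) *\<^sub>R axis k 1) (a t)))))
        (at t within {0..1}))"
    if seg: "\<And>t. t \<in> {0..1} \<Longrightarrow> y1 + (s * t) *\<^sub>R axis k 1 \<in> ball y0 s0" and s: "0 < s" "s < s0" and a0: "a0 \<in> spin_group"
    for k y1 s a0
  proof -
    define y where "y t = y1 + (s * t) *\<^sub>R axis k 1" for t :: real
    have yV: "y t \<in> V" "y t \<in> cball y0 r0" if "t \<in> {0..1}" for t
      using seg [OF that] ballV r0(2) by (auto simp: y_def)
    have dy: "(y has_vector_derivative s *\<^sub>R axis k 1) (at t within S)" for t S
    proof -
      have "((\<lambda>t. y1 + (s * t) *\<^sub>R axis k 1) has_vector_derivative 0 + s *\<^sub>R axis k 1) (at t within S)"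
        by (intro has_vector_derivative_add has_vector_derivative_const has_vector_derivative_scaleR_const)
          (auto intro!: derivative_eq_intros)
      then show ?thesis by (simp add: y_def [abs_def])
    qed
    have cy: "continuous_on {0..1} y"
      by (rule continuous_on_vector_derivative [OF dy])
    \<comment> \<open>With this sign, the derivative of E minus E \<omega> equals - \<Gamma> E, so E
      times the covering matrix of a solves the transport equation.\<close>
    define X where "X t = (- s) *\<^sub>R \<omega> k (y t)" for t
    have "s * C \<le> \<delta>" using s C by (simp add: s0_def field_simps)
    moreover have "continuous_on {0..1} X"
      unfolding X_def using yV(1) by (intro continuous_on_scaleR continuous_on_const continuous_on_compose2 [OF co cy]) auto
    moreover have Xs: "transpose (X t) = - X t" if "t \<in> {0..1}" for t
    proof -
      have "transpose (X t) = (- s) *\<^sub>R transpose (\<omega> k (y t))"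
        unfolding X_def by (rule linear_scale [OF bounded_linear.linear [OF bounded_linear_transpose]])
      then show ?thesis using skew [OF yV(1) [OF that]] by (simp add: X_def)
    qed
    moreover have "norm (X t) \<le> s * C" if "t \<in> {0..1}" for t
      using BC [OF yV(2) [OF that], of k] s by (simp add: X_def)
    ultimately obtain a where a: "a 0 = a0" "\<And>t. t \<in> {0..1} \<Longrightarrow> a t \<in> spin_group"
      "\<And>t. t \<in> {0..1} \<Longrightarrow> norm (a t - a0) \<le> L * (s * C) * norm a0"
      "\<And>t. t \<in> {0..1} \<Longrightarrow> (a has_vector_derivative spin_lift (X t) * a t) (at t within {0..1})"
      using L [of X "s * C" a0] a0 by blast
    have baseP: "base M (P (y t) (a t)) = inv_into D \<phi> (y t)" if "t \<in> {0..1}" for t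
      using inv(2) [OF yV(1) [OF that]] a(2) [OF that] by (simp add: P_def act_base U(2))
    have frameP: "frame M (D, \<phi>) (P (y t) (a t)) = E (y t) ** spin_cover (a t)" if "t \<in> {0..1}" for t
      unfolding P_def E_def using inv [OF yV(1) [OF that]] a(2) [OF that]
      by (intro frame_equivariant [OF c]) (simp_all add: U(2))
    have dframe: "((\<lambda>t. frame M (D, \<phi>) (P (y t) (a t))) has_vector_derivative
        - (s *\<^sub>R (\<Gamma> k (y t) ** frame M (D, \<phi>) (P (y t) (a t))))) (at t within {0..1})" if t: "t \<in> {0..1}" for t
    proof -
      have dE: "(E has_derivative frechet_derivative E (at (y t))) (at (y t))"
        by (rule smooth_on_has_derivative [OF smE V(1) yV(1) [OF t]])
      have "((E \<circ> y) has_vector_derivative frechet_derivative E (at (y t)) (s *\<^sub>R axis k 1)) (at t within {0..1})"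
        by (rule vector_derivative_diff_chain_within [OF dy has_derivative_at_withinI [OF dE]])
      moreover have "frechet_derivative E (at (y t)) (s *\<^sub>R axis k 1) = s *\<^sub>R partial k E (y t)"
        unfolding partial_def by (rule linear_scale [OF has_derivative_linear [OF dE]])
      ultimately have "((\<lambda>t. E (y t)) has_vector_derivative s *\<^sub>R partial k E (y t)) (at t within {0..1})"
        by (simp add: o_def)
      from mm.has_vector_derivative [OF this spin_cover_has_vector_derivative [OF a(4) [OF t] Xs [OF t] a(2) [OF t]]]
      have "((\<lambda>t. E (y t) ** spin_cover (a t)) has_vector_derivative
          E (y t) ** (X t ** spin_cover (a t)) + (s *\<^sub>R partial k E (y t)) ** spin_cover (a t)) (at t within {0..1})" .
      also have "E (y t) ** (X t ** spin_cover (a t)) + (s *\<^sub>R partial k E (y t)) ** spin_cover (a t) =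
          (s *\<^sub>R partial k E (y t) - s *\<^sub>R (E (y t) ** \<omega> k (y t))) ** spin_cover (a t)"
        by (simp add: X_def mm.scaleR_left mm.scaleR_right mm.minus_left mm.minus_right mm.diff_left matrix_mul_assoc)
      also have "\<dots> = - (s *\<^sub>R (\<Gamma> k (y t) ** (E (y t) ** spin_cover (a t))))"
        unfolding E\<omega> [OF yV(1) [OF t]]
        by (simp add: \<Gamma>_def mm.scaleR_left mm.add_left mm.minus_left scaleR_add_right matrix_mul_assoc)
      also have "\<dots> = - (s *\<^sub>R (\<Gamma> k (y t) ** frame M (D, \<phi>) (P (y t) (a t))))"
        by (simp only: frameP [OF t])
      finally show ?thesis
        by (rule has_vector_derivative_transform [OF t frameP, rotated])
    qed
    have "parallel_curve M (\<lambda>t. P (y t) (a t))"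
    proof (rule parallel_curveI [OF _ c, where x' = "\<lambda>_. s *\<^sub>R axis k 1"])
      have ca: "continuous_on {0..1} a"
        by (rule continuous_on_vector_derivative [OF a(4)])
      have "continuous_on {0..1} (\<lambda>t. inv_into D \<phi> (y t))"
        using homeo V(2) yV(1) unfolding homeomorphism_def
        by (intro continuous_on_compose2 [OF _ cy, of "\<phi> ` D" "inv_into D \<phi>"]) auto
      then have "continuous_on {0..1} (\<lambda>t. (inv_into D \<phi> (y t), a t))"
        using ca by (rule continuous_on_Pair)
      then have "continuous_on {0..1} (\<lambda>t. (\<lambda>(y, a). act M (\<sigma> y) a) (inv_into D \<phi> (y t), a t))"
        by (rule continuous_on_compose2 [OF cont]) (use inv(2) [OF yV(1)] a(2) in auto)
      then show "continuous_on {0..1} (\<lambda>t. P (y t) (a t))" by (simp add: P_def)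
      fix t :: real assume t: "t \<in> {0..1}"
      show "base M (P (y t) (a t)) \<in> D" using inv(1) [OF yV(1) [OF t]] by (simp add: baseP [OF t])
      have \<phi>b: "\<phi> (base M (P (y t) (a t))) = y t" if "t \<in> {0..1}" for t
        using inv(3) [OF yV(1) [OF that]] by (simp add: baseP [OF that])
      show "((\<lambda>s. \<phi> (base M (P (y s) (a s)))) has_vector_derivative s *\<^sub>R axis k 1) (at t within {0..1})"
        by (rule has_vector_derivative_transform [OF t \<phi>b dy])
      have "(\<Sum>i\<in>UNIV. (s *\<^sub>R axis k (1::real)) $ i *\<^sub>R christoffel M (D, \<phi>) (\<phi> (base M (P (y t) (a t)))) i) = s *\<^sub>R \<Gamma> k (y t)"
        by (simp add: \<phi>b [OF t] axis_def \<Gamma>_def if_distrib [of "\<lambda>r. (s * r) *\<^sub>R _"] cong: if_cong)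
      then show "((\<lambda>s. frame M (D, \<phi>) (P (y s) (a s))) has_vector_derivative
        - ((\<Sum>i\<in>UNIV. (s *\<^sub>R axis k 1) $ i *\<^sub>R christoffel M (D, \<phi>) (\<phi> (base M (P (y t) (a t)))) i) **
          frame M (D, \<phi>) (P (y t) (a t)))) (at t within {0..1})"
        using dframe [OF t] by (simp only: mm.scaleR_left)
    qed simp
    then show ?thesis
      using a dframe by (intro exI [of _ a]) (auto simp: y_def \<Gamma>_def mult_ac)
  qed
  note main = this
  have "ball y0 s0 \<subseteq> \<phi> ` (D \<inter> U)"
    using ballV r0(2) by (auto simp: V_def)
  note ball = this
  show ?thesis
    by (rule exI [of _ s0], intro conjI s0 ball exI [of _ "L * C"] allI impI)
      (elim conjE, rule main, blast, assumption+)
qed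

end

text \<open>Supplies the hypothesis on the coefficient in \<open>segment_expansion\<close> from
  differentiability at y alone: the argument stays within s * N of y, and the prefactor s raises an
  o(s) remainder to o(s^2).\<close>

lemma uniformly_small_differentiable:
  fixes f :: "'a::real_normed_vector \<Rightarrow> 'b::real_normed_vector"
  assumes f: "(f has_derivative f') (at y)"
  shows "uniformly_small 2 (\<lambda>s t. s *\<^sub>R f (y + s *\<^sub>R w + (s * t) *\<^sub>R v) - s *\<^sub>R (f y + s *\<^sub>R f' w + (s * t) *\<^sub>R f' v))"
  unfolding uniformly_small_def
proof (intro allI impI)
  fix \<epsilon> :: real assume "\<epsilon> > 0"
  define N where "N = norm w + norm v + 1"
  have N: "N > 0" by (simp add: N_def add_nonneg_pos)
  then have "\<epsilon> / N > 0" using \<open>\<epsilon> > 0\<close> by simp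
  then obtain d where d: "d > 0" "\<And>z. norm (z - y) < d \<Longrightarrow> norm (f z - f y - f' (z - y)) \<le> \<epsilon> / N * norm (z - y)"
    using f unfolding has_derivative_at_alt by blast
  interpret f': bounded_linear f' using f by (rule has_derivative_bounded_linear)
  have "\<forall>\<^sub>F s in at_right 0. s < d / N"
    using d(1) N by (intro order_tendstoD(2) [of "\<lambda>s. s" 0] tendsto_ident_at) simp
  then show "\<forall>\<^sub>F s in at_right 0. \<forall>t\<in>{0..1}.
    norm (s *\<^sub>R f (y + s *\<^sub>R w + (s * t) *\<^sub>R v) - s *\<^sub>R (f y + s *\<^sub>R f' w + (s * t) *\<^sub>R f' v)) \<le> \<epsilon> * s\<^sup>2"
    using eventually_at_right_less
  proof eventually_elim
    case (elim s)
    show ?case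
    proof
      fix t :: real assume t: "t \<in> {0..1}"
      define z where "z = y + s *\<^sub>R w + (s * t) *\<^sub>R v"
      have "norm ((s * t) *\<^sub>R v) \<le> s * norm v"
        using t elim by (simp add: abs_mult mult_left_le_one_le mult_right_mono mult_left_mono mult.assoc)
      moreover have "norm (s *\<^sub>R w) = s * norm w" using elim by simp
      moreover have "norm (z - y) \<le> norm (s *\<^sub>R w) + norm ((s * t) *\<^sub>R v)"
        using norm_triangle_ineq [of "s *\<^sub>R w" "(s * t) *\<^sub>R v"] by (simp add: z_def)
      ultimately have zN: "norm (z - y) \<le> s * N" using elim by (simp add: N_def algebra_simps)
      also have "s * N < d" using elim N by (simp add: field_simps)
      finally have "norm (f z - f y - f' (z - y)) \<le> \<epsilon> / N * norm (z - y)" by (rule d(2))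
      also have "\<dots> \<le> \<epsilon> / N * (s * N)"
        using zN \<open>\<epsilon> / N > 0\<close> by (intro mult_left_mono) auto
      also have "\<dots> = \<epsilon> * s" using N by simp
      finally have le: "norm (f z - f y - f' (z - y)) \<le> \<epsilon> * s" .
      have "f' (z - y) = s *\<^sub>R f' w + (s * t) *\<^sub>R f' v"
        by (simp add: z_def f'.add f'.scaleR)
      then have "s *\<^sub>R f z - s *\<^sub>R (f y + s *\<^sub>R f' w + (s * t) *\<^sub>R f' v) = s *\<^sub>R (f z - f y - f' (z - y))"
        by (simp add: algebra_simps)
      then have "norm (s *\<^sub>R f z - s *\<^sub>R (f y + s *\<^sub>R f' w + (s * t) *\<^sub>R f' v)) = s * norm (f z - f y - f' (z - y))"
        using elim by simp
      also have "\<dots> \<le> s * (\<epsilon> * s)"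
        using le elim by (intro mult_left_mono) auto
      finally show "norm (s *\<^sub>R f (y + s *\<^sub>R w + (s * t) *\<^sub>R v) - s *\<^sub>R (f y + s *\<^sub>R f' w + (s * t) *\<^sub>R f' v)) \<le> \<epsilon> * s\<^sup>2"
        by (simp add: z_def power2_eq_square mult_ac)
    qed
  qed
qed

lemma matrix_inv_eqI:
  fixes A :: "real^'n^'n"
  assumes "B ** A = mat 1"
  shows "matrix_inv A = B"
proof -
  have "invertible A"
    using assms matrix_left_right_inverse unfolding invertible_def by blast
  have "matrix_inv A = (B ** A) ** matrix_inv A" by (simp add: assms)
  also have "\<dots> = B ** (A ** matrix_inv A)" by (simp only: matrix_mul_assoc)
  also have "\<dots> = B" by (simp add: matrix_inv_right [OF \<open>invertible A\<close>])
  finally show ?thesis .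
qed

lemma eventually_at_right_interval: "r > 0 \<Longrightarrow> \<forall>\<^sub>F s::real in at_right 0. 0 < s \<and> s < r"
  by (auto simp: eventually_at_right_field)

text \<open>Second-order expansion of the parallel transport along \<open>e\<^sub>k\<close> and then \<open>e\<^sub>l\<close>.\<close>

lemma corner_expansion:
  fixes F1 F2 :: "real \<Rightarrow> real \<Rightarrow> real^'n^'n" and \<Gamma> :: "'n::finite \<Rightarrow> 'n rvec \<Rightarrow> 'n rmat"
  assumes d\<Gamma>: "\<And>k. (\<Gamma> k has_derivative \<Gamma>' k) (at y)"
    and F1: "\<forall>\<^sub>F s in at_right 0. \<forall>t\<in>{0..1}. (F1 s has_vector_derivative
       - (s *\<^sub>R (\<Gamma> k (y + (s * t) *\<^sub>R axis k 1) ** F1 s t))) (at t within {0..1})"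
    and F2: "\<forall>\<^sub>F s in at_right 0. \<forall>t\<in>{0..1}. (F2 s has_vector_derivative
       - (s *\<^sub>R (\<Gamma> l (y + s *\<^sub>R axis k 1 + (s * t) *\<^sub>R axis l 1) ** F2 s t))) (at t within {0..1})"
    and F10: "\<And>s. F1 s 0 = F0" and F20: "\<And>s. F2 s 0 = F1 s 1"
  shows "((\<lambda>s. (1 / s\<^sup>2) *\<^sub>R (F2 s 1 - F0 + s *\<^sub>R ((\<Gamma> k y + \<Gamma> l y) ** F0))) \<longlongrightarrow>
    ((1/2) *\<^sub>R (\<Gamma> k y ** \<Gamma> k y - \<Gamma>' k (axis k 1)) + (1/2) *\<^sub>R (\<Gamma> l y ** \<Gamma> l y - \<Gamma>' l (axis l 1))
      + \<Gamma> l y ** \<Gamma> k y - \<Gamma>' l (axis k 1)) ** F0) (at_right 0)"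
proof -
  interpret mm: bounded_action "(**) :: 'n rmat \<Rightarrow> 'n rmat \<Rightarrow> 'n rmat"
    by (simp add: bounded_action_def bounded_bilinear_matrix_mult)
  have d: "((\<lambda>y. - \<Gamma> k y) has_derivative (\<lambda>h. - \<Gamma>' k h)) (at y)" for k
    by (intro derivative_intros d\<Gamma>)
  have small: "uniformly_small 2 (\<lambda>s t. s *\<^sub>R (- \<Gamma> k (y + s *\<^sub>R w + (s * t) *\<^sub>R axis k 1))
      - s *\<^sub>R (- \<Gamma> k y + s *\<^sub>R (- \<Gamma>' k w) + (s * t) *\<^sub>R (- \<Gamma>' k (axis k 1))))" for k w
    by (rule uniformly_small_differentiable [OF d])
  have zero: "\<Gamma>' k 0 = 0" for k
    using d\<Gamma> by (meson has_derivative_bounded_linear linear_simps(3))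
  define T1 where "T1 s = (1 / s\<^sup>2) *\<^sub>R (F1 s 1 - F0 - s *\<^sub>R ((- \<Gamma> k y) ** F0))" for s
  define q1 where "q1 = (1/2) *\<^sub>R ((- \<Gamma>' k (axis k 1)) ** F0) + (1/2) *\<^sub>R ((- \<Gamma> k y) ** ((- \<Gamma> k y) ** F0))"
  have T1: "(T1 \<longlongrightarrow> q1) (at_right 0)"
  proof -
    \<comment> \<open>The first leg starts at y itself, so its displacement is 0 and the term U of
      \<open>segment_expansion\<close> vanishes.\<close>
    have F1': "\<forall>\<^sub>F s in at_right 0. \<forall>t\<in>{0..1}. (F1 s has_vector_derivative
       (s *\<^sub>R (- \<Gamma> k (y + s *\<^sub>R 0 + (s * t) *\<^sub>R axis k 1))) ** F1 s t) (at t within {0..1})"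
      using F1 by (simp add: mm.scaleR_left mm.minus_left)
    have "((\<lambda>s. F1 s 0) \<longlongrightarrow> F0) (at_right 0)" by (simp add: F10)
    from mm.segment_expansion [OF F1' small this] show ?thesis
      by (simp add: T1_def [abs_def] q1_def F10 zero mm.zero_left)
  qed
  have s1: "\<forall>\<^sub>F s::real in at_right 0. 0 < s \<and> s < 1" by (rule eventually_at_right_interval) simp
  have x1: "((\<lambda>s. F1 s 1) \<longlongrightarrow> F0) (at_right 0)"
  proof -
    have "((\<lambda>s. F0 + s *\<^sub>R ((- \<Gamma> k y) ** F0) + s\<^sup>2 *\<^sub>R T1 s) \<longlongrightarrow> F0 + 0 *\<^sub>R ((- \<Gamma> k y) ** F0) + 0\<^sup>2 *\<^sub>R q1) (at_right 0)"
      by (intro tendsto_intros T1)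
    then have "((\<lambda>s. F0 + s *\<^sub>R ((- \<Gamma> k y) ** F0) + s\<^sup>2 *\<^sub>R T1 s) \<longlongrightarrow> F0) (at_right 0)" by simp
    moreover have "\<forall>\<^sub>F s in at_right 0. F0 + s *\<^sub>R ((- \<Gamma> k y) ** F0) + s\<^sup>2 *\<^sub>R T1 s = F1 s 1"
      using s1 by eventually_elim (simp add: T1_def)
    ultimately show ?thesis by (rule Lim_transform_eventually)
  qed
  have x1': "((\<lambda>s. (1 / s) *\<^sub>R (F1 s 1 - F0)) \<longlongrightarrow> (- \<Gamma> k y) ** F0) (at_right 0)"
  proof -
    have "((\<lambda>s. (- \<Gamma> k y) ** F0 + s *\<^sub>R T1 s) \<longlongrightarrow> (- \<Gamma> k y) ** F0 + 0 *\<^sub>R q1) (at_right 0)"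
      by (intro tendsto_intros T1)
    then have "((\<lambda>s. (- \<Gamma> k y) ** F0 + s *\<^sub>R T1 s) \<longlongrightarrow> (- \<Gamma> k y) ** F0) (at_right 0)" by simp
    moreover have "\<forall>\<^sub>F s in at_right 0. (- \<Gamma> k y) ** F0 + s *\<^sub>R T1 s = (1 / s) *\<^sub>R (F1 s 1 - F0)"
      using s1 by eventually_elim (simp add: T1_def power2_eq_square scaleR_diff_right)
    ultimately show ?thesis by (rule Lim_transform_eventually)
  qed
  define T2 where "T2 s = (1 / s\<^sup>2) *\<^sub>R (F2 s 1 - F1 s 1 - s *\<^sub>R ((- \<Gamma> l y) ** F1 s 1))" for s
  define q2 where "q2 = (- \<Gamma>' l (axis k 1)) ** F0 + (1/2) *\<^sub>R ((- \<Gamma>' l (axis l 1)) ** F0) + (1/2) *\<^sub>R ((- \<Gamma> l y) ** ((- \<Gamma> l y) ** F0))"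
  have T2: "(T2 \<longlongrightarrow> q2) (at_right 0)"
  proof -
    have F2': "\<forall>\<^sub>F s in at_right 0. \<forall>t\<in>{0..1}. (F2 s has_vector_derivative
       (s *\<^sub>R (- \<Gamma> l (y + s *\<^sub>R axis k 1 + (s * t) *\<^sub>R axis l 1))) ** F2 s t) (at t within {0..1})"
      using F2 by (simp add: mm.scaleR_left mm.minus_left)
    have "((\<lambda>s. F2 s 0) \<longlongrightarrow> F0) (at_right 0)" by (simp add: F20 x1)
    from mm.segment_expansion [OF F2' small this] show ?thesis
      by (simp add: T2_def [abs_def] q2_def F20)
  qed
  \<comment> \<open>The first-order term of the second leg is taken at F1 s 1. Replacing this by F0
    costs the last summand, whose limit supplies the mixed product of \<open>\<Gamma> l\<close> and
    \<open>\<Gamma> k\<close>.\<close>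
  have lim: "((\<lambda>s. T2 s + T1 s - \<Gamma> l y ** ((1 / s) *\<^sub>R (F1 s 1 - F0))) \<longlongrightarrow> q2 + q1 - \<Gamma> l y ** ((- \<Gamma> k y) ** F0)) (at_right 0)"
    by (intro tendsto_intros T1 T2 mm.tendsto x1')
  have eq: "q2 + q1 - \<Gamma> l y ** ((- \<Gamma> k y) ** F0) =
     ((1/2) *\<^sub>R (\<Gamma> k y ** \<Gamma> k y - \<Gamma>' k (axis k 1)) + (1/2) *\<^sub>R (\<Gamma> l y ** \<Gamma> l y - \<Gamma>' l (axis l 1))
      + \<Gamma> l y ** \<Gamma> k y - \<Gamma>' l (axis k 1)) ** F0"
    by (simp add: q1_def q2_def mm.add_left mm.diff_left mm.minus_left mm.minus_right mm.scaleR_left matrix_mul_assoc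
        scaleR_diff_right algebra_simps)
  have "\<forall>\<^sub>F s in at_right 0. T2 s + T1 s - \<Gamma> l y ** ((1 / s) *\<^sub>R (F1 s 1 - F0)) =
      (1 / s\<^sup>2) *\<^sub>R (F2 s 1 - F0 + s *\<^sub>R ((\<Gamma> k y + \<Gamma> l y) ** F0))"
    using s1
  proof eventually_elim
    case (elim s)
    have "\<Gamma> l y ** ((1 / s) *\<^sub>R (F1 s 1 - F0)) = (1 / s\<^sup>2) *\<^sub>R (s *\<^sub>R (\<Gamma> l y ** (F1 s 1 - F0)))"
      using elim by (simp add: mm.scaleR_right power2_eq_square)
    then have "T2 s + T1 s - \<Gamma> l y ** ((1 / s) *\<^sub>R (F1 s 1 - F0)) = (1 / s\<^sup>2) *\<^sub>R
       ((F2 s 1 - F1 s 1 - s *\<^sub>R ((- \<Gamma> l y) ** F1 s 1)) + (F1 s 1 - F0 - s *\<^sub>R ((- \<Gamma> k y) ** F0)) - s *\<^sub>R (\<Gamma> l y ** (F1 s 1 - F0)))"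
      by (simp only: T1_def T2_def scaleR_diff_right scaleR_add_right)
    also have "(F2 s 1 - F1 s 1 - s *\<^sub>R ((- \<Gamma> l y) ** F1 s 1)) + (F1 s 1 - F0 - s *\<^sub>R ((- \<Gamma> k y) ** F0)) - s *\<^sub>R (\<Gamma> l y ** (F1 s 1 - F0)) =
       F2 s 1 - F0 + s *\<^sub>R ((\<Gamma> k y + \<Gamma> l y) ** F0)"
      by (simp add: mm.minus_left mm.add_left mm.diff_right scaleR_diff_right scaleR_add_right)
    finally show ?case .
  qed
  from Lim_transform_eventually [OF lim this] show ?thesis unfolding eq .
qed

section \<open>Infinitesimal holonomy: curvature values lie in the Lie algebra\<close>

context closed_spin_manifold
begin

text \<open>Both corner paths end over the same point, so their end frames differ by an element H s.
  In the difference of the two expansions the first-order terms and the pure second-order terms,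
  symmetric in i and j, cancel; the mixed ones leave exactly \<open>riemann_coord\<close>.\<close>

theorem curvature_in_lie_algebra:
  assumes G: "compact_connected_subgroup G" and hol: "holonomy_group M u \<subseteq> G"
    and q: "q \<in> reduction M G u" and c: "(D, \<phi>) \<in> charts M" and qD: "base M q \<in> D"
  shows "matrix_inv (frame M (D, \<phi>) q) ** riemann_coord M (D, \<phi>) (\<phi> (base M q)) i j ** frame M (D, \<phi>) q
    \<in> lie_algebra G"
proof -
  interpret mm: bounded_action "(**) :: 'n rmat \<Rightarrow> 'n rmat \<Rightarrow> 'n rmat"
    by (simp add: bounded_action_def bounded_bilinear_matrix_mult)
  define y0 where "y0 = \<phi> (base M q)"
  define F0 where "F0 = frame M (D, \<phi>) q"
  define g where "g = gram M (D, \<phi>)"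
  define \<Gamma> where "\<Gamma> k y = christoffel M (D, \<phi>) y k" for k y
  obtain U \<sigma> h where U: "open U" "base M q \<in> U" "\<And>y. y \<in> U \<Longrightarrow> base M (\<sigma> y) = y"
    and homeo: "homeomorphism (U \<times> spin_group) (base M -` U) (\<lambda>(y, a). act M (\<sigma> y) a) h"
    and smooth: "\<forall>(D, \<phi>)\<in>charts M. smooth_on (\<phi> ` (D \<inter> U)) (\<lambda>y. frame M (D, \<phi>) (\<sigma> (inv_into D \<phi> y)))"
    using locally_trivial [of "base M q"] by blast
  have smooth_c: "smooth_on (\<phi> ` (D \<inter> U)) (\<lambda>y. frame M (D, \<phi>) (\<sigma> (inv_into D \<phi> y)))"
    using bspec [OF smooth c] by simp
  have cont: "continuous_on (U \<times> spin_group) (\<lambda>(y, a). act M (\<sigma> y) a)"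
    using homeo by (rule homeomorphism_cont1)
  have y0: "y0 \<in> \<phi> ` (D \<inter> U)" using qD U(2) by (simp add: y0_def)
  then have y0D: "y0 \<in> \<phi> ` D" by blast
  have hD: "homeomorphism D (\<phi> ` D) \<phi> (inv_into D \<phi>)" "open (\<phi> ` D)" using chart_homeo [OF c] by blast+
  then have inj: "inj_on \<phi> D" unfolding homeomorphism_def by (metis inj_on_inverseI)
  obtain a0 where a0: "a0 \<in> spin_group" "q = act M (\<sigma> (base M q)) a0"
    using act_simply_transitive [of "\<sigma> (base M q)" q] U(2,3) by auto
  define P where "P y a = act M (\<sigma> (inv_into D \<phi> y)) a" for y a
  have q_eq: "q = P y0 a0"
    using a0(2) inj qD by (simp add: P_def y0_def)
  have "\<exists>s0>0. \<exists>L. ball y0 s0 \<subseteq> \<phi> ` (D \<inter> U) \<and> (\<forall>k y1 s a0. (\<forall>t\<in>{0..1}. y1 + (s * t) *\<^sub>R axis k 1 \<in> ball y0 s0) \<and> 0 < s \<and> s < s0 \<and> a0 \<in> spin_group \<longrightarrow>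
    (\<exists>a. a 0 = a0 \<and> a 1 \<in> spin_group \<and> norm (a 1 - a0) \<le> L * s * norm a0 \<and>
      parallel_curve M (\<lambda>t. P (y1 + (s * t) *\<^sub>R axis k 1) (a t)) \<and>
      (\<forall>t\<in>{0..1}. ((\<lambda>t. frame M (D, \<phi>) (P (y1 + (s * t) *\<^sub>R axis k 1) (a t))) has_vector_derivative
        - (s *\<^sub>R (\<Gamma> k (y1 + (s * t) *\<^sub>R axis k 1) ** frame M (D, \<phi>) (P (y1 + (s * t) *\<^sub>R axis k 1) (a t)))))
        (at t within {0..1}))))"
    unfolding P_def \<Gamma>_def by (rule parallel_lift [OF c U(1) _ cont smooth_c y0]) (rule U(3))
  then obtain s0 L where s0: "s0 > 0" "ball y0 s0 \<subseteq> \<phi> ` (D \<inter> U)"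
    and lift0: "\<forall>k y1 s a0. (\<forall>t\<in>{0..1}. y1 + (s * t) *\<^sub>R axis k 1 \<in> ball y0 s0) \<and> 0 < s \<and> s < s0 \<and> a0 \<in> spin_group \<longrightarrow>
    (\<exists>a. a 0 = a0 \<and> a 1 \<in> spin_group \<and> norm (a 1 - a0) \<le> L * s * norm a0 \<and>
      parallel_curve M (\<lambda>t. P (y1 + (s * t) *\<^sub>R axis k 1) (a t)) \<and>
      (\<forall>t\<in>{0..1}. ((\<lambda>t. frame M (D, \<phi>) (P (y1 + (s * t) *\<^sub>R axis k 1) (a t))) has_vector_derivative
        - (s *\<^sub>R (\<Gamma> k (y1 + (s * t) *\<^sub>R axis k 1) ** frame M (D, \<phi>) (P (y1 + (s * t) *\<^sub>R axis k 1) (a t)))))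
        (at t within {0..1})))"
    by (elim exE conjE) (rule that)
  note lift = lift0 [THEN spec, THEN spec, THEN spec, THEN spec, THEN mp]
  \<comment> \<open>Two legs of length below s0 / 2 stay in the ball of radius s0.\<close>
  have near: "y0 + s *\<^sub>R axis k 1 + (s * t) *\<^sub>R axis l 1 \<in> ball y0 s0" "y0 + (s * t) *\<^sub>R axis l 1 \<in> ball y0 s0"
    if "0 < s" "s < s0 / 2" "t \<in> {0..1}" for s t k l
  proof -
    have st: "s * t \<le> s" "0 \<le> s * t" using that by (auto simp: mult_left_le)
    have n: "norm (s *\<^sub>R axis k (1::real)) = s" "norm ((s * t) *\<^sub>R axis l (1::real)) = s * t"
      using that st by simp_all
    have ball: "y0 + v \<in> ball y0 s0" if "norm v < s0" for v
      using that by (simp add: dist_norm)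
    have "norm (s *\<^sub>R axis k 1 + (s * t) *\<^sub>R axis l (1::real)) < s0"
      using norm_triangle_ineq [of "s *\<^sub>R axis k 1" "(s * t) *\<^sub>R axis l (1::real)"] n st that by linarith
    from ball [OF this] show "y0 + s *\<^sub>R axis k 1 + (s * t) *\<^sub>R axis l 1 \<in> ball y0 s0"
      by (simp only: add.assoc)
    show "y0 + (s * t) *\<^sub>R axis l 1 \<in> ball y0 s0"
      by (rule ball) (use n st that in linarith)
  qed
  have "\<exists>b. (\<forall>\<^sub>F s in at_right 0. b s \<in> spin_group \<and> parallel_related M q (P (y0 + s *\<^sub>R axis k 1 + s *\<^sub>R axis l 1) (b s))) \<and>
      (b \<longlongrightarrow> a0) (at_right 0) \<and>
      ((\<lambda>s. (1 / s\<^sup>2) *\<^sub>R (frame M (D, \<phi>) (P (y0 + s *\<^sub>R axis k 1 + s *\<^sub>R axis l 1) (b s)) - F0 + s *\<^sub>R ((\<Gamma> k y0 + \<Gamma> l y0) ** F0))) \<longlongrightarrow>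
      ((1/2) *\<^sub>R (\<Gamma> k y0 ** \<Gamma> k y0 - partial k (\<Gamma> k) y0) + (1/2) *\<^sub>R (\<Gamma> l y0 ** \<Gamma> l y0 - partial l (\<Gamma> l) y0)
        + \<Gamma> l y0 ** \<Gamma> k y0 - partial k (\<Gamma> l) y0) ** F0) (at_right 0)" for k l
  proof -
    \<comment> \<open>The lifts are chosen for each s separately; regularity in s is supplied only
      by the uniform estimates. Outside the range of s the choice is arbitrary.\<close>
    have "\<exists>a b. 0 < s \<and> s < s0 / 2 \<longrightarrow> a 0 = a0 \<and> norm (a 1 - a0) \<le> L * s * norm a0 \<and>
      parallel_curve M (\<lambda>t. P (y0 + (s * t) *\<^sub>R axis k 1) (a t)) \<and>
      (\<forall>t\<in>{0..1}. ((\<lambda>t. frame M (D, \<phi>) (P (y0 + (s * t) *\<^sub>R axis k 1) (a t))) has_vector_derivative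
        - (s *\<^sub>R (\<Gamma> k (y0 + (s * t) *\<^sub>R axis k 1) ** frame M (D, \<phi>) (P (y0 + (s * t) *\<^sub>R axis k 1) (a t)))))
        (at t within {0..1})) \<and>
      b 0 = a 1 \<and> b 1 \<in> spin_group \<and> norm (b 1 - a 1) \<le> L * s * norm (a 1) \<and>
      parallel_curve M (\<lambda>t. P (y0 + s *\<^sub>R axis k 1 + (s * t) *\<^sub>R axis l 1) (b t)) \<and>
      (\<forall>t\<in>{0..1}. ((\<lambda>t. frame M (D, \<phi>) (P (y0 + s *\<^sub>R axis k 1 + (s * t) *\<^sub>R axis l 1) (b t))) has_vector_derivative
        - (s *\<^sub>R (\<Gamma> l (y0 + s *\<^sub>R axis k 1 + (s * t) *\<^sub>R axis l 1) ** frame M (D, \<phi>) (P (y0 + s *\<^sub>R axis k 1 + (s * t) *\<^sub>R axis l 1) (b t)))))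
        (at t within {0..1}))" (is "\<exists>a b. ?range s \<longrightarrow> ?Q s a b") for s
    proof (cases "?range s")
      case True
      have "s < s0" using True s0(1) by linarith
      obtain a where a: "a 0 = a0 \<and> a 1 \<in> spin_group \<and> norm (a 1 - a0) \<le> L * s * norm a0 \<and>
        parallel_curve M (\<lambda>t. P (y0 + (s * t) *\<^sub>R axis k 1) (a t)) \<and>
        (\<forall>t\<in>{0..1}. ((\<lambda>t. frame M (D, \<phi>) (P (y0 + (s * t) *\<^sub>R axis k 1) (a t))) has_vector_derivative
          - (s *\<^sub>R (\<Gamma> k (y0 + (s * t) *\<^sub>R axis k 1) ** frame M (D, \<phi>) (P (y0 + (s * t) *\<^sub>R axis k 1) (a t)))))
          (at t within {0..1}))"
        using lift [of y0 s k a0] near(2) [of s] True \<open>s < s0\<close> a0(1) by blast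
      obtain b where "b 0 = a 1 \<and> b 1 \<in> spin_group \<and> norm (b 1 - a 1) \<le> L * s * norm (a 1) \<and>
        parallel_curve M (\<lambda>t. P (y0 + s *\<^sub>R axis k 1 + (s * t) *\<^sub>R axis l 1) (b t)) \<and>
        (\<forall>t\<in>{0..1}. ((\<lambda>t. frame M (D, \<phi>) (P (y0 + s *\<^sub>R axis k 1 + (s * t) *\<^sub>R axis l 1) (b t))) has_vector_derivative
          - (s *\<^sub>R (\<Gamma> l (y0 + s *\<^sub>R axis k 1 + (s * t) *\<^sub>R axis l 1) ** frame M (D, \<phi>) (P (y0 + s *\<^sub>R axis k 1 + (s * t) *\<^sub>R axis l 1) (b t)))))
          (at t within {0..1}))"
        using lift [of "y0 + s *\<^sub>R axis k 1" s l "a 1"] near(1) [of s] True \<open>s < s0\<close> a by blast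
      then have "?Q s a b" using a by blast
      then show ?thesis by blast
    qed blast
    then have "\<forall>s. \<exists>a b. ?range s \<longrightarrow> ?Q s a b" by (rule allI)
    then have "\<exists>a. \<forall>s. \<exists>b. ?range s \<longrightarrow> ?Q s (a s) b" by (rule choice)
    then obtain a where "\<forall>s. \<exists>b. ?range s \<longrightarrow> ?Q s (a s) b" by (rule exE)
    then have "\<exists>b. \<forall>s. ?range s \<longrightarrow> ?Q s (a s) (b s)" by (rule choice)
    then obtain b where "\<forall>s. ?range s \<longrightarrow> ?Q s (a s) (b s)" by (rule exE)
    note ab = this [THEN spec, THEN mp]
    have ev: "\<forall>\<^sub>F s in at_right 0. ?range s" using s0(1) by (intro eventually_at_right_interval) simp
    \<comment> \<open>Outside the range, the default F0 keeps the initial conditions of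
      \<open>corner_expansion\<close> true for every s.\<close>
    define F1 where "F1 s t = (if ?range s then frame M (D, \<phi>) (P (y0 + (s * t) *\<^sub>R axis k 1) (a s t)) else F0)" for s t
    define F2 where "F2 s t = (if ?range s then frame M (D, \<phi>) (P (y0 + s *\<^sub>R axis k 1 + (s * t) *\<^sub>R axis l 1) (b s t)) else F0)" for s t
    have d\<Gamma>: "(\<Gamma> k has_derivative frechet_derivative (\<Gamma> k) (at y0)) (at y0)" for k
      unfolding \<Gamma>_def using christoffel_differentiable [OF c y0D, of k] by (simp add: frechet_derivative_works)
    have F1: "\<forall>\<^sub>F s in at_right 0. \<forall>t\<in>{0..1}. (F1 s has_vector_derivative
       - (s *\<^sub>R (\<Gamma> k (y0 + (s * t) *\<^sub>R axis k 1) ** F1 s t))) (at t within {0..1})"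
      using ev by eventually_elim (use ab in \<open>simp add: F1_def [abs_def]\<close>)
    have F2: "\<forall>\<^sub>F s in at_right 0. \<forall>t\<in>{0..1}. (F2 s has_vector_derivative
       - (s *\<^sub>R (\<Gamma> l (y0 + s *\<^sub>R axis k 1 + (s * t) *\<^sub>R axis l 1) ** F2 s t))) (at t within {0..1})"
      using ev by eventually_elim (use ab in \<open>simp add: F2_def [abs_def]\<close>)
    have F10: "F1 s 0 = F0" for s using ab [of s] q_eq by (simp add: F1_def F0_def)
    have F20: "F2 s 0 = F1 s 1" for s using ab [of s] by (simp add: F1_def F2_def)
    note lim = corner_expansion [OF d\<Gamma> F1 F2 F10 F20, folded partial_def]
    have F2_eq: "\<forall>\<^sub>F s in at_right 0. (1 / s\<^sup>2) *\<^sub>R (F2 s 1 - F0 + s *\<^sub>R ((\<Gamma> k y0 + \<Gamma> l y0) ** F0)) =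
        (1 / s\<^sup>2) *\<^sub>R (frame M (D, \<phi>) (P (y0 + s *\<^sub>R axis k 1 + s *\<^sub>R axis l 1) (b s 1)) - F0 + s *\<^sub>R ((\<Gamma> k y0 + \<Gamma> l y0) ** F0))"
      using ev by eventually_elim (simp add: F2_def)
    have "((\<lambda>s. L * s * norm a0) \<longlongrightarrow> L * 0 * norm a0) (at_right 0)"
      by (intro tendsto_intros)
    then have "((\<lambda>s. L * s * norm a0) \<longlongrightarrow> 0) (at_right 0)" by simp
    moreover have "\<forall>\<^sub>F s in at_right 0. norm (a s 1 - a0) \<le> L * s * norm a0"
      using ev by eventually_elim (use ab in blast)
    ultimately have "((\<lambda>s. a s 1 - a0) \<longlongrightarrow> 0) (at_right 0)" by (rule Lim_null_comparison [rotated])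
    then have a1: "((\<lambda>s. a s 1) \<longlongrightarrow> a0) (at_right 0)" by (rule LIM_zero_cancel)
    have "((\<lambda>s. L * s * norm (a s 1)) \<longlongrightarrow> L * 0 * norm a0) (at_right 0)"
      by (intro tendsto_intros a1)
    then have "((\<lambda>s. L * s * norm (a s 1)) \<longlongrightarrow> 0) (at_right 0)" by simp
    moreover have "\<forall>\<^sub>F s in at_right 0. norm (b s 1 - a s 1) \<le> L * s * norm (a s 1)"
      using ev by eventually_elim (use ab in blast)
    ultimately have "((\<lambda>s. b s 1 - a s 1) \<longlongrightarrow> 0) (at_right 0)" by (rule Lim_null_comparison [rotated])
    from tendsto_add [OF this a1] have b1: "((\<lambda>s. b s 1) \<longlongrightarrow> a0) (at_right 0)" by simp
    have rel: "\<forall>\<^sub>F s in at_right 0. b s 1 \<in> spin_group \<and> parallel_related M q (P (y0 + s *\<^sub>R axis k 1 + s *\<^sub>R axis l 1) (b s 1))"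
      using ev
    proof eventually_elim
      case (elim s)
      have "parallel_related M q (P (y0 + s *\<^sub>R axis k 1) (a s 1))"
        using ab [OF elim] parallel_curve_related [of "\<lambda>t. P (y0 + (s * t) *\<^sub>R axis k 1) (a s t)"] by (simp add: q_eq)
      moreover have "parallel_related M (P (y0 + s *\<^sub>R axis k 1) (a s 1)) (P (y0 + s *\<^sub>R axis k 1 + s *\<^sub>R axis l 1) (b s 1))"
        using ab [OF elim] parallel_curve_related [of "\<lambda>t. P (y0 + s *\<^sub>R axis k 1 + (s * t) *\<^sub>R axis l 1) (b s t)"] by simp
      ultimately show ?case using ab [OF elim] parallel_related_trans by blast
    qed
    show ?thesis
      by (rule exI [of _ "\<lambda>s. b s 1"], intro conjI rel b1) (rule Lim_transform_eventually [OF lim F2_eq])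
  qed
  note corner = this
  define ys where "ys s = y0 + s *\<^sub>R axis i 1 + s *\<^sub>R axis j 1" for s
  have ys': "y0 + s *\<^sub>R axis j 1 + s *\<^sub>R axis i 1 = ys s" for s by (simp add: ys_def algebra_simps)
  obtain b1 where b1: "\<forall>\<^sub>F s in at_right 0. b1 s \<in> spin_group \<and> parallel_related M q (P (ys s) (b1 s))"
    "(b1 \<longlongrightarrow> a0) (at_right 0)"
    and lim1: "((\<lambda>s. (1 / s\<^sup>2) *\<^sub>R (frame M (D, \<phi>) (P (ys s) (b1 s)) - F0 + s *\<^sub>R ((\<Gamma> i y0 + \<Gamma> j y0) ** F0))) \<longlongrightarrow>
      ((1/2) *\<^sub>R (\<Gamma> i y0 ** \<Gamma> i y0 - partial i (\<Gamma> i) y0) + (1/2) *\<^sub>R (\<Gamma> j y0 ** \<Gamma> j y0 - partial j (\<Gamma> j) y0)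
        + \<Gamma> j y0 ** \<Gamma> i y0 - partial i (\<Gamma> j) y0) ** F0) (at_right 0)"
    using corner [of i j, folded ys_def] by blast
  obtain b2 where b2: "\<forall>\<^sub>F s in at_right 0. b2 s \<in> spin_group \<and> parallel_related M q (P (ys s) (b2 s))"
    "(b2 \<longlongrightarrow> a0) (at_right 0)"
    and lim2: "((\<lambda>s. (1 / s\<^sup>2) *\<^sub>R (frame M (D, \<phi>) (P (ys s) (b2 s)) - F0 + s *\<^sub>R ((\<Gamma> j y0 + \<Gamma> i y0) ** F0))) \<longlongrightarrow>
      ((1/2) *\<^sub>R (\<Gamma> j y0 ** \<Gamma> j y0 - partial j (\<Gamma> j) y0) + (1/2) *\<^sub>R (\<Gamma> i y0 ** \<Gamma> i y0 - partial i (\<Gamma> i) y0)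
        + \<Gamma> i y0 ** \<Gamma> j y0 - partial j (\<Gamma> i) y0) ** F0) (at_right 0)"
    using corner [of j i, unfolded ys'] by blast
  define R where "R = riemann_coord M (D, \<phi>) y0 i j"
  have R: "R = partial i (\<Gamma> j) y0 - partial j (\<Gamma> i) y0 + \<Gamma> i y0 ** \<Gamma> j y0 - \<Gamma> j y0 ** \<Gamma> i y0"
    by (simp add: R_def riemann_coord_def \<Gamma>_def [abs_def])
  define x1 where "x1 s = frame M (D, \<phi>) (P (ys s) (b1 s))" for s
  define x2 where "x2 s = frame M (D, \<phi>) (P (ys s) (b2 s))" for s
  have diff: "((\<lambda>s. (1 / s\<^sup>2) *\<^sub>R (x2 s - x1 s)) \<longlongrightarrow> R ** F0) (at_right 0)"
  proof -
    from tendsto_diff [OF lim2 lim1] show ?thesis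
      unfolding x1_def [symmetric] x2_def [symmetric] scaleR_diff_right [symmetric] mm.diff_left [symmetric]
      by (simp add: R algebra_simps)
  qed
  have ev: "\<forall>\<^sub>F s in at_right 0. 0 < s \<and> s < s0 / 2" using s0(1) by (intro eventually_at_right_interval) simp
  have x1_lim: "(x1 \<longlongrightarrow> F0) (at_right 0)"
  proof -
    define T where "T s = (1 / s\<^sup>2) *\<^sub>R (x1 s - F0 + s *\<^sub>R ((\<Gamma> i y0 + \<Gamma> j y0) ** F0))" for s
    obtain l where T: "(T \<longlongrightarrow> l) (at_right 0)" using lim1 by (simp add: T_def [abs_def] x1_def)
    have "((\<lambda>s. F0 - s *\<^sub>R ((\<Gamma> i y0 + \<Gamma> j y0) ** F0) + s\<^sup>2 *\<^sub>R T s) \<longlongrightarrow> F0 - 0 *\<^sub>R ((\<Gamma> i y0 + \<Gamma> j y0) ** F0) + 0\<^sup>2 *\<^sub>R l) (at_right 0)"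
      by (intro tendsto_intros T)
    then have "((\<lambda>s. F0 - s *\<^sub>R ((\<Gamma> i y0 + \<Gamma> j y0) ** F0) + s\<^sup>2 *\<^sub>R T s) \<longlongrightarrow> F0) (at_right 0)" by simp
    moreover have "\<forall>\<^sub>F s in at_right 0. F0 - s *\<^sub>R ((\<Gamma> i y0 + \<Gamma> j y0) ** F0) + s\<^sup>2 *\<^sub>R T s = x1 s"
      using ev by eventually_elim (simp add: T_def)
    ultimately show ?thesis by (rule Lim_transform_eventually)
  qed
  \<comment> \<open>Right action by H s carries the end frame of the first path to that of the
    second, so H s is the holonomy of the loop and lies in G by
    \<open>parallel_loop_in_group\<close>.\<close>
  define H where "H s = reversal (b1 s) * b2 s" for s
  have facts: "\<forall>\<^sub>F s in at_right 0. H s \<in> spin_group \<and> H s \<in> G \<and> x2 s = x1 s ** spin_cover (H s) \<and>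
      transpose (x1 s) ** g (ys s) ** x1 s = mat 1 \<and> transpose (x2 s) ** g (ys s) ** x2 s = mat 1"
    using ev b1(1) b2(1)
  proof eventually_elim
    case (elim s)
    have yU: "ys s \<in> \<phi> ` (D \<inter> U)"
      using near(1) [of s 1 i j] elim(1) s0(2) by (auto simp: ys_def)
    then have inD: "inv_into D \<phi> (ys s) \<in> D" "inv_into D \<phi> (ys s) \<in> U" "\<phi> (inv_into D \<phi> (ys s)) = ys s"
      using inj by auto
    have spin: "b1 s \<in> spin_group" "b2 s \<in> spin_group" "H s \<in> spin_group"
      using elim by (auto simp: H_def spin_group_mult spin_group_reversal)
    have base: "base M (P (ys s) b) = inv_into D \<phi> (ys s)" if "b \<in> spin_group" for b
      using that inD(2) by (simp add: P_def act_base U(3))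
    have "b1 s * H s = (b1 s * reversal (b1 s)) * b2 s" by (simp only: H_def mult.assoc)
    then have "b1 s * H s = b2 s" using spin by (simp add: spin_group_iff)
    then have P2: "P (ys s) (b2 s) = act M (P (ys s) (b1 s)) (H s)"
      using spin by (simp add: P_def flip: act_mult)
    have "H s \<in> G"
      using elim spin by (intro parallel_loop_in_group [OF G hol q spin(3), of "P (ys s) (b1 s)"]) (simp_all flip: P2)
    moreover have "x2 s = x1 s ** spin_cover (H s)"
      unfolding x1_def x2_def P2 using base [OF spin(1)] inD(1) spin(3) by (intro frame_equivariant [OF c]) simp_all
    moreover have "transpose (frame M (D, \<phi>) (P (ys s) b)) ** g (ys s) ** frame M (D, \<phi>) (P (ys s) b) = mat 1" if "b \<in> spin_group" for b
      using frame_orthonormal [OF c, of "P (ys s) b"] inD by (simp add: base [OF that] g_def)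
    ultimately show ?case using spin unfolding x1_def x2_def by blast
  qed
  have orth0: "transpose F0 ** g y0 ** F0 = mat 1"
    using frame_orthonormal [OF c qD] by (simp add: F0_def g_def y0_def)
  then have inv0: "matrix_inv F0 = transpose F0 ** g y0" by (rule matrix_inv_eqI)
  define Y where "Y = matrix_inv F0 ** R ** F0"
  define Z where "Z s = (1 / s\<^sup>2) *\<^sub>R (spin_cover (H s) - mat 1)" for s
  \<comment> \<open>transpose (x1 s) times the Gram matrix inverts the orthonormal frame x1 s, so Z
    s is this inverse times the divided difference of the two frames.\<close>
  have Z: "(Z \<longlongrightarrow> Y) (at_right 0)"
  proof -
    have "isCont g y0"
      unfolding g_def using smooth_on_continuous [OF gram_smooth [OF c]] hD(2) y0D continuous_on_eq_continuous_at by blast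
    moreover have "((\<lambda>s. y0 + s *\<^sub>R axis i 1 + s *\<^sub>R axis j 1) \<longlongrightarrow> y0 + 0 *\<^sub>R axis i 1 + 0 *\<^sub>R axis j 1) (at_right 0)"
      by (intro tendsto_intros)
    ultimately have "((\<lambda>s. g (ys s)) \<longlongrightarrow> g y0) (at_right 0)"
      by (intro isCont_tendsto_compose [of y0 g]) (simp_all add: ys_def)
    then have "((\<lambda>s. (transpose (x1 s) ** g (ys s)) ** ((1 / s\<^sup>2) *\<^sub>R (x2 s - x1 s))) \<longlongrightarrow> (transpose F0 ** g y0) ** (R ** F0)) (at_right 0)"
      by (intro mm.tendsto diff bounded_linear.tendsto [OF bounded_linear_transpose x1_lim])
    moreover have "\<forall>\<^sub>F s in at_right 0. (transpose (x1 s) ** g (ys s)) ** ((1 / s\<^sup>2) *\<^sub>R (x2 s - x1 s)) = Z s"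
      using facts
    proof eventually_elim
      case (elim s)
      have "(transpose (x1 s) ** g (ys s)) ** (x2 s - x1 s) = (transpose (x1 s) ** g (ys s) ** x1 s) ** spin_cover (H s) - transpose (x1 s) ** g (ys s) ** x1 s"
        using elim by (simp add: mm.diff_right matrix_mul_assoc)
      then show ?case using elim by (simp add: mm.scaleR_right Z_def)
    qed
    ultimately have "(Z \<longlongrightarrow> (transpose F0 ** g y0) ** (R ** F0)) (at_right 0)"
      by (rule Lim_transform_eventually)
    then show ?thesis by (simp add: Y_def inv0 matrix_mul_assoc)
  qed
  \<comment> \<open>Both end frames are orthonormal over the same point, hence 1 + s^2 Z s is
    orthogonal. Dividing the orthogonality relation by s^2 and letting s tend to 0 leaves
    skewness.\<close>
  have Yskew: "transpose Y = - Y"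
  proof -
    have lim: "((\<lambda>s. transpose (Z s) + Z s + s\<^sup>2 *\<^sub>R (transpose (Z s) ** Z s)) \<longlongrightarrow> transpose Y + Y + 0\<^sup>2 *\<^sub>R (transpose Y ** Y)) (at_right 0)"
      by (intro tendsto_intros mm.tendsto Z bounded_linear.tendsto [OF bounded_linear_transpose Z])
    have "\<forall>\<^sub>F s in at_right 0. transpose (Z s) + Z s + s\<^sup>2 *\<^sub>R (transpose (Z s) ** Z s) = 0"
      using facts ev
    proof eventually_elim
      case (elim s)
      define S where "S = spin_cover (H s)"
      have "x2 s = x1 s ** S" using elim by (simp add: S_def)
      then have "transpose (x2 s) ** g (ys s) ** x2 s = transpose S ** (transpose (x1 s) ** g (ys s) ** x1 s) ** S"
        by (simp only: matrix_transpose_mul matrix_mul_assoc)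
      moreover have "transpose (x1 s) ** g (ys s) ** x1 s = mat 1" "transpose (x2 s) ** g (ys s) ** x2 s = mat 1"
        using elim by auto
      ultimately have SS: "transpose S ** S = mat 1" by (simp only: matrix_mul_rid)
      have S: "S = mat 1 + s\<^sup>2 *\<^sub>R Z s" using elim by (simp add: S_def Z_def)
      then have "transpose S = mat 1 + s\<^sup>2 *\<^sub>R transpose (Z s)"
        by (simp add: transpose_def vec_eq_iff mat_def)
      with SS S have "(mat 1 + s\<^sup>2 *\<^sub>R transpose (Z s)) ** (mat 1 + s\<^sup>2 *\<^sub>R Z s) = mat 1" by simp
      then have "s\<^sup>2 *\<^sub>R (transpose (Z s) + Z s + s\<^sup>2 *\<^sub>R (transpose (Z s) ** Z s)) = 0"
        by (simp add: mm.add_left mm.add_right mm.scaleR_left mm.scaleR_right scaleR_add_right algebra_simps)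
      then show ?case using elim by simp
    qed
    then have "((\<lambda>s. transpose (Z s) + Z s + s\<^sup>2 *\<^sub>R (transpose (Z s) ** Z s)) \<longlongrightarrow> 0) (at_right 0)"
      by (rule tendsto_eventually)
    from tendsto_unique [OF trivial_limit_at_right_real lim this] have "transpose Y + Y = 0" by simp
    then show ?thesis by (simp add: eq_neg_iff_add_eq_0)
  qed
  have "(H \<longlongrightarrow> reversal a0 * a0) (at_right 0)"
    unfolding H_def by (intro tendsto_mult bounded_linear.tendsto [OF bounded_linear_reversal] b1(2) b2(2))
  then have H1: "(H \<longlongrightarrow> 1) (at_right 0)" using a0(1) by (simp add: spin_group_iff)
  have "((\<lambda>s::real. s\<^sup>2) \<longlongrightarrow> 0\<^sup>2) (at_right 0)" by (intro tendsto_intros)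
  then have s2: "((\<lambda>s::real. s\<^sup>2) \<longlongrightarrow> 0) (at_right 0)" by simp
  have "((\<lambda>s. (1 / s\<^sup>2) *\<^sub>R (H s - 1)) \<longlongrightarrow> spin_lift Y) (at_right 0)"
    using facts ev Z unfolding Z_def
    by (intro spin_cover_expansion H1 s2 Yskew) (auto elim: eventually_mono)
  moreover have "\<forall>\<^sub>F s in at_right 0. H s \<in> G" using facts by (auto elim: eventually_mono)
  ultimately have "Y \<in> lie_algebra G"
    by (intro lie_algebra_memI [OF G Yskew])
  then show ?thesis by (simp add: Y_def R_def F0_def y0_def)
qed

end

section \<open>Algebraic curvature tensors\<close>

lemma sum3_rotate:
  "(\<Sum>j\<in>A. \<Sum>k\<in>A. \<Sum>l\<in>A. f l j k) = (\<Sum>j\<in>A. \<Sum>k\<in>A. \<Sum>l\<in>A. f j k l)"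
proof -
  have "(\<Sum>j\<in>A. \<Sum>k\<in>A. \<Sum>l\<in>A. f l j k) = (\<Sum>j\<in>A. \<Sum>l\<in>A. \<Sum>k\<in>A. f l j k)"
    by (intro sum.cong refl sum.swap)
  also have "\<dots> = (\<Sum>l\<in>A. \<Sum>j\<in>A. \<Sum>k\<in>A. f l j k)"
    by (rule sum.swap)
  finally show ?thesis .
qed

text \<open>In the application \<open>r a b c d\<close> is minus the entry (d, c) of the curvature
  matrix in the frame directions a and b. With this sign the sum of \<open>r a b a b\<close> is the
  scalar curvature.\<close>

locale curvature_tensor =
  fixes r :: "'n::finite \<Rightarrow> 'n \<Rightarrow> 'n \<Rightarrow> 'n \<Rightarrow> real"
  assumes antisym12: "r b a c d = - r a b c d"
    and antisym34: "r a b d c = - r a b c d"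
    and bianchi: "r a b c d + r b c a d + r c a b d = 0"
begin

text \<open>The classical octahedron argument: four instances of the Bianchi identity, reduced by
  the two antisymmetries, combine linearly to the claim.\<close>

lemma pair_symmetric: "r a b c d = r c d a b"
  using bianchi [of a b c d] bianchi [of b c d a] bianchi [of c d a b] bianchi [of d a b c]
    antisym12 [of a b c d] antisym34 [of a b c d] antisym12 [of c d a b] antisym34 [of c d a b]
    antisym34 [of b c a d] antisym12 [of b c a d] antisym34 [of c a b d] antisym12 [of a c b d] antisym12 [of c a b d]
    antisym34 [of a c b d] antisym34 [of d a b c] antisym12 [of d b a c] antisym34 [of d b a c] antisym12 [of d b c a]
    antisym34 [of b d a c] antisym34 [of a b d c] antisym34 [of c d b a] antisym34 [of d a c b] antisym12 [of b d a c]
    antisym34 [of d b c a] antisym12 [of c d b a] antisym34 [of b c d a] antisym34 [of a c d b]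
  by linarith

lemma bianchi_right: "r a b c d + r a c d b + r a d b c = 0"
  using bianchi [of c d b a] pair_symmetric [of a b c d] pair_symmetric [of a c d b] pair_symmetric [of a d b c]
    antisym34 [of c d b a] antisym34 [of d b c a] antisym34 [of b c d a]
  by linarith

text \<open>The sum over the cyclic orders of the last three indices vanishes by
  \<open>bianchi_right\<close>, while reordering a triple product costs only contractions. So the
  triple sum T equals twice the contraction S, and the remaining product of two generators is
  symmetrised to -2 on the diagonal.\<close>

lemma clifford_contraction:
  fixes e :: "'n \<Rightarrow> 'a::real_algebra_1"
  assumes e: "\<And>i j. e i * e j + e j * e i = (if i = j then -2 else 0)"
  shows "(\<Sum>i\<in>UNIV. \<Sum>j\<in>UNIV. \<Sum>k\<in>UNIV. \<Sum>l\<in>UNIV. r i j k l *\<^sub>R (e i * e j * e k * e l)) =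
    (- 2 * (\<Sum>i\<in>UNIV. \<Sum>j\<in>UNIV. r i j i j)) *\<^sub>R 1"
proof -
  define S where "S i = (\<Sum>j\<in>UNIV. \<Sum>k\<in>UNIV. r i j k j *\<^sub>R e k)" for i
  define T where "T i = (\<Sum>j\<in>UNIV. \<Sum>k\<in>UNIV. \<Sum>l\<in>UNIV. r i j k l *\<^sub>R (e j * e k * e l))" for i
  have swap: "e i * e j = - (e j * e i) + (if i = j then -2 else 0)" for i j
    using e [of i j] by (simp add: algebra_simps)
  have e3: "e l * e j * e k = e j * e k * e l + (if l = k then 2 *\<^sub>R e j else 0) - (if l = j then 2 *\<^sub>R e k else 0)" for j k l
  proof -
    have "e l * e j * e k = - (e j * (e l * e k)) + (if l = j then -2 * e k else 0)"
      by (simp add: swap [of l j] algebra_simps)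
    also have "e l * e k = - (e k * e l) + (if l = k then -2 else 0)" by (rule swap)
    finally show ?thesis by (auto simp: algebra_simps scaleR_2 mult_2 mult_2_right)
  qed
  have T: "T i = 2 *\<^sub>R S i" for i
  proof -
    define U where "U = (\<Sum>j\<in>UNIV. \<Sum>k\<in>UNIV. \<Sum>l\<in>UNIV. r i j k l *\<^sub>R (e l * e j * e k))"
    define V where "V = (\<Sum>j\<in>UNIV. \<Sum>k\<in>UNIV. \<Sum>l\<in>UNIV. r i j k l *\<^sub>R (e k * e l * e j))"
    have "U = (\<Sum>j\<in>UNIV. \<Sum>k\<in>UNIV. \<Sum>l\<in>UNIV. r i k l j *\<^sub>R (e j * e k * e l))"
      unfolding U_def by (rule sum3_rotate [where f = "\<lambda>j k l. r i k l j *\<^sub>R (e j * e k * e l)"])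
    moreover have "V = (\<Sum>j\<in>UNIV. \<Sum>k\<in>UNIV. \<Sum>l\<in>UNIV. r i l j k *\<^sub>R (e j * e k * e l))"
      unfolding V_def by (rule sum3_rotate [where f = "\<lambda>j k l. r i j k l *\<^sub>R (e k * e l * e j)", symmetric])
    ultimately have "T i + U + V = (\<Sum>j\<in>UNIV. \<Sum>k\<in>UNIV. \<Sum>l\<in>UNIV. (r i j k l + r i k l j + r i l j k) *\<^sub>R (e j * e k * e l))"
      by (simp add: T_def sum.distrib scaleR_add_left)
    then have sum0: "T i + U + V = 0" by (simp add: bianchi_right)
    have rkk: "r i j k k = 0" for j k using antisym34 [of i j k k] by simp
    have rjj: "r i j j l = - r i j l j" for j l by (rule antisym34)
    have "r i j k l *\<^sub>R (e l * e j * e k) = r i j k l *\<^sub>R (e j * e k * e l) +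
        (if l = k then (2 * r i j k l) *\<^sub>R e j else 0) - (if l = j then (2 * r i j k l) *\<^sub>R e k else 0)" for j k l
      unfolding e3 [of l j k] by (simp add: scaleR_add_right scaleR_diff_right mult.commute)
    then have U: "U = T i - 2 *\<^sub>R S i"
      unfolding U_def T_def S_def by (simp add: sum.distrib sum_subtractf rkk scaleR_sum_right)
    \<comment> \<open>The third cyclic order is reached by two exchanges. The contraction at k = j
      becomes a second -2 S by antisymmetry in the last pair; together with U this gives 3 T = 6
      S.\<close>
    have V: "V = T i - 2 *\<^sub>R S i - 2 *\<^sub>R S i"
    proof -
      have e3': "e k * e l * e j = e j * e k * e l + (if k = j then 2 *\<^sub>R e l else 0) - (if l = j then 2 *\<^sub>R e k else 0)" for j k l
      proof -
        have trans: "x = z + c - d" if "x = y + c - b" "y = z + b - d" for x y z b c d :: 'a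
          using that by simp
        have "(if k = l then 2 *\<^sub>R e j else 0) = (if l = k then 2 *\<^sub>R e j else 0)" by auto
        from trans [OF e3 [of k l j, unfolded this] e3 [of l j k]] show ?thesis .
      qed
      have "r i j k l *\<^sub>R (e k * e l * e j) = r i j k l *\<^sub>R (e j * e k * e l) +
          (if k = j then (2 * r i j k l) *\<^sub>R e l else 0) - (if l = j then (2 * r i j k l) *\<^sub>R e k else 0)" for j k l
        unfolding e3' [of k l j] by (simp add: scaleR_add_right scaleR_diff_right mult.commute)
      moreover have "(\<Sum>k\<in>UNIV. \<Sum>l\<in>UNIV. if k = j then (2 * r i j k l) *\<^sub>R e l else 0) = (\<Sum>l\<in>UNIV. (2 * r i j j l) *\<^sub>R e l)" for j
        by (subst sum.swap) simp
      ultimately have "V = T i + (\<Sum>j\<in>UNIV. \<Sum>l\<in>UNIV. (2 * r i j j l) *\<^sub>R e l) - 2 *\<^sub>R S i"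
        unfolding V_def T_def S_def by (simp add: sum.distrib sum_subtractf scaleR_sum_right)
      then show ?thesis
        by (simp add: S_def rjj sum_negf scaleR_sum_right)
    qed
    have t3: "3 *\<^sub>R x = x + (x + x)" for x :: 'a
      using scaleR_add_left [of 1 2 x] scaleR_2 [of x] by simp
    have "3 *\<^sub>R T i = 3 *\<^sub>R (2 *\<^sub>R S i)"
      using sum0 unfolding U V by (simp add: t3 [of "T i"] algebra_simps flip: scaleR_add_left)
    then show ?thesis by (simp only: scaleR_cancel_left) simp
  qed
  have "(\<Sum>i\<in>UNIV. \<Sum>j\<in>UNIV. \<Sum>k\<in>UNIV. \<Sum>l\<in>UNIV. r i j k l *\<^sub>R (e i * e j * e k * e l)) = (\<Sum>i\<in>UNIV. e i * T i)"
    by (simp add: T_def sum_distrib_left mult.assoc)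
  also have "\<dots> = 2 *\<^sub>R (\<Sum>i\<in>UNIV. \<Sum>k\<in>UNIV. (\<Sum>j\<in>UNIV. r i j k j) *\<^sub>R (e i * e k))"
  proof -
    have "e i * S i = (\<Sum>k\<in>UNIV. (\<Sum>j\<in>UNIV. r i j k j) *\<^sub>R (e i * e k))" for i
      unfolding S_def by (subst sum.swap) (simp add: sum_distrib_left scaleR_sum_left)
    then show ?thesis by (simp add: T scaleR_sum_right)
  qed
  also have "\<dots> = (\<Sum>i\<in>UNIV. \<Sum>k\<in>UNIV. (\<Sum>j\<in>UNIV. r i j k j) *\<^sub>R (e i * e k + e k * e i))"
  proof -
    have "(\<Sum>j\<in>UNIV. r i j k j) = (\<Sum>j\<in>UNIV. r k j i j)" for i k
      \<comment> \<open>The contraction is the Ricci tensor, and its symmetry lets the Clifford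
        products be replaced by anticommutators.\<close>
      by (intro sum.cong refl) (rule pair_symmetric)
    then have "(\<Sum>i\<in>UNIV. \<Sum>k\<in>UNIV. (\<Sum>j\<in>UNIV. r i j k j) *\<^sub>R (e k * e i)) = (\<Sum>i\<in>UNIV. \<Sum>k\<in>UNIV. (\<Sum>j\<in>UNIV. r i j k j) *\<^sub>R (e i * e k))"
      by (subst sum.swap) simp
    then show ?thesis by (simp add: scaleR_add_right sum.distrib scaleR_2)
  qed
  also have "\<dots> = (\<Sum>i\<in>UNIV. (\<Sum>j\<in>UNIV. r i j i j) *\<^sub>R (- 2))"
    by (simp add: e if_distrib [of "scaleR _"] cong: if_cong)
  also have "\<dots> = (- 2 * (\<Sum>i\<in>UNIV. \<Sum>j\<in>UNIV. r i j i j)) *\<^sub>R 1"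
  proof -
    have "(- 2 :: 'a) = (- 2) *\<^sub>R 1" by (simp add: scaleR_conv_of_real)
    then show ?thesis
      by (simp only: scaleR_sum_left [symmetric] scaleR_scaleR mult.commute sum_distrib_left)
  qed
  finally show ?thesis .
qed

end

section \<open>Bivectors and expansions in orthonormal bases\<close>

lemma so_inner_conv_inner: "so_inner X Y = (1/2) * (X \<bullet> Y)"
  by (simp add: so_inner_def trace_def matrix_matrix_mult_def transpose_def inner_vec_def)

lemma transpose_wedge [simp]: "transpose (wedge v w) = - wedge v w"
  by (simp add: transpose_def wedge_def vec_eq_iff)

lemma spin_lift_wedge: "cvec v * cvec w = 2 *\<^sub>R spin_lift (wedge v w) - (v \<bullet> w) *\<^sub>R 1"
proof -
  have "spin_lift (wedge v w) = (1/4) *\<^sub>R ((\<Sum>i\<in>UNIV. \<Sum>j\<in>UNIV. (v $ i * w $ j) *\<^sub>R (cliff_basis {i} * cliff_basis {j}))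
      - (\<Sum>i\<in>UNIV. \<Sum>j\<in>UNIV. (w $ i * v $ j) *\<^sub>R (cliff_basis {i} * cliff_basis {j})))"
    unfolding spin_lift_skew [OF transpose_wedge] by (simp add: wedge_def scaleR_diff_left sum_subtractf)
  also have "\<dots> = (1/4) *\<^sub>R (cvec v * cvec w - cvec w * cvec v)"
    by (simp add: cvec_def sum_product mult.commute)
  also have "cvec w * cvec v = - (2 * (v \<bullet> w)) *\<^sub>R 1 - cvec v * cvec w"
    using cvec_mult [of v w] by (simp add: algebra_simps)
  finally show ?thesis
    by (simp add: algebra_simps scaleR_add_right flip: scaleR_add_left)
qed

text \<open>The bivectors of an orthonormal frame are an orthonormal basis of the skew matrices for
  \<open>so_inner\<close>. With P the orthogonal matrix of the frame, the coefficients are entries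
  of transpose P times Z times P, and resumming conjugates back to Z.\<close>

lemma wedge_frame_expansion:
  fixes f :: "'n::{finite,linorder} \<Rightarrow> 'n rvec"
  assumes f: "\<And>i j. f i \<bullet> f j = (if i = j then 1 else 0)" and Z: "transpose Z = - Z"
  shows "(\<Sum>i\<in>UNIV. \<Sum>j\<in>{i<..}. so_inner Z (wedge (f i) (f j)) *\<^sub>R wedge (f i) (f j)) = Z"
proof -
  have anti: "wedge (f j) (f i) = - wedge (f i) (f j)" for i j by (simp add: wedge_def vec_eq_iff)
  have Zs: "Z $ a $ b = - Z $ b $ a" for a b
    using arg_cong [OF Z, of "\<lambda>X. X $ b $ a"] by (simp add: transpose_def)
  define P :: "'n rmat" where "P = (\<chi> a i. f i $ a)"
  define N where "N = transpose P ** Z ** P"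
  have "transpose P ** P = mat 1"
    using f by (simp add: P_def matrix_matrix_mult_def transpose_def vec_eq_iff mat_def inner_vec_def)
  then have PP: "P ** transpose P = mat 1" by (simp add: matrix_left_right_inverse)
  have inner: "so_inner Z (wedge (f i) (f j)) = N $ j $ i" for i j
  proof -
    have "so_inner Z (wedge (f i) (f j)) = (1/2) * ((\<Sum>a\<in>UNIV. \<Sum>b\<in>UNIV. Z $ a $ b * (f i $ b * f j $ a)) - (\<Sum>a\<in>UNIV. \<Sum>b\<in>UNIV. Z $ a $ b * (f j $ b * f i $ a)))"
      by (simp add: so_inner_conv_inner inner_vec_def wedge_def right_diff_distrib sum_subtractf)
    also have "(\<Sum>a\<in>UNIV. \<Sum>b\<in>UNIV. Z $ a $ b * (f j $ b * f i $ a)) = - (\<Sum>a\<in>UNIV. \<Sum>b\<in>UNIV. Z $ a $ b * (f i $ b * f j $ a))"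
    proof -
      have "Z $ b $ a * (x * y) = - (Z $ a $ b * (y * x))" for a b x y
        using Zs [of b a] by simp
      then show ?thesis
        unfolding sum_negf [symmetric] by (subst sum.swap) (intro sum.cong refl)
    qed
    finally have "so_inner Z (wedge (f i) (f j)) = (\<Sum>a\<in>UNIV. \<Sum>b\<in>UNIV. Z $ a $ b * (f i $ b * f j $ a))" by simp
    moreover have "N $ j $ i = (\<Sum>b\<in>UNIV. \<Sum>a\<in>UNIV. f j $ a * Z $ a $ b * f i $ b)"
      by (simp add: N_def P_def matrix_matrix_mult_def transpose_def sum_distrib_right)
    moreover have "\<dots> = (\<Sum>a\<in>UNIV. \<Sum>b\<in>UNIV. Z $ a $ b * (f i $ b * f j $ a))"
      by (subst sum.swap) (simp add: mult_ac)
    ultimately show ?thesis by simp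
  qed
  have "(\<Sum>i\<in>UNIV. \<Sum>j\<in>{i<..}. so_inner Z (wedge (f i) (f j)) *\<^sub>R wedge (f i) (f j)) =
      (1/2) *\<^sub>R (\<Sum>i\<in>UNIV. \<Sum>j\<in>UNIV. so_inner Z (wedge (f i) (f j)) *\<^sub>R wedge (f i) (f j))"
  proof (rule sum_less_symmetric)
    show "so_inner Z (wedge (f j) (f i)) *\<^sub>R wedge (f j) (f i) = so_inner Z (wedge (f i) (f j)) *\<^sub>R wedge (f i) (f j)" for i j
      unfolding anti [of i j] by (simp add: so_inner_conv_inner)
    show "so_inner Z (wedge (f i) (f i)) *\<^sub>R wedge (f i) (f i) = 0" for i
      by (simp add: wedge_def vec_eq_iff)
  qed
  also have "(\<Sum>i\<in>UNIV. \<Sum>j\<in>UNIV. so_inner Z (wedge (f i) (f j)) *\<^sub>R wedge (f i) (f j)) = P ** N ** transpose P - transpose (P ** N ** transpose P)"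
    unfolding inner
    by (simp add: vec_eq_iff wedge_def P_def matrix_matrix_mult_def transpose_def sum_distrib_left sum_distrib_right
        right_diff_distrib sum_subtractf mult_ac)
  also have "P ** N ** transpose P = (P ** transpose P) ** Z ** (P ** transpose P)"
    by (simp only: N_def matrix_mul_assoc)
  also have "\<dots> = Z" by (simp only: PP matrix_mul_lid matrix_mul_rid)
  also have "(1/2) *\<^sub>R (Z - transpose Z) = Z"
    unfolding Z by (simp add: vec_eq_iff)
  finally show ?thesis .
qed

lemma orthonormal_basis_finite: 
  assumes "orthonormal_basis B V"
  shows "finite B"
proof -
  have on: "\<forall>X\<in>B. \<forall>Y\<in>B. so_inner X Y = (if X = Y then 1 else 0)"
    using assms unfolding orthonormal_basis_def by blast
  then have "0 \<notin> B"
    using bspec [OF bspec [OF on], of 0 0] by (auto simp: so_inner_conv_inner)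
  moreover have "pairwise orthogonal B"
    using on by (simp add: so_inner_conv_inner pairwise_def orthogonal_def)
  ultimately show ?thesis
    using pairwise_orthogonal_independent independent_imp_finite by blast
qed

lemma orthonormal_basis_expansion:
  assumes B: "orthonormal_basis B V" and Z: "Z \<in> V"
  shows "Z = (\<Sum>X\<in>B. so_inner Z X *\<^sub>R X)"
proof -
  have fin: "finite B" using B by (rule orthonormal_basis_finite)
  have on: "\<forall>X\<in>B. \<forall>Y\<in>B. so_inner X Y = (if X = Y then 1 else 0)" and "span B = V"
    using B unfolding orthonormal_basis_def by blast+
  then have "Z \<in> span B" using Z by simp
  then obtain c where c: "Z = (\<Sum>X\<in>B. c X *\<^sub>R X)"
    unfolding span_finite [OF fin] by auto
  have "so_inner Z Y = c Y" if "Y \<in> B" for Y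
  proof -
    have "so_inner Z Y = (\<Sum>X\<in>B. c X * so_inner X Y)"
      by (simp add: c so_inner_conv_inner inner_sum_left sum_distrib_left mult_ac)
    also have "\<dots> = (\<Sum>X\<in>B. if X = Y then c X else 0)"
      using on that by (intro sum.cong refl) simp
    also have "\<dots> = c Y" using fin that by simp
    finally show ?thesis .
  qed
  then have "(\<Sum>X\<in>B. so_inner Z X *\<^sub>R X) = (\<Sum>X\<in>B. c X *\<^sub>R X)" by simp
  then show ?thesis using c by simp
qed

section \<open>The curvature operator in a frame\<close>

text \<open>Applied to \<open>lie_algebra G\<close>, which is defined through one-parameter groups:
  its closure under sums comes from here.\<close>

lemma orthonormal_basis_subspace:
  assumes "orthonormal_basis B V"
  shows "subspace V"
proof -
  have "span B = V" using assms unfolding orthonormal_basis_def by blast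
  then show ?thesis using subspace_span [of B] by simp
qed

definition frame_curvature :: "('m, 'n::finite, 'p) spin_data \<Rightarrow> ('m, 'n) chart \<Rightarrow> 'p \<Rightarrow> 'n \<Rightarrow> 'n \<Rightarrow> 'n rmat" where
  "frame_curvature M c q a b = matrix_inv (frame M c q) **
     riemann M c (snd c (base M q)) (column a (frame M c q)) (column b (frame M c q)) ** frame M c q"

lemma riemann_coord_antisym: "riemann_coord M c y j i = - riemann_coord M c y i j"
  by (simp add: riemann_coord_def)

lemma frame_curvature_expand:
  fixes M :: "('m, 'n::{finite,linorder}, 'p) spin_data"
  shows "frame_curvature M c q a b = (\<Sum>i\<in>UNIV. \<Sum>j\<in>UNIV. (frame M c q $ i $ a * frame M c q $ j $ b) *\<^sub>R
     (matrix_inv (frame M c q) ** riemann_coord M c (snd c (base M q)) i j ** frame M c q))"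
proof -
  interpret mm: bounded_bilinear "(**) :: 'n rmat \<Rightarrow> 'n rmat \<Rightarrow> 'n rmat"
    by (rule bounded_bilinear_matrix_mult)
  show ?thesis
    by (simp add: frame_curvature_def riemann_def column_def mm.sum_left mm.sum_right mm.scaleR_left mm.scaleR_right)
qed

lemma frame_curvature_antisym:
  fixes M :: "('m, 'n::{finite,linorder}, 'p) spin_data"
  shows "frame_curvature M c q b a = - frame_curvature M c q a b"
proof -
  interpret mm: bounded_bilinear "(**) :: 'n rmat \<Rightarrow> 'n rmat \<Rightarrow> 'n rmat"
    by (rule bounded_bilinear_matrix_mult)
  let ?F = "frame M c q" and ?R = "riemann_coord M c (snd c (base M q))"
  have "frame_curvature M c q b a = (\<Sum>j\<in>UNIV. \<Sum>i\<in>UNIV. (?F $ i $ b * ?F $ j $ a) *\<^sub>R (matrix_inv ?F ** ?R i j ** ?F))"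
    unfolding frame_curvature_expand by (rule sum.swap)
  also have "\<dots> = (\<Sum>j\<in>UNIV. \<Sum>i\<in>UNIV. - ((?F $ j $ a * ?F $ i $ b) *\<^sub>R (matrix_inv ?F ** ?R j i ** ?F)))"
  proof (intro sum.cong refl)
    fix i j
    show "(?F $ i $ b * ?F $ j $ a) *\<^sub>R (matrix_inv ?F ** ?R i j ** ?F) = - ((?F $ j $ a * ?F $ i $ b) *\<^sub>R (matrix_inv ?F ** ?R j i ** ?F))"
      unfolding riemann_coord_antisym [of M c _ j i] by (simp add: mm.minus_left mm.minus_right mult.commute)
  qed
  finally show ?thesis by (simp add: frame_curvature_expand sum_negf)
qed

lemma curvature_operator_eq:
  "curvature_operator M c q X = - (\<Sum>a\<in>UNIV. \<Sum>b\<in>{a<..}. X $ b $ a *\<^sub>R frame_curvature M c q a b)"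
  by (simp add: curvature_operator_def frame_curvature_def)

lemma curvature_operator_linear: "linear (curvature_operator M c q)"
  by (rule linearI) (simp_all add: curvature_operator_eq scaleR_add_left sum.distrib scaleR_sum_right)

lemma curvature_operator_skew:
  assumes "transpose X = - X"
  shows "curvature_operator M c q X = - ((1/2) *\<^sub>R (\<Sum>a\<in>UNIV. \<Sum>b\<in>UNIV. X $ b $ a *\<^sub>R frame_curvature M c q a b))"
proof -
  have X: "X $ i $ j = - X $ j $ i" for i j
    using arg_cong [OF assms, of "\<lambda>Y. Y $ j $ i"] by (simp add: transpose_def)
  have "(\<Sum>a\<in>UNIV. \<Sum>b\<in>{a<..}. X $ b $ a *\<^sub>R frame_curvature M c q a b) =
      (1/2) *\<^sub>R (\<Sum>a\<in>UNIV. \<Sum>b\<in>UNIV. X $ b $ a *\<^sub>R frame_curvature M c q a b)"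
  proof (rule sum_less_symmetric)
    show "X $ a $ b *\<^sub>R frame_curvature M c q b a = X $ b $ a *\<^sub>R frame_curvature M c q a b" for a b
      using X [of a b] frame_curvature_antisym [of M c q b a] by simp
    show "X $ a $ a *\<^sub>R frame_curvature M c q a a = 0" for a
      using X [of a a] by simp
  qed
  then show ?thesis by (simp only: curvature_operator_eq)
qed

lemma curvature_operator_wedge_axis:
  "curvature_operator M c q (wedge (axis a 1) (axis b 1)) = - frame_curvature M c q a b"
proof -
  have "(\<Sum>i\<in>UNIV. \<Sum>j\<in>UNIV. wedge (axis a 1) (axis b 1) $ j $ i *\<^sub>R frame_curvature M c q i j) =
      (\<Sum>i\<in>UNIV. \<Sum>j\<in>UNIV. (if i = a then (if j = b then frame_curvature M c q i j else 0) else 0)) -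
      (\<Sum>i\<in>UNIV. \<Sum>j\<in>UNIV. (if i = b then (if j = a then frame_curvature M c q i j else 0) else 0))"
    unfolding sum_subtractf [symmetric] by (intro sum.cong refl) (simp add: wedge_def axis_def)
  also have "\<dots> = frame_curvature M c q a b - frame_curvature M c q b a"
  proof -
    have "(\<Sum>j\<in>UNIV. if i = k then (if j = l then frame_curvature M c q i j else 0) else 0) =
        (if i = k then frame_curvature M c q k l else 0)" for i k l
      by (cases "i = k") auto
    then show ?thesis by simp
  qed
  also have "\<dots> = 2 *\<^sub>R frame_curvature M c q a b"
    unfolding frame_curvature_antisym [of M c q a b] by (simp add: scaleR_2)
  finally show ?thesis by (simp add: curvature_operator_skew)
qed

section \<open>Symmetries of the curvature in a spin frame\<close>

context closed_spin_manifold
begin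

lemma partial_christoffel_symmetric:
  assumes c: "(D, \<phi>) \<in> charts M" and y: "y \<in> \<phi> ` D"
  shows "partial i (\<lambda>z. christoffel M (D, \<phi>) z j) y $ l $ k = partial i (\<lambda>z. christoffel M (D, \<phi>) z k) y $ l $ j"
proof -
  have op: "open (\<phi> ` D)" using chart_homeo [OF c] by blast
  have d: "((\<lambda>z. christoffel M (D, \<phi>) z j $ l $ k) has_derivative
      (\<lambda>v. frechet_derivative (\<lambda>z. christoffel M (D, \<phi>) z j) (at y) v $ l $ k)) (at y)" for j k
    using christoffel_differentiable [OF c y, of j] unfolding frechet_derivative_works
    by (intro bounded_linear.has_derivative [OF bounded_linear_vec_nth])
  have "((\<lambda>z. christoffel M (D, \<phi>) z k $ l $ j) has_derivative
      (\<lambda>v. frechet_derivative (\<lambda>z. christoffel M (D, \<phi>) z j) (at y) v $ l $ k)) (at y)"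
    by (rule has_derivative_transform_within_open [OF d [of j k] op y]) (rule christoffel_symmetric [OF c])
  from has_derivative_unique [OF this d [of k j]] show ?thesis
    unfolding partial_def by (rule fun_cong)
qed

text \<open>Torsion-freeness: the Christoffel symbols and their derivatives are symmetric in the
  lower indices, so in the cyclic sum the derivative terms and the products cancel in pairs.\<close>

lemma riemann_coord_bianchi:
  assumes c: "(D, \<phi>) \<in> charts M" and y: "y \<in> \<phi> ` D"
  defines "R \<equiv> riemann_coord M (D, \<phi>) y"
  shows "R i j $ l $ k + R j k $ l $ i + R k i $ l $ j = 0"
proof -
  define \<Gamma> where "\<Gamma> i = christoffel M (D, \<phi>) y i" for i
  define \<Gamma>' where "\<Gamma>' i j = partial i (\<lambda>z. christoffel M (D, \<phi>) z j) y" for i j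
  have R: "R i j = \<Gamma>' i j - \<Gamma>' j i + \<Gamma> i ** \<Gamma> j - \<Gamma> j ** \<Gamma> i" for i j
    by (simp add: R_def riemann_coord_def \<Gamma>_def \<Gamma>'_def)
  have d: "\<Gamma>' i j $ l $ k = \<Gamma>' i k $ l $ j" for i j k
    unfolding \<Gamma>'_def by (rule partial_christoffel_symmetric [OF c y])
  have p: "(\<Gamma> i ** \<Gamma> j) $ l $ k = (\<Gamma> i ** \<Gamma> k) $ l $ j" for i j k
    using christoffel_symmetric [OF c y] unfolding matrix_matrix_mult_def by (simp add: \<Gamma>_def)
  show ?thesis
    unfolding R using d [of i j k] d [of j i k] d [of k i j] p [of i j k] p [of j i k] p [of k i j] by simp
qed

context
  fixes D \<phi> q
  assumes c: "(D, \<phi>) \<in> charts M" and qD: "base M q \<in> D"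
begin

private abbreviation "F \<equiv> frame M (D, \<phi>) q"
private abbreviation "R \<equiv> riemann_coord M (D, \<phi>) (\<phi> (base M q))"
private abbreviation "K \<equiv> frame_curvature M (D, \<phi>) q"

lemma frame_matrix_inv:
  "matrix_inv F = transpose F ** gram M (D, \<phi>) (\<phi> (base M q))" "matrix_inv F ** F = mat 1" "F ** matrix_inv F = mat 1"
proof -
  have orth: "transpose F ** gram M (D, \<phi>) (\<phi> (base M q)) ** F = mat 1" by (rule frame_orthonormal [OF c qD])
  then show eq: "matrix_inv F = transpose F ** gram M (D, \<phi>) (\<phi> (base M q))" by (rule matrix_inv_eqI)
  show "matrix_inv F ** F = mat 1" unfolding eq by (rule orth)
  then show "F ** matrix_inv F = mat 1" by (simp add: matrix_left_right_inverse)
qed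

lemma gram_inv: "matrix_inv (gram M (D, \<phi>) (\<phi> (base M q))) = F ** transpose F"
proof (rule matrix_inv_eqI)
  show "F ** transpose F ** gram M (D, \<phi>) (\<phi> (base M q)) = mat 1"
    using frame_matrix_inv(3) unfolding frame_matrix_inv(1) by (simp only: matrix_mul_assoc)
qed

text \<open>The frame components contract \<open>riemann_coord\<close> with the frame matrix in
  three indices. Rotating the summation indices reduces the cyclic sum to the identity in
  coordinates.\<close>

lemma frame_curvature_bianchi: "K a b $ d $ c + K b c $ d $ a + K c a $ d $ b = 0"
proof -
  define s where "s i j k = (\<Sum>l\<in>UNIV. matrix_inv F $ d $ l * R i j $ l $ k)" for i j k
  have comp: "K a b $ d $ c = (\<Sum>i\<in>UNIV. \<Sum>j\<in>UNIV. \<Sum>k\<in>UNIV. F $ i $ a * F $ j $ b * F $ k $ c * s i j k)" for a b c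
    by (simp add: frame_curvature_expand matrix_matrix_mult_def s_def sum_distrib_left sum_distrib_right mult_ac)
  have "K b c $ d $ a = (\<Sum>i\<in>UNIV. \<Sum>j\<in>UNIV. \<Sum>k\<in>UNIV. F $ i $ a * F $ j $ b * F $ k $ c * s j k i)"
    unfolding comp by (subst sum3_rotate [symmetric]) (simp add: mult_ac)
  moreover have "K c a $ d $ b = (\<Sum>i\<in>UNIV. \<Sum>j\<in>UNIV. \<Sum>k\<in>UNIV. F $ i $ a * F $ j $ b * F $ k $ c * s k i j)"
    unfolding comp by (subst sum3_rotate [symmetric], subst sum3_rotate [symmetric]) (simp add: mult_ac)
  ultimately have "K a b $ d $ c + K b c $ d $ a + K c a $ d $ b =
      (\<Sum>i\<in>UNIV. \<Sum>j\<in>UNIV. \<Sum>k\<in>UNIV. F $ i $ a * F $ j $ b * F $ k $ c * (s i j k + s j k i + s k i j))"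
    by (simp add: comp [of a b c] sum.distrib distrib_left)
  moreover have "s i j k + s j k i + s k i j = 0" for i j k
  proof -
    have "s i j k + s j k i + s k i j = (\<Sum>l\<in>UNIV. matrix_inv F $ d $ l * (R i j $ l $ k + R j k $ l $ i + R k i $ l $ j))"
      by (simp add: s_def sum.distrib distrib_left)
    then show ?thesis using riemann_coord_bianchi [OF c imageI [OF qD]] by simp
  qed
  ultimately show ?thesis by simp
qed

text \<open>The inverse Gram matrix is F times its transpose. The interchanges of sums bring the sum
  over a to the inside, where F meets its inverse; the sum over b then forms the inverse Gram
  matrix.\<close>

lemma scal_frame: "scal M (D, \<phi>) (\<phi> (base M q)) = (\<Sum>a\<in>UNIV. \<Sum>b\<in>UNIV. K a b $ a $ b)"
proof -
  have "(\<Sum>a\<in>UNIV. \<Sum>b\<in>UNIV. K a b $ a $ b) =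
      (\<Sum>a\<in>UNIV. \<Sum>b\<in>UNIV. \<Sum>i\<in>UNIV. \<Sum>j\<in>UNIV. F $ i $ a * F $ j $ b * (matrix_inv F ** (R i j ** F)) $ a $ b)"
    by (simp add: frame_curvature_expand matrix_mul_assoc)
  also have "\<dots> = (\<Sum>b\<in>UNIV. \<Sum>a\<in>UNIV. \<Sum>j\<in>UNIV. \<Sum>i\<in>UNIV. F $ i $ a * F $ j $ b * (matrix_inv F ** (R i j ** F)) $ a $ b)"
    by (subst sum.swap, intro sum.cong refl sum.swap)
  also have "\<dots> = (\<Sum>b\<in>UNIV. \<Sum>j\<in>UNIV. \<Sum>a\<in>UNIV. \<Sum>i\<in>UNIV. F $ i $ a * F $ j $ b * (matrix_inv F ** (R i j ** F)) $ a $ b)"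
    by (intro sum.cong refl sum.swap)
  also have "\<dots> = (\<Sum>b\<in>UNIV. \<Sum>j\<in>UNIV. \<Sum>i\<in>UNIV. \<Sum>a\<in>UNIV. F $ i $ a * F $ j $ b * (matrix_inv F ** (R i j ** F)) $ a $ b)"
    by (intro sum.cong refl sum.swap)
  also have "\<dots> = (\<Sum>b\<in>UNIV. \<Sum>j\<in>UNIV. \<Sum>i\<in>UNIV. F $ j $ b * (R i j ** F) $ i $ b)"
  proof (intro sum.cong refl)
    fix b j i
    have "(F ** (matrix_inv F ** (R i j ** F))) $ i $ b = (R i j ** F) $ i $ b"
      by (simp add: matrix_mul_assoc frame_matrix_inv(3))
    then have sa: "(\<Sum>a\<in>UNIV. F $ i $ a * (matrix_inv F ** (R i j ** F)) $ a $ b) = (R i j ** F) $ i $ b"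
      by (simp add: matrix_matrix_mult_def [of F])
    then show "(\<Sum>a\<in>UNIV. F $ i $ a * F $ j $ b * (matrix_inv F ** (R i j ** F)) $ a $ b) = F $ j $ b * (R i j ** F) $ i $ b"
      unfolding sa [symmetric] sum_distrib_left by (simp add: mult_ac)
  qed
  also have "\<dots> = (\<Sum>j\<in>UNIV. \<Sum>i\<in>UNIV. \<Sum>b\<in>UNIV. F $ j $ b * (R i j ** F) $ i $ b)"
    by (subst sum.swap, intro sum.cong refl sum.swap)
  also have "\<dots> = (\<Sum>j\<in>UNIV. \<Sum>i\<in>UNIV. (R i j ** (F ** transpose F)) $ i $ j)"
  proof (intro sum.cong refl)
    fix i j
    have "(R i j ** (F ** transpose F)) $ i $ j = ((R i j ** F) ** transpose F) $ i $ j" by (simp only: matrix_mul_assoc)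
    also have "\<dots> = (\<Sum>b\<in>UNIV. (R i j ** F) $ i $ b * F $ j $ b)"
      unfolding matrix_matrix_mult_def [of "R i j ** F"] by (simp add: transpose_def)
    finally show "(\<Sum>b\<in>UNIV. F $ j $ b * (R i j ** F) $ i $ b) = (R i j ** (F ** transpose F)) $ i $ j"
      by (simp add: mult.commute)
  qed
  also have "\<dots> = (\<Sum>j\<in>UNIV. \<Sum>i\<in>UNIV. \<Sum>k\<in>UNIV. R i j $ i $ k * (F ** transpose F) $ j $ k)"
  proof -
    have "(F ** transpose F) $ k $ j = (F ** transpose F) $ j $ k" for j k
      by (simp add: matrix_matrix_mult_def transpose_def mult.commute)
    then show ?thesis by (simp add: matrix_matrix_mult_def [of "R _ _"])
  qed
  also have "\<dots> = (\<Sum>j\<in>UNIV. \<Sum>k\<in>UNIV. (F ** transpose F) $ j $ k * (\<Sum>i\<in>UNIV. R i j $ i $ k))"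
    unfolding sum_distrib_left by (rule sum.cong [OF refl], subst sum.swap) (simp add: mult.commute)
  finally show ?thesis
    by (simp add: scal_def gram_inv)
qed

text \<open>Skewness in the last index pair is not computed from the metric: it is part of
  membership in the Lie algebra, which holonomy has provided. Antisymmetry in the first pair and the
  Bianchi identity come from the coordinate formula.\<close>

lemma
  assumes G: "compact_connected_subgroup G" and hol: "holonomy_group M u \<subseteq> G"
    and q: "q \<in> reduction M G u" and sub: "subspace (lie_algebra G)"
  shows curvature_operator_in_lie_algebra: "curvature_operator M (D, \<phi>) q X \<in> lie_algebra G"
    and frame_curvature_tensor: "curvature_tensor (\<lambda>a b c d. - K a b $ d $ c)"
proof -
  have KG: "K a b \<in> lie_algebra G" for a b
    unfolding frame_curvature_expand using curvature_in_lie_algebra [OF G hol q c qD]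
    by (intro subspace_sum [OF sub] subspace_scale [OF sub]) simp
  then show "curvature_operator M (D, \<phi>) q X \<in> lie_algebra G"
    unfolding curvature_operator_eq
    by (intro subspace_neg [OF sub] subspace_sum [OF sub] subspace_scale [OF sub])
  show "curvature_tensor (\<lambda>a b c d. - K a b $ d $ c)"
  proof
    fix a b c d
    show "- K b a $ d $ c = - (- K a b $ d $ c)"
      by (subst frame_curvature_antisym) simp
    have "transpose (K a b) = - K a b" using KG [of a b] by (simp add: lie_algebra_def)
    from arg_cong [OF this, of "\<lambda>A. A $ d $ c"] show "- K a b $ c $ d = - (- K a b $ d $ c)"
      by (simp add: transpose_def)
    show "- K a b $ d $ c + - K b c $ d $ a + - K c a $ d $ b = 0"
      using frame_curvature_bianchi [of a b d c] by simp
  qed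
qed

text \<open>Both sides are one fourfold sum with the two index pairs interchanged; the interchanges
  of sums only prepare for pair symmetry of the tensor.\<close>

lemma curvature_operator_symmetric:
  assumes "curvature_tensor (\<lambda>a b c d. - K a b $ d $ c)"
    and X: "transpose X = - X" and Y: "transpose Y = - Y"
  shows "so_inner (curvature_operator M (D, \<phi>) q X) Y = so_inner X (curvature_operator M (D, \<phi>) q Y)"
proof -
  have so: "so_inner (curvature_operator M (D, \<phi>) q X) Y =
      - (1/4) * (\<Sum>d\<in>UNIV. \<Sum>c\<in>UNIV. \<Sum>a\<in>UNIV. \<Sum>b\<in>UNIV. X $ b $ a * Y $ d $ c * K a b $ d $ c)"
    if "transpose X = - X" for X Y
    by (simp add: so_inner_conv_inner curvature_operator_skew [OF that] inner_vec_def sum_distrib_left sum_distrib_right mult_ac flip: sum_negf)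
  have pair: "K a b $ d $ c = K c d $ b $ a" for a b c d
    using curvature_tensor.pair_symmetric [OF assms(1), of a b d c] by simp
  have "(\<Sum>d\<in>UNIV. \<Sum>c\<in>UNIV. \<Sum>a\<in>UNIV. \<Sum>b\<in>UNIV. X $ b $ a * Y $ d $ c * K a b $ d $ c) =
      (\<Sum>d\<in>UNIV. \<Sum>a\<in>UNIV. \<Sum>c\<in>UNIV. \<Sum>b\<in>UNIV. X $ b $ a * Y $ d $ c * K a b $ d $ c)"
    by (intro sum.cong refl sum.swap)
  also have "\<dots> = (\<Sum>d\<in>UNIV. \<Sum>a\<in>UNIV. \<Sum>b\<in>UNIV. \<Sum>c\<in>UNIV. X $ b $ a * Y $ d $ c * K a b $ d $ c)"
    by (intro sum.cong refl sum.swap)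
  also have "\<dots> = (\<Sum>a\<in>UNIV. \<Sum>b\<in>UNIV. \<Sum>d\<in>UNIV. \<Sum>c\<in>UNIV. X $ b $ a * Y $ d $ c * K a b $ d $ c)"
    by (subst sum.swap, intro sum.cong refl sum.swap)
  also have "\<dots> = (\<Sum>a\<in>UNIV. \<Sum>b\<in>UNIV. \<Sum>c\<in>UNIV. \<Sum>d\<in>UNIV. X $ b $ a * Y $ d $ c * K a b $ d $ c)"
    by (intro sum.cong refl sum.swap)
  also have "\<dots> = (\<Sum>b\<in>UNIV. \<Sum>a\<in>UNIV. \<Sum>c\<in>UNIV. \<Sum>d\<in>UNIV. Y $ d $ c * X $ b $ a * K c d $ b $ a)"
  proof -
    have "X $ b $ a * Y $ d $ c * K a b $ d $ c = Y $ d $ c * X $ b $ a * K c d $ b $ a" for a b c d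
      using pair [of a b d c] by simp
    then show ?thesis by (subst sum.swap) (simp only:)
  qed
  finally have "so_inner (curvature_operator M (D, \<phi>) q X) Y = so_inner (curvature_operator M (D, \<phi>) q Y) X"
    unfolding so [OF X] so [OF Y] by simp
  then show ?thesis
    by (simp add: so_inner_conv_inner inner_commute)
qed

end

end

section \<open>The Weitzenboeck formula\<close>

lemma kron_mult:
  fixes A B :: "complex^'s^'s" and C D :: "complex^'k^'k"
  shows "kron A C ** kron B D = kron (A ** B) (C ** D)"
proof (simp only: vec_eq_iff, intro allI)
  fix p q :: "'s \<times> 'k"
  have "(kron A C ** kron B D) $ p $ q =
      (\<Sum>r\<in>UNIV \<times> UNIV. (A $ fst p $ fst r * B $ fst r $ fst q) * (C $ snd p $ snd r * D $ snd r $ snd q))"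
    by (simp add: kron_def matrix_matrix_mult_def mult_ac)
  also have "\<dots> = (\<Sum>i\<in>UNIV. \<Sum>j\<in>UNIV. (A $ fst p $ i * B $ i $ fst q) * (C $ snd p $ j * D $ j $ snd q))"
    by (simp only: sum.cartesian_product) (simp add: case_prod_unfold)
  also have "\<dots> = kron (A ** B) (C ** D) $ p $ q"
    by (simp add: kron_def matrix_matrix_mult_def sum_product)
  finally show "(kron A C ** kron B D) $ p $ q = kron (A ** B) (C ** D) $ p $ q" .
qed

lemma kron_mat_one: "kron (mat 1) (mat 1) = mat 1"
  by (auto simp: kron_def mat_def vec_eq_iff prod_eq_iff)

lemma bounded_bilinear_kron: "bounded_bilinear kron"
proof (rule bilinear_conv_bounded_bilinear [THEN iffD1], unfold bilinear_def, intro conjI allI)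
  show "linear (kron A)" for A :: "complex^'s^'s"
    by (rule linearI) (simp_all add: kron_def vec_eq_iff algebra_simps)
  show "linear (\<lambda>A. kron A B)" for B :: "complex^'k^'k"
    by (rule linearI) (simp_all add: kron_def vec_eq_iff algebra_simps)
qed

text \<open>Leibniz rule for the Kronecker product. The spinor factor is linear on the whole
  Clifford algebra, so its derivative along the exponential is its value at the lift.\<close>

lemma d_rep_tensor:
  fixes \<rho> :: "'n::{finite,linorder} cliff \<Rightarrow> complex^'s^'s" and \<pi> :: "'n cliff \<Rightarrow> complex^'k^'k"
  assumes \<rho>: "linear \<rho>" "\<rho> 1 = mat 1" and \<pi>: "unitary_rep G \<pi>" and X: "X \<in> lie_algebra G"
  shows "d_rep (tensor_rep \<rho> \<pi>) X = kron (\<rho> (spin_lift X)) (mat 1) + kron (mat 1) (d_rep \<pi> X)"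
proof -
  interpret kron: bounded_bilinear "kron :: complex^'s^'s \<Rightarrow> complex^'k^'k \<Rightarrow> _"
    by (rule bounded_bilinear_kron)
  have "((\<lambda>t. exp (t *\<^sub>R spin_lift X)) has_vector_derivative spin_lift X) (at 0)"
    using exp_scaleR_has_vector_derivative_right [of "spin_lift X" 0] by simp
  then have d: "((\<lambda>t. \<rho> (exp (t *\<^sub>R spin_lift X))) has_vector_derivative \<rho> (spin_lift X)) (at 0)"
    by (rule bounded_linear.has_vector_derivative [OF bounded_linear_from_cliff [OF \<rho>(1)]])
  have "\<pi> 1 = mat 1" using \<pi> by (simp add: unitary_rep_def)
  with kron.has_vector_derivative [OF d rep_exp_has_vector_derivative [OF \<pi> X]]
  have "((\<lambda>t. tensor_rep \<rho> \<pi> (exp (t *\<^sub>R spin_lift X))) has_vector_derivative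
      kron (\<rho> (spin_lift X)) (mat 1) + kron (mat 1) (d_rep \<pi> X)) (at 0)"
    by (simp add: tensor_rep_def \<rho>(2) add.commute)
  then show ?thesis unfolding d_rep_def by (rule vector_derivative_at)
qed

lemma d_rep_sum:
  fixes \<pi> :: "'n::{finite,linorder} cliff \<Rightarrow> complex^'k^'k"
  assumes G: "compact_connected_subgroup G" and \<pi>: "unitary_rep G \<pi>"
    and sub: "subspace (lie_algebra G)" and B: "finite B" "B \<subseteq> lie_algebra G"
  shows "d_rep \<pi> (\<Sum>X\<in>B. c X *\<^sub>R X) = (\<Sum>X\<in>B. c X *\<^sub>R d_rep \<pi> X)"
  using B
proof (induction B)
  case empty
  have "d_rep \<pi> (0 *\<^sub>R 0) = 0 *\<^sub>R d_rep \<pi> 0"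
    by (rule d_rep_scaleR [OF \<pi> subspace_0 [OF sub]])
  then show ?case by simp
next
  case (insert X B)
  then have "c X *\<^sub>R X \<in> lie_algebra G" "(\<Sum>X\<in>B. c X *\<^sub>R X) \<in> lie_algebra G" "X \<in> lie_algebra G"
    by (auto intro!: subspace_sum [OF sub] subspace_scale [OF sub])
  moreover from this have "c X *\<^sub>R X + (\<Sum>X\<in>B. c X *\<^sub>R X) \<in> lie_algebra G"
    by (intro subspace_add [OF sub])
  ultimately show ?case
    using insert by (simp add: d_rep_add [OF G \<pi>] d_rep_scaleR [OF \<pi>])
qed

section \<open>Contractions with a symmetric operator on the skew matrices\<close>

lemma lie_algebra_skew: "X \<in> lie_algebra G \<Longrightarrow> transpose X = - X"
  by (simp add: lie_algebra_def)

text \<open>Isolates the properties of the curvature operator that enter the contraction. Symmetry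
  is required against all skew matrices, while the values and the basis lie in V, which becomes the
  Lie algebra.\<close>

locale symmetric_basis_operator =
  fixes B V and T :: "'n::{finite,linorder} rmat \<Rightarrow> 'n rmat"
  assumes B: "orthonormal_basis B V" and V: "\<And>X. X \<in> V \<Longrightarrow> transpose X = - X"
    and TV: "\<And>X. T X \<in> V"
    and sym: "\<And>X Y. transpose X = - X \<Longrightarrow> transpose Y = - Y \<Longrightarrow> so_inner (T X) Y = so_inner X (T Y)"
begin

lemma finite_basis: "finite B" and basis_in: "X \<in> B \<Longrightarrow> X \<in> V"
  using orthonormal_basis_finite [OF B] B unfolding orthonormal_basis_def by blast+

text \<open>X may lie outside V: T X is expanded in the basis, and symmetry moves T to the basis
  element. In effect T vanishes on the orthogonal complement of V in the skew matrices.\<close>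

lemma T_expansion:
  assumes "transpose X = - X"
  shows "T X = (\<Sum>Y\<in>B. so_inner X (T Y) *\<^sub>R Y)"
proof -
  have "T X = (\<Sum>Y\<in>B. so_inner (T X) Y *\<^sub>R Y)" by (rule orthonormal_basis_expansion [OF B TV])
  then show ?thesis by (simp add: sym assms V basis_in)
qed

text \<open>T of a bivector is expanded in B, and the bivectors are resummed against their
  coefficients to T X. D has to respect only combinations of B, because d\<pi> is linear only on the
  Lie algebra.\<close>

lemma sum_frame_eq_sum_basis:
  fixes f :: "'n \<Rightarrow> 'n rvec"
  assumes \<beta>: "bounded_bilinear \<beta>" and s: "linear s"
    and D: "\<And>c. D (\<Sum>X\<in>B. c X *\<^sub>R X) = (\<Sum>X\<in>B. c X *\<^sub>R D X)"
    and f: "\<And>i j. f i \<bullet> f j = (if i = j then 1 else 0)"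
  shows "(\<Sum>i\<in>UNIV. \<Sum>j\<in>{i<..}. \<beta> (s (wedge (f i) (f j))) (D (T (wedge (f i) (f j))))) = (\<Sum>X\<in>B. \<beta> (s (T X)) (D X))"
proof -
  interpret bounded_bilinear \<beta> by fact
  interpret s: linear s by fact
  define w where "w i j = wedge (f i) (f j)" for i j
  have "\<beta> (s (w i j)) (D (T (w i j))) = (\<Sum>X\<in>B. \<beta> (s (so_inner (T X) (w i j) *\<^sub>R w i j)) (D X))" for i j
  proof -
    have "D (T (w i j)) = (\<Sum>X\<in>B. so_inner (w i j) (T X) *\<^sub>R D X)"
      unfolding T_expansion [of "w i j", unfolded w_def, OF transpose_wedge, folded w_def] by (rule D)
    then show ?thesis
      by (simp add: sum_right scaleR_right scaleR_left s.scale so_inner_conv_inner inner_commute)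
  qed
  then have "(\<Sum>i\<in>UNIV. \<Sum>j\<in>{i<..}. \<beta> (s (w i j)) (D (T (w i j)))) =
      (\<Sum>i\<in>UNIV. \<Sum>X\<in>B. \<Sum>j\<in>{i<..}. \<beta> (s (so_inner (T X) (w i j) *\<^sub>R w i j)) (D X))"
    by (simp add: sum.swap [of _ B])
  also have "\<dots> = (\<Sum>X\<in>B. \<Sum>i\<in>UNIV. \<Sum>j\<in>{i<..}. \<beta> (s (so_inner (T X) (w i j) *\<^sub>R w i j)) (D X))"
    by (rule sum.swap)
  also have "\<dots> = (\<Sum>X\<in>B. \<beta> (s (\<Sum>i\<in>UNIV. \<Sum>j\<in>{i<..}. so_inner (T X) (w i j) *\<^sub>R w i j)) (D X))"
    by (simp only: sum_left s.sum)
  also have "\<dots> = (\<Sum>X\<in>B. \<beta> (s (T X)) (D X))"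
  proof -
    have "(\<Sum>i\<in>UNIV. \<Sum>j\<in>{i<..}. so_inner (T X) (w i j) *\<^sub>R w i j) = T X" for X
      unfolding w_def by (rule wedge_frame_expansion) (simp_all add: f V TV)
    then show ?thesis by simp
  qed
  finally show ?thesis by (simp only: w_def)
qed

text \<open>The matrix of T in B is symmetric, so T moves from one argument to the other. This
  identifies the two mixed terms in K of the tensor representation.\<close>

lemma sum_basis_symmetric:
  assumes \<beta>: "bounded_bilinear \<beta>"
    and S: "\<And>c. S (\<Sum>X\<in>B. c X *\<^sub>R X) = (\<Sum>X\<in>B. c X *\<^sub>R S X)"
    and D: "\<And>c. D (\<Sum>X\<in>B. c X *\<^sub>R X) = (\<Sum>X\<in>B. c X *\<^sub>R D X)"
  shows "(\<Sum>X\<in>B. \<beta> (S X) (D (T X))) = (\<Sum>X\<in>B. \<beta> (S (T X)) (D X))"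
proof -
  interpret bounded_bilinear \<beta> by fact
  have T: "T X = (\<Sum>Y\<in>B. so_inner X (T Y) *\<^sub>R Y)" if "X \<in> B" for X
    using T_expansion V basis_in that by blast
  have "(\<Sum>X\<in>B. \<beta> (S X) (D (T X))) = (\<Sum>X\<in>B. \<Sum>Y\<in>B. so_inner X (T Y) *\<^sub>R \<beta> (S X) (D Y))"
    by (intro sum.cong refl) (simp only: T D sum_right scaleR_right)
  also have "\<dots> = (\<Sum>Y\<in>B. \<Sum>X\<in>B. so_inner Y (T X) *\<^sub>R \<beta> (S X) (D Y))"
    by (subst sum.swap) (intro sum.cong refl, metis V basis_in sym so_inner_conv_inner inner_commute)
  also have "\<dots> = (\<Sum>Y\<in>B. \<beta> (S (T Y)) (D Y))"
    by (intro sum.cong refl) (simp only: T S sum_left scaleR_left)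
  finally show ?thesis .
qed

text \<open>The constant collects 1/2 from the lift of a basis bivector, 1/4 from the lift of its
  image as a full double sum, 1/2 from passing from i < j to all pairs, and -2 from
  \<open>clifford_contraction\<close>.\<close>

lemma sum_basis_spin_lift:
  assumes r: "curvature_tensor r" and T: "\<And>a b c d. T (wedge (axis a 1) (axis b 1)) $ d $ c = r a b c d"
  shows "(\<Sum>X\<in>B. spin_lift (T X) * spin_lift X) = (- (1/8) * (\<Sum>a\<in>UNIV. \<Sum>b\<in>UNIV. r a b a b)) *\<^sub>R 1"
proof -
  interpret r: curvature_tensor r by fact
  interpret lift: bounded_linear "spin_lift :: 'n rmat \<Rightarrow> _" by (rule bounded_linear_spin_lift)
  define w :: "'n \<Rightarrow> 'n \<Rightarrow> 'n rmat" where "w a b = wedge (axis a 1) (axis b 1)" for a b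
  define e :: "'n \<Rightarrow> 'n cliff" where "e a = cliff_basis {a}" for a
  have prod: "spin_lift (w a b) * spin_lift (T (w a b)) =
      (1/8) *\<^sub>R (\<Sum>c\<in>UNIV. \<Sum>d\<in>UNIV. r a b c d *\<^sub>R (e a * e b * e c * e d))" for a b
  proof -
    have lT: "spin_lift (T (w a b)) = (1/4) *\<^sub>R (\<Sum>c\<in>UNIV. \<Sum>d\<in>UNIV. r a b c d *\<^sub>R (e c * e d))"
      unfolding spin_lift_skew [OF V [OF TV]] by (simp add: T w_def e_def)
    show ?thesis
    proof (cases "a = b")
      case True
      then have "r a b c d = 0" for c d using r.antisym12 [of a b c d] by simp
      then show ?thesis by (simp add: lT)
    next
      case False
      then have "spin_lift (w a b) = (1/2) *\<^sub>R (e a * e b)"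
        using spin_lift_wedge [of "axis a 1" "axis b 1"] by (simp add: e_def w_def inner_axis_axis)
      then show ?thesis by (simp add: lT sum_distrib_left scaleR_sum_right mult.assoc)
    qed
  qed
  have wba: "w b a = - w a b" for a b by (simp add: w_def wedge_def vec_eq_iff)
  have Tba: "T (w b a) = - T (w a b)" for a b
    by (simp add: vec_eq_iff T w_def r.antisym12 [of b a])
  have "(\<Sum>X\<in>B. spin_lift (T X) * spin_lift X) = (\<Sum>a\<in>UNIV. \<Sum>b\<in>{a<..}. spin_lift (w a b) * spin_lift (T (w a b)))"
    unfolding w_def
    by (rule sum_frame_eq_sum_basis [OF bounded_bilinear_mult lift.linear, symmetric])
      (simp_all add: lift.sum lift.scaleR inner_axis_axis)
  also have "\<dots> = (1/2) *\<^sub>R (\<Sum>a\<in>UNIV. \<Sum>b\<in>UNIV. spin_lift (w a b) * spin_lift (T (w a b)))"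
  proof (rule sum_less_symmetric)
    show "spin_lift (w b a) * spin_lift (T (w b a)) = spin_lift (w a b) * spin_lift (T (w a b))" for a b
    proof -
      have "spin_lift (w b a) = - spin_lift (w a b)" by (subst wba) (rule lift.neg)
      moreover have "spin_lift (T (w b a)) = - spin_lift (T (w a b))" by (subst Tba) (rule lift.neg)
      ultimately show ?thesis by simp
    qed
    have "w a a = 0" for a by (simp add: w_def wedge_def vec_eq_iff)
    then show "spin_lift (w a a) * spin_lift (T (w a a)) = 0" for a by (simp add: lift.zero)
  qed
  also have "\<dots> = (1/16) *\<^sub>R (\<Sum>a\<in>UNIV. \<Sum>b\<in>UNIV. \<Sum>c\<in>UNIV. \<Sum>d\<in>UNIV. r a b c d *\<^sub>R (e a * e b * e c * e d))"
    unfolding prod scaleR_sum_right [symmetric] scaleR_scaleR by simp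
  also have "(\<Sum>a\<in>UNIV. \<Sum>b\<in>UNIV. \<Sum>c\<in>UNIV. \<Sum>d\<in>UNIV. r a b c d *\<^sub>R (e a * e b * e c * e d)) =
      (- 2 * (\<Sum>a\<in>UNIV. \<Sum>b\<in>UNIV. r a b a b)) *\<^sub>R 1"
    by (rule r.clifford_contraction) (simp add: e_def clifford_relation)
  finally show ?thesis by simp
qed

end

section \<open>The identity at a spin frame and on the fibres\<close>

context closed_spin_manifold
begin

lemma weitzenboeck_eq:
  fixes \<rho> :: "'n cliff \<Rightarrow> complex^'s^'s" and \<pi> :: "'n cliff \<Rightarrow> complex^'k^'k"
  assumes G: "compact_connected_subgroup G" and hol: "holonomy_group M u \<subseteq> G"
    and \<pi>: "unitary_rep G \<pi>" and \<rho>: "linear \<rho>" "\<rho> 1 = mat 1" "\<And>a b. \<rho> (a * b) = \<rho> a ** \<rho> b"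
    and B: "orthonormal_basis B (lie_algebra G)" and c: "(D, \<phi>) \<in> charts M"
    and q: "q \<in> reduction M G u" and qD: "base M q \<in> D"
    and e: "\<And>i j. e i \<bullet> (gram M (D, \<phi>) (\<phi> (base M q)) *v e j) = (if i = j then 1 else 0)"
  shows "weitzenboeck M (D, \<phi>) \<rho> \<pi> e q = K_endo M (D, \<phi>) B (tensor_rep \<rho> \<pi>) q
    + (scal M (D, \<phi>) (\<phi> (base M q)) / 8) *\<^sub>R mat 1 - kron (mat 1) (K_endo M (D, \<phi>) B \<pi> q)"
proof -
  interpret kron: bounded_bilinear "kron :: complex^'s^'s \<Rightarrow> complex^'k^'k \<Rightarrow> _"
    by (rule bounded_bilinear_kron)
  interpret mm: bounded_bilinear "(**) :: complex^('s \<times> 'k)^('s \<times> 'k) \<Rightarrow> complex^('s \<times> 'k)^('s \<times> 'k) \<Rightarrow> _"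
    by (rule bounded_bilinear_matrix_mult)
  interpret \<rho>: linear \<rho> by (rule \<rho>(1))
  have sub: "subspace (lie_algebra G)" by (rule orthonormal_basis_subspace [OF B])
  define T where "T = curvature_operator M (D, \<phi>) q"
  define r where "r a b c d = - frame_curvature M (D, \<phi>) q a b $ d $ c" for a b c d
  have tens: "curvature_tensor r"
    unfolding r_def by (rule frame_curvature_tensor [OF c qD G hol q sub])
  have TG: "T X \<in> lie_algebra G" for X
    unfolding T_def by (rule curvature_operator_in_lie_algebra [OF c qD G hol q sub])
  interpret symmetric_basis_operator B "lie_algebra G" T
  proof
    show "so_inner (T X) Y = so_inner X (T Y)" if "transpose X = - X" "transpose Y = - Y" for X Y
      unfolding T_def by (rule curvature_operator_symmetric [OF c qD tens [unfolded r_def] that])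
  qed (use B TG lie_algebra_skew in auto)
  define s where "s X = \<rho> (spin_lift X)" for X
  have s: "linear s"
    unfolding s_def by (rule linearI) (simp_all add: spin_lift_linear \<rho>.add \<rho>.scale)
  interpret s: linear s by (rule s)
  have p_sum: "d_rep \<pi> (\<Sum>X\<in>B. c X *\<^sub>R X) = (\<Sum>X\<in>B. c X *\<^sub>R d_rep \<pi> X)" for c
    by (rule d_rep_sum [OF G \<pi> sub finite_basis]) (use basis_in in blast)
  have s_sum: "s (\<Sum>X\<in>B. c X *\<^sub>R X) = (\<Sum>X\<in>B. c X *\<^sub>R s X)" for c
    by (simp add: s.sum s.scale)
  define D' where "D' = d_rep (tensor_rep \<rho> \<pi>)"
  have D': "D' X = kron (s X) (mat 1) + kron (mat 1) (d_rep \<pi> X)" if "X \<in> lie_algebra G" for X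
    unfolding D'_def s_def by (rule d_rep_tensor [OF \<rho>(1,2) \<pi> that])
  have D'_sum: "D' (\<Sum>X\<in>B. c X *\<^sub>R X) = (\<Sum>X\<in>B. c X *\<^sub>R D' X)" for c
  proof -
    have "(\<Sum>X\<in>B. c X *\<^sub>R X) \<in> lie_algebra G"
      by (intro subspace_sum [OF sub] subspace_scale [OF sub] basis_in)
    then show ?thesis
      by (simp add: D' basis_in s_sum p_sum kron.sum_left kron.sum_right kron.scaleR_left kron.scaleR_right
          scaleR_add_right sum.distrib)
  qed
  define f where "f i = in_frame M (D, \<phi>) q (e i)" for i
  \<comment> \<open>The tangent frame e and the spin frame q are both orthonormal, so the components
    of e in q form an orthonormal basis of Euclidean space.\<close>
  have f: "f i \<bullet> f j = (if i = j then 1 else 0)" for i j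
  proof -
    define F where "F = frame M (D, \<phi>) q"
    define g where "g = gram M (D, \<phi>) (\<phi> (base M q))"
    have inv: "matrix_inv F = transpose F ** g" "F ** matrix_inv F = mat 1"
      using frame_matrix_inv [OF c qD] by (simp_all add: F_def g_def)
    have "transpose g = g" using gram_sym [OF c qD] by (simp add: g_def)
    then have "transpose (matrix_inv F) ** matrix_inv F = g ** (F ** matrix_inv F)"
      unfolding inv(1) matrix_transpose_mul by (simp add: matrix_mul_assoc)
    then have "transpose (matrix_inv F) ** matrix_inv F = g" by (simp add: inv(2))
    moreover have "f i \<bullet> f j = e i \<bullet> ((transpose (matrix_inv F) ** matrix_inv F) *v e j)"
      unfolding f_def in_frame_def F_def [symmetric]
      by (metis dot_lmul_matrix matrix_vector_mul_assoc transpose_matrix_vector transpose_transpose)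
    ultimately show ?thesis using e [of i j] by (simp add: g_def)
  qed
  define \<beta> :: "complex^'s^'s \<Rightarrow> complex^('s \<times> 'k)^('s \<times> 'k) \<Rightarrow> _" where "\<beta> a b = kron a (mat 1) ** b" for a b
  have \<beta>: "bounded_bilinear \<beta>"
    unfolding \<beta>_def by (rule mm.comp1 [OF kron.bounded_linear_left])
  \<comment> \<open>P, Q and N are the pure spinor, mixed and pure \<pi> parts. The three terms
    become -2(P + Q) for the curvature endomorphism, -(P + 2Q + N) for K of the tensor
    representation and -N for K of \<pi>, so the claim reduces to -P = scal/8.\<close>
  define P where "P = (\<Sum>X\<in>B. kron (s (T X) ** s X) (mat 1 :: complex^'k^'k))"
  define Q where "Q = (\<Sum>X\<in>B. kron (s (T X)) (d_rep \<pi> X))"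
  define N where "N = (\<Sum>X\<in>B. kron (mat 1 :: complex^'s^'s) (d_rep \<pi> (T X) ** d_rep \<pi> X))"
  have Q': "(\<Sum>X\<in>B. kron (s X) (d_rep \<pi> (T X))) = Q"
    unfolding Q_def by (rule sum_basis_symmetric [OF bounded_bilinear_kron s_sum p_sum])
  have W: "weitzenboeck M (D, \<phi>) \<rho> \<pi> e q = - 2 *\<^sub>R (P + Q)"
  proof -
    have "weitzenboeck M (D, \<phi>) \<rho> \<pi> e q = (\<Sum>i\<in>UNIV. \<Sum>j\<in>{i<..}. - 2 *\<^sub>R \<beta> (s (wedge (f i) (f j))) (D' (T (wedge (f i) (f j)))))"
      unfolding weitzenboeck_def
    proof (intro sum.cong refl)
      fix i j :: 'n assume "j \<in> {i<..}"
      \<comment> \<open>For i < j the vectors are orthogonal, so their Clifford product is twice the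
        lifted bivector. Together with the minus sign in \<open>assoc_curvature\<close> this gives
        the factor -2.\<close>
      then have "cvec (f i) * cvec (f j) = 2 *\<^sub>R spin_lift (wedge (f i) (f j))"
        using spin_lift_wedge [of "f i" "f j"] f [of i j] by auto
      then have "\<rho> (cvec (f i)) ** \<rho> (cvec (f j)) = 2 *\<^sub>R s (wedge (f i) (f j))"
        by (simp add: s_def \<rho>.scale flip: \<rho>(3))
      then show "kron (clifford_mult M (D, \<phi>) \<rho> (e i) q ** clifford_mult M (D, \<phi>) \<rho> (e j) q) (mat 1) **
          assoc_curvature M (D, \<phi>) (tensor_rep \<rho> \<pi>) (e i) (e j) q = - 2 *\<^sub>R \<beta> (s (wedge (f i) (f j))) (D' (T (wedge (f i) (f j))))"
        by (simp add: clifford_mult_def assoc_curvature_def f_def \<beta>_def D'_def T_def kron.scaleR_left mm.scaleR_left mm.minus_right)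
    qed
    also have "\<dots> = - 2 *\<^sub>R (\<Sum>i\<in>UNIV. \<Sum>j\<in>{i<..}. \<beta> (s (wedge (f i) (f j))) (D' (T (wedge (f i) (f j)))))"
      by (simp only: scaleR_sum_right)
    also have "(\<Sum>i\<in>UNIV. \<Sum>j\<in>{i<..}. \<beta> (s (wedge (f i) (f j))) (D' (T (wedge (f i) (f j))))) = (\<Sum>X\<in>B. \<beta> (s (T X)) (D' X))"
      by (rule sum_frame_eq_sum_basis [OF \<beta> s D'_sum f])
    also have "\<dots> = P + Q"
      by (simp add: \<beta>_def D' basis_in P_def Q_def mm.add_right kron_mult sum.distrib)
    finally show ?thesis .
  qed
  have K: "K_endo M (D, \<phi>) B (tensor_rep \<rho> \<pi>) q = - (P + Q + Q + N)"
  proof -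
    have "D' (T X) ** D' X = kron (s (T X) ** s X) (mat 1) + kron (s (T X)) (d_rep \<pi> X)
        + kron (s X) (d_rep \<pi> (T X)) + kron (mat 1) (d_rep \<pi> (T X) ** d_rep \<pi> X)" if "X \<in> B" for X
      by (simp add: D' TG basis_in that mm.add_left mm.add_right kron_mult add_ac)
    then have "(\<Sum>X\<in>B. D' (T X) ** D' X) = P + Q + Q + N"
      by (simp add: sum.distrib Q' flip: P_def Q_def N_def)
    then show ?thesis by (simp add: K_endo_def D'_def T_def)
  qed
  have K\<pi>: "kron (mat 1) (K_endo M (D, \<phi>) B \<pi> q) = - N"
    by (simp add: K_endo_def N_def T_def kron.minus_right kron.sum_right)
  \<comment> \<open>The scalar identity holds already in the Clifford algebra and is carried over by
    the multiplicative linear map \<rho>.\<close>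
  have "P = - (scal M (D, \<phi>) (\<phi> (base M q)) / 8) *\<^sub>R mat 1"
  proof -
    have "r a b a b = frame_curvature M (D, \<phi>) q a b $ a $ b" for a b
      using curvature_tensor.antisym34 [OF tens, of a b b a] by (simp add: r_def)
    then have "(\<Sum>X\<in>B. spin_lift (T X) * spin_lift X) = (- (1/8) * scal M (D, \<phi>) (\<phi> (base M q))) *\<^sub>R 1"
      using sum_basis_spin_lift [OF tens] by (simp add: scal_frame [OF c qD] T_def curvature_operator_wedge_axis r_def)
    then have "\<rho> (\<Sum>X\<in>B. spin_lift (T X) * spin_lift X) = (- (1/8) * scal M (D, \<phi>) (\<phi> (base M q))) *\<^sub>R mat 1"
      by (simp only: \<rho>.scale \<rho>(2))
    then have "(\<Sum>X\<in>B. s (T X) ** s X) = (- (1/8) * scal M (D, \<phi>) (\<phi> (base M q))) *\<^sub>R mat 1"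
      by (simp only: \<rho>.sum \<rho>(3) s_def)
    moreover have "P = kron (\<Sum>X\<in>B. s (T X) ** s X) (mat 1)"
      by (simp add: P_def kron.sum_left)
    ultimately show ?thesis by (simp add: kron.scaleR_left kron.minus_left kron_mat_one)
  qed
  then have "(scal M (D, \<phi>) (\<phi> (base M q)) / 8) *\<^sub>R mat 1 = - P" by simp
  moreover have "- 2 *\<^sub>R (P + Q) = - (P + Q) - (P + Q)"
    by (simp only: scaleR_minus_left scaleR_2) (simp only: minus_add_distrib diff_conv_add_uminus)
  ultimately show ?thesis
    unfolding W K K\<pi> by simp
qed

end

lemma bundle_endo_cong:
  assumes "\<And>q \<psi>. (q, \<psi>) \<in> z \<Longrightarrow> T q = T' q"
  shows "bundle_endo T z = bundle_endo T' z"
  unfolding bundle_endo_def using assms by auto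

theorem lemma4p3:
  fixes M :: "('m::t2_space, 'n::{finite,linorder}, 'p::topological_space) spin_data"
    and G :: "'n cliff set" and u :: 'p
    and \<pi>\<^sub>S :: "'n cliff \<Rightarrow> complex^'s^'s"
    and \<pi> :: "'n cliff \<Rightarrow> complex^'k^'k"
    and B :: "('n rmat) set"
    and c :: "('m, 'n) chart" and x :: 'm and e :: "'n \<Rightarrow> 'n rvec"
    and z :: "('p \<times> (complex^('s \<times> 'k))) set"
  assumes "closed_spin_manifold M"
    and "compact_connected_subgroup G"
    and "holonomy_group M u \<subseteq> G"
    and "unitary_rep G \<pi>"
    and "spinor_module \<pi>\<^sub>S"
    and "orthonormal_basis B (lie_algebra G)"
    and "c \<in> charts M" and "x \<in> fst c"
    and "\<And>i j. e i \<bullet> (gram M c (snd c x) *v e j) = (if i = j then 1 else 0)"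
    and "z \<in> assoc_fibre M G (reduction M G u) (tensor_rep \<pi>\<^sub>S \<pi>) x"
  shows "bundle_endo (weitzenboeck M c \<pi>\<^sub>S \<pi> e) z =
    bundle_endo (\<lambda>q. K_endo M c B (tensor_rep \<pi>\<^sub>S \<pi>) q + (scal M c (snd c x) / 8) *\<^sub>R mat 1
      - kron (mat 1) (K_endo M c B \<pi> q)) z"
proof -
  interpret closed_spin_manifold M by fact
  obtain D \<phi> where c: "c = (D, \<phi>)" by (cases c)
  obtain q0 \<psi>0 where z: "z = assoc_class M G (tensor_rep \<pi>\<^sub>S \<pi>) q0 \<psi>0" "q0 \<in> reduction M G u" "base M q0 = x"
    using assms(10) by (auto simp: assoc_fibre_def)
  \<comment> \<open>The frames occurring in z form a G-orbit, which stays over x and inside the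
    reduction, so the matrix identity applies at each of them.\<close>
  have "weitzenboeck M c \<pi>\<^sub>S \<pi> e q = K_endo M c B (tensor_rep \<pi>\<^sub>S \<pi>) q + (scal M c (snd c x) / 8) *\<^sub>R mat 1
      - kron (mat 1) (K_endo M c B \<pi> q)" if zq: "(q, \<psi>) \<in> z" for q \<psi>
  proof -
    obtain a where a: "a \<in> G" "q = act M q0 a"
      using zq unfolding z(1) assoc_class_def by auto
    have "a \<in> spin_group" using a(1) assms(2) by (auto simp: compact_connected_subgroup_def)
    then have base: "base M q = x" by (simp add: a(2) act_base z(3))
    have q: "q \<in> reduction M G u" unfolding a(2) by (rule reduction_act [OF assms(2) z(2) a(1)])
    have \<rho>: "linear \<pi>\<^sub>S" "\<pi>\<^sub>S 1 = mat 1" "\<And>a b. \<pi>\<^sub>S (a * b) = \<pi>\<^sub>S a ** \<pi>\<^sub>S b"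
      using assms(5) by (auto simp: spinor_module_def)
    show ?thesis
      using weitzenboeck_eq [OF assms(2-4) \<rho> assms(6) assms(7) [unfolded c] q] assms(8,9) by (simp add: c base)
  qed
  then show ?thesis by (rule bundle_endo_cong)
qed

end
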